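(* For every triple of integers $m,k,n$ satisfying $1\le m<k\le n-1$ and $n>(m+2)(k+2)-2$, there exists an origin-symmetric $C^2_+$ convex body $K\subset\mathbb{R}^n$ such that $$I_{m,-n}(K)^{1/m}<I_{k,-n}(K)^{1/k}.$$ Consequently, the chain of inequalities $$I_{1,p}(K)\ge I_{2,p}(K)^{1/2}\ge\cdots\ge I_{k,p}(K)^{1/k}\ge\cdots\ge I_{n,p}(K)^{1/n}=1$$ does not hold in full generality at $p=-n$; that is, it is not true that for all $n$ and all convex bodies $K\subset\mathbb{R}^n$ this chain holds with $p=-n$.
   Context: A convex body in $\mathbb{R}^n$ is a compact convex set with non-empty interior. $K$ is origin-symmetric if $K=-K$. The support function of $K$ is $h_K(u)=\max_{x\in K}\langle x,u\rangle$. A convex body is $C^2_+$ if its support function restricted to the unit sphere $\mathbb{S}^{n-1}$ is $C^2$ and the curvature matrix $\nabla^2h_K+h_Kg$ is positive definite at every point of $\mathbb{S}^{n-1}$, where $g$ is the round metric and $\nabla^2$ is the covariant Hessian on $\mathbb{S}^{n-1}$. $G_{n,k}$ denotes the Grassmannian of $k$-dimensional linear subspaces of $\mathbb{R}^n$ with its rotation-invariant probability measure $dF$. $P_F$ is orthogonal projection onto $F$, and $\mathrm{vol}_k$ is $k$-dimensional volume. For a convex body $K\subset\mathbb{R}^n$, $B_K$ is the Euclidean ball centered at the origin with $\mathrm{vol}_n(B_K)=\mathrm{vol}_n(K)$. For $p\neq0$ and $1\le k\le n$, define $$I_{k,p}(K)=\left(\frac{\int_{G_{n,k}}\mathrm{vol}_k(P_FK)^p\,dF}{\int_{G_{n,k}}\mathrm{vol}_k(P_FB_K)^p\,dF}\right)^{1/p}.$$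 *)

theory Defs
  imports "HOL-Analysis.Analysis" "HOL-Probability.Probability_Measure"
begin

text \<open>
  Everything below is relative to a finite-dimensional linear subspace \<open>E\<close> of a real inner
  product space, which plays the role of Euclidean space. For \<open>E = UNIV :: (real ^ 'n) set\<close> these
  are the usual notions in dimension \<open>CARD('n)\<close>. Statements that quantify over the dimension
  inside a formula take \<open>E = coord_space n\<close>, the span of the first \<open>n\<close> coordinate
  vectors in the space of finitely supported real sequences defined at the end.
\<close>

section \<open>Convex bodies\<close>

definition convex_body_in :: "'a::real_inner set \<Rightarrow> 'a set \<Rightarrow> bool" where
  "convex_body_in E K \<longleftrightarrow>
     K \<subseteq> E \<and> compact K \<and> convex K \<and> (top_of_set E) interior_of K \<noteq> {}"

lemma convex_body_in_UNIV:
  "convex_body_in UNIV K \<longleftrightarrow> compact K \<and> convex K \<and> interior K \<noteq> {}"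
  by (simp add: convex_body_in_def)

definition origin_symmetric :: "'a::real_inner set \<Rightarrow> bool" where
  "origin_symmetric K \<longleftrightarrow> K = uminus ` K"

definition support_fun :: "'a::real_inner set \<Rightarrow> 'a \<Rightarrow> real" where
  "support_fun K u = (SUP x\<in>K. x \<bullet> u)"

text \<open>
  Calculus on the unit sphere \<open>S\<close> of \<open>E\<close> uses the radial extension \<open>\<lambda>y. f (sgn y)\<close>,
  where \<open>sgn y = y /\<^sub>R norm y\<close>, of a function \<open>f\<close> on \<open>S\<close>. Its radial derivative vanishes, so at a
  point of \<open>S\<close> its gradient \<open>G\<close> is tangent to \<open>S\<close> and is the Riemannian gradient of \<open>f\<close>. The
  Levi-Civita connection of \<open>S\<close> is the tangential part of the Euclidean one, so for tangent
  vectors \<open>v\<close>, \<open>w\<close> at \<open>u\<close> the covariant Hessian of \<open>f\<close> is \<open>H u v \<bullet> w\<close>, with \<open>H\<close> the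
  derivative of \<open>G\<close>. Both \<open>G\<close> and \<open>H x\<close> on \<open>E\<close> are determined by \<open>f\<close>.
\<close>

definition sphere_grad_hess ::
  "'a::real_inner set \<Rightarrow> ('a \<Rightarrow> real) \<Rightarrow> ('a \<Rightarrow> 'a) \<Rightarrow> ('a \<Rightarrow> 'a \<Rightarrow> 'a) \<Rightarrow> bool" where
  "sphere_grad_hess E f G H \<longleftrightarrow>
     (\<forall>x\<in>E - {0}. G x \<in> E \<and>
        ((\<lambda>y. f (sgn y)) has_derivative (\<lambda>v. G x \<bullet> v)) (at x within E) \<and>
        (G has_derivative H x) (at x within E))"

definition C2_plus :: "'a::real_inner set \<Rightarrow> 'a set \<Rightarrow> bool" where
  "C2_plus E K \<longleftrightarrow>
     (\<exists>G H. sphere_grad_hess E (support_fun K) G H \<and>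
        (\<forall>v\<in>E. continuous_on (E - {0}) (\<lambda>x. H x v)) \<and>
        (\<forall>u\<in>E. norm u = 1 \<longrightarrow>
           (\<forall>v\<in>E. v \<bullet> u = 0 \<and> v \<noteq> 0 \<longrightarrow>
              0 < H u v \<bullet> v + support_fun K u * (v \<bullet> v))))"

section \<open>Projections and volume on subspaces\<close>

definition orth_proj :: "'a::real_inner set \<Rightarrow> 'a \<Rightarrow> 'a" where
  "orth_proj F x = (THE y. y \<in> F \<and> (\<forall>z\<in>F. (x - y) \<bullet> z = 0))"

definition orthonormal_basis :: "'a::real_inner set \<Rightarrow> 'a set \<Rightarrow> bool" where
  "orthonormal_basis F B \<longleftrightarrow>
     pairwise orthogonal B \<and> (\<forall>b\<in>B. norm b = 1) \<and> span B = F"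

text \<open>
  Lebesgue measure on the finite-dimensional subspace \<open>F\<close>, built as \<open>lborel\<close> is in the library,
  with an orthonormal basis of \<open>F\<close> in place of \<open>Basis\<close>. It does not depend on the basis chosen.
\<close>

definition subspace_lborel :: "'a::real_inner set \<Rightarrow> 'a measure" where
  "subspace_lborel F =
     (let B = (SOME B. orthonormal_basis F B)
      in distr (\<Pi>\<^sub>M b\<in>B. lborel) borel (\<lambda>c. \<Sum>b\<in>B. c b *\<^sub>R b))"

definition vol :: "'a::real_inner set \<Rightarrow> 'a set \<Rightarrow> real" where
  "vol F A = measure (subspace_lborel F) A"

definition vol_ball :: "'a::real_inner set \<Rightarrow> 'a set \<Rightarrow> 'a set" where
  "vol_ball E K = (THE B. \<exists>r\<ge>0. B = cball 0 r \<inter> E \<and> vol E B = vol E K)"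

section \<open>The Grassmannian\<close>

definition grassmannian :: "'a::real_inner set \<Rightarrow> nat \<Rightarrow> 'a set set" where
  "grassmannian E k = {F. subspace F \<and> F \<subseteq> E \<and> dim F = k}"

text \<open>The gap metric, which induces the usual topology of the Grassmannian.\<close>

definition gap :: "'a::real_inner set \<Rightarrow> 'a set \<Rightarrow> real" where
  "gap F F' = onorm (\<lambda>x. orth_proj F x - orth_proj F' x)"

definition grassmann_borel :: "'a::real_inner set \<Rightarrow> nat \<Rightarrow> 'a set measure" where
  "grassmann_borel E k =
     sigma (grassmannian E k)
       {U. U \<subseteq> grassmannian E k \<and>
          (\<forall>F\<in>U. \<exists>e>0. \<forall>F'\<in>grassmannian E k. gap F F' < e \<longrightarrow> F' \<in> U)}"

definition rotation_invariant_prob ::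
  "'a::real_inner set \<Rightarrow> nat \<Rightarrow> 'a set measure \<Rightarrow> bool" where
  "rotation_invariant_prob E k \<mu> \<longleftrightarrow>
     sets \<mu> = sets (grassmann_borel E k) \<and> prob_space \<mu> \<and>
     (\<forall>T. orthogonal_transformation T \<and> T ` E = E \<longrightarrow> distr \<mu> \<mu> ((`) T) = \<mu>)"

text \<open>There is exactly one such measure, so the choice is immaterial.\<close>

definition grassmann_measure :: "'a::real_inner set \<Rightarrow> nat \<Rightarrow> 'a set measure" where
  "grassmann_measure E k = (SOME \<mu>. rotation_invariant_prob E k \<mu>)"

section \<open>Normalized moments of projection volumes\<close>

definition proj_moment :: "'a::real_inner set \<Rightarrow> nat \<Rightarrow> real \<Rightarrow> 'a set \<Rightarrow> real" where
  "proj_moment E k p K = (\<integral>F. vol F (orth_proj F ` K) powr p \<partial>grassmann_measure E k)"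

definition I_fun :: "'a::real_inner set \<Rightarrow> nat \<Rightarrow> real \<Rightarrow> 'a set \<Rightarrow> real" where
  "I_fun E k p K =
     (proj_moment E k p K / proj_moment E k p (vol_ball E K)) powr (1 / p)"

definition I_chain :: "'a::real_inner set \<Rightarrow> real \<Rightarrow> 'a set \<Rightarrow> bool" where
  "I_chain E p K \<longleftrightarrow>
     (\<forall>k. 1 \<le> k \<and> k < dim E \<longrightarrow>
        I_fun E k p K powr (1 / real k) \<ge> I_fun E (k + 1) p K powr (1 / real (k + 1))) \<and>
     I_fun E (dim E) p K powr (1 / real (dim E)) = 1"

section \<open>Coordinate spaces of variable dimension\<close>

text \<open>
  Finitely supported real sequences with the Euclidean inner product. The library type
  \<open>nat \<Rightarrow>\<^sub>0 real\<close> cannot be used, since it already carries the \<open>l\<^sup>1\<close> norm.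
\<close>

typedef fseq = "{f :: nat \<Rightarrow> real. finite {i. f i \<noteq> 0}}"
  morphisms fcoord Abs_fseq
  by (rule exI[of _ "\<lambda>_. 0"]) simp

setup_lifting type_definition_fseq

lemma fseq_eqI: "(\<And>i. fcoord x i = fcoord y i) \<Longrightarrow> x = y"
  by (metis ext fcoord_inject)

lemma finite_fcoord: "finite {i. fcoord x i \<noteq> 0}"
  using fcoord by blast

instantiation fseq :: real_vector
begin

lift_definition zero_fseq :: fseq is "\<lambda>_. 0" by simp

lift_definition plus_fseq :: "fseq \<Rightarrow> fseq \<Rightarrow> fseq" is "\<lambda>f g i. f i + g i"
  by (erule (1) finite_subset[OF _ finite_UnI, rotated]) auto

lift_definition uminus_fseq :: "fseq \<Rightarrow> fseq" is "\<lambda>f i. - f i" by simp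

lift_definition minus_fseq :: "fseq \<Rightarrow> fseq \<Rightarrow> fseq" is "\<lambda>f g i. f i - g i"
  by (erule (1) finite_subset[OF _ finite_UnI, rotated]) auto

lift_definition scaleR_fseq :: "real \<Rightarrow> fseq \<Rightarrow> fseq" is "\<lambda>r f i. r * f i"
  by (erule rev_finite_subset) auto

instance
  by standard (transfer; simp add: algebra_simps fun_eq_iff)+

end

lemma fcoord_simps [simp]:
  "fcoord 0 i = 0"
  "fcoord (x + y) i = fcoord x i + fcoord y i"
  "fcoord (x - y) i = fcoord x i - fcoord y i"
  "fcoord (- x) i = - fcoord x i"
  "fcoord (r *\<^sub>R x) i = r * fcoord x i"
  by (transfer; simp)+

instantiation fseq :: real_inner
begin

definition inner_fseq :: "fseq \<Rightarrow> fseq \<Rightarrow> real" where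
  "inner_fseq x y = (\<Sum>i\<in>{i. fcoord x i \<noteq> 0}. fcoord x i * fcoord y i)"

definition norm_fseq :: "fseq \<Rightarrow> real" where
  "norm_fseq x = sqrt (inner x x)"

definition sgn_fseq :: "fseq \<Rightarrow> fseq" where
  "sgn_fseq x = x /\<^sub>R norm x"

definition dist_fseq :: "fseq \<Rightarrow> fseq \<Rightarrow> real" where
  "dist_fseq x y = norm (x - y)"

definition uniformity_fseq :: "(fseq \<times> fseq) filter" where
  "uniformity_fseq = (INF e\<in>{0<..}. principal {(x, y). dist x y < e})"

definition open_fseq :: "fseq set \<Rightarrow> bool" where
  "open_fseq U \<longleftrightarrow> (\<forall>x\<in>U. \<forall>\<^sub>F (x', y) in uniformity. x' = x \<longrightarrow> y \<in> U)"

lemma inner_fseq_superset: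
  assumes "finite A" "{i. fcoord x i \<noteq> 0} \<subseteq> A"
  shows "inner x y = (\<Sum>i\<in>A. fcoord x i * fcoord y i)"
  unfolding inner_fseq_def by (rule sum.mono_neutral_left) (use assms in auto)

instance
proof
  fix x y z :: fseq and r :: real
  let ?A = "{i. fcoord x i \<noteq> 0} \<union> {i. fcoord y i \<noteq> 0}"
  have fin: "finite ?A"
    by (simp add: finite_fcoord)
  have x: "inner x w = (\<Sum>i\<in>?A. fcoord x i * fcoord w i)"
    and y: "inner y w = (\<Sum>i\<in>?A. fcoord y i * fcoord w i)"
    and xy: "inner (x + y) w = (\<Sum>i\<in>?A. fcoord (x + y) i * fcoord w i)"
    and rx: "inner (r *\<^sub>R x) w = (\<Sum>i\<in>?A. fcoord (r *\<^sub>R x) i * fcoord w i)" for w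
    by (rule inner_fseq_superset[OF fin]; auto)+
  show "inner x y = inner y x"
    by (simp add: x y mult.commute)
  show "inner (x + y) z = inner x z + inner y z"
    by (simp add: x y xy sum.distrib algebra_simps)
  show "inner (r *\<^sub>R x) y = r * inner x y"
    by (simp add: x rx sum_distrib_left algebra_simps)
  show "0 \<le> inner x x"
    by (simp add: inner_fseq_def sum_nonneg)
  show "inner x x = 0 \<longleftrightarrow> x = 0"
  proof
    assume "inner x x = 0"
    then have "\<forall>i\<in>{i. fcoord x i \<noteq> 0}. fcoord x i * fcoord x i = 0"
      unfolding inner_fseq_def by (subst (asm) sum_nonneg_eq_0_iff) (auto simp: finite_fcoord)
    then show "x = 0"
      by (intro fseq_eqI) auto
  qed (simp add: inner_fseq_def)
qed (simp_all add: norm_fseq_def sgn_fseq_def dist_fseq_def uniformity_fseq_def open_fseq_def)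

end

definition coord_space :: "nat \<Rightarrow> fseq set" where
  "coord_space n = {x. \<forall>i\<ge>n. fcoord x i = 0}"

lift_definition funit :: "nat \<Rightarrow> fseq" is "\<lambda>j i. if i = j then 1 else 0" by simp

lemma subspace_coord_space: "subspace (coord_space n)"
  by (auto simp: coord_space_def subspace_def)

lemma fcoord_funit [simp]: "fcoord (funit j) i = (if i = j then 1 else 0)"
  by transfer simp

lemma fcoord_sum [simp]: "fcoord (sum f A) i = (\<Sum>a\<in>A. fcoord (f a) i)"
  by (induction A rule: infinite_finite_induct) auto

lemma inj_funit: "inj funit"
  by (metis fcoord_funit injI zero_neq_one)

lemma dim_coord_space: "dim (coord_space n) = n"
proof -
  let ?B = "funit ` {..<n}"
  have "independent ?B"
  proof (rule independent_if_scalars_zero)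
    fix f x assume s: "(\<Sum>x\<in>?B. f x *\<^sub>R x) = 0" and "x \<in> ?B"
    then obtain j where j: "j < n" "x = funit j" by auto
    have "(\<Sum>i<n. f (funit i) *\<^sub>R funit i) = 0"
      using s by (simp add: sum.reindex inj_on_subset[OF inj_funit])
    then have "fcoord (\<Sum>i<n. f (funit i) *\<^sub>R funit i) j = 0" by simp
    with j show "f x = 0"
      by (simp add: if_distrib[of "\<lambda>c. _ * c"] cong: if_cong)
  qed simp
  moreover have "coord_space n \<subseteq> span ?B"
  proof
    fix x assume "x \<in> coord_space n"
    then have "x = (\<Sum>i<n. fcoord x i *\<^sub>R funit i)"
      by (intro fseq_eqI)
        (auto simp: coord_space_def if_distrib[of "\<lambda>c. _ * c"] not_less cong: if_cong)
    also have "\<dots> \<in> span ?B"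
      by (intro span_sum span_mul span_base) auto
    finally show "x \<in> span ?B" .
  qed
  moreover have "?B \<subseteq> coord_space n"
    by (auto simp: coord_space_def)
  ultimately show ?thesis
    by (intro dim_unique[of ?B]) (auto simp: card_image inj_on_subset[OF inj_funit])
qed

end

theory Submission
  imports Defs
begin

text \<open>
  Perturb the unit ball to the body \<open>K\<close> with support function \<open>1 + t (u \<bullet> e)\<^sup>4\<close> on the sphere.
  Its projection to \<open>F\<close> has support function \<open>1 + \<tau> (u \<bullet> f)\<^sup>4\<close> with \<open>\<tau> = t \<bar>P\<^sub>F e\<bar>\<^sup>4\<close>, where \<open>f\<close> is
  the direction of \<open>P\<^sub>F e\<close>, so it is a body of revolution. Its boundary is parametrised by the
  gradient of the support function, and slicing orthogonally to \<open>f\<close> turns its volume into a one-dimensional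
  integral that is a polynomial in \<open>\<tau>\<close>. Relative to the unit ball the volume is
  \<open>1 + \<alpha> \<tau> + \<beta> \<tau>\<^sup>2 + O(\<tau>\<^sup>3)\<close> with \<open>\<alpha> = 3 / (k + 2)\<close> and
  \<open>\<beta> = - 135 (k - 1) / (2 (k + 2) (k + 4) (k + 6))\<close>.

  Rotation invariance alone gives the moments of \<open>\<bar>P\<^sub>F e\<bar>\<^sup>2\<close>, by comparing second variations in \<open>e\<close>.
  With \<open>\<Phi>\<^sub>k(t)\<close> the mean of the \<open>-n\<close>-th power of the relative volumes, the claim becomes
  \<open>\<Phi>\<^sub>k\<^sup>m < \<Phi>\<^sub>m\<^sup>k\<close>. Both sides agree to first order in \<open>t\<close>, and the difference of the second-order
  coefficients has the sign of \<open>(n + 2) / ((m + 2) (k + 2)) - 1\<close>.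
\<close>

section \<open>Uniform second-order expansions\<close>

text \<open>Why a quartic bump: at p = -n the functionals are invariant under volume-preserving
  linear maps, so they equal 1 on ellipsoids. A quadratic bump is an ellipsoid up to second-order
  terms whose effect is the same for all k, so it cannot separate two indices at second order; the
  fourth power is the next even one. The bound 1/6 keeps 1 - 3 t (u \<bullet> e)^4 at least 1/2.
  This yields boundary points for all normals, positive curvature, and a lower bound on relative
  volumes, which controls their negative powers. Expansions are integrated over the Grassmannian, so
  error constants must not depend on the subspace: \<open>S\<close> is the parameter set over which
  \<open>jet2\<close> is uniform. Explicit O(x^3) errors replace derivatives and survive products,
  powers, inverses and integrals. The volume of the body never has to be expanded: the comparison
  ball of radius r contributes the same factor 1 / r for every k. \<open>grassmann_measure\<close>
  is a choice, so an invariant measure has to be constructed before anything can be said about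
  it.\<close>

definition jet2 :: "'s set \<Rightarrow> (real \<Rightarrow> 's \<Rightarrow> real) \<Rightarrow> ('s \<Rightarrow> real) \<Rightarrow> ('s \<Rightarrow> real) \<Rightarrow> ('s \<Rightarrow> real) \<Rightarrow> bool"
  where "jet2 S f a b c \<longleftrightarrow>
    (\<exists>C. \<forall>s\<in>S. \<forall>x\<in>{0..1/6}. \<bar>f x s - (a s + b s * x + c s * x\<^sup>2)\<bar> \<le> C * x ^ 3) \<and>
    (\<exists>M. \<forall>s\<in>S. \<bar>a s\<bar> \<le> M \<and> \<bar>b s\<bar> \<le> M \<and> \<bar>c s\<bar> \<le> M)"

lemma jet2E:
  assumes "jet2 S f a b c"
  obtains C where "C \<ge> 0"
    "\<And>s x. s \<in> S \<Longrightarrow> x \<in> {0..1/6} \<Longrightarrow> \<bar>f x s - (a s + b s * x + c s * x\<^sup>2)\<bar> \<le> C * x ^ 3"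
    "\<And>s. s \<in> S \<Longrightarrow> \<bar>a s\<bar> \<le> C" "\<And>s. s \<in> S \<Longrightarrow> \<bar>b s\<bar> \<le> C" "\<And>s. s \<in> S \<Longrightarrow> \<bar>c s\<bar> \<le> C"
proof -
  obtain C M where C: "\<And>s x. s \<in> S \<Longrightarrow> x \<in> {0..1/6} \<Longrightarrow> \<bar>f x s - (a s + b s * x + c s * x\<^sup>2)\<bar> \<le> C * x ^ 3"
    and M: "\<And>s. s \<in> S \<Longrightarrow> \<bar>a s\<bar> \<le> M \<and> \<bar>b s\<bar> \<le> M \<and> \<bar>c s\<bar> \<le> M"
    using assms unfolding jet2_def by blast
  define D where "D = \<bar>C\<bar> + \<bar>M\<bar>"
  show thesis
  proof (rule that[of D])
    fix s and x :: real assume s: "s \<in> S" and x: "x \<in> {0..1/6}"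
    have "C * x ^ 3 \<le> D * x ^ 3"
      using x by (intro mult_right_mono) (auto simp: D_def)
    then show "\<bar>f x s - (a s + b s * x + c s * x\<^sup>2)\<bar> \<le> D * x ^ 3"
      using C[OF s x] by linarith
  qed (use M in \<open>force simp: D_def\<close>)+
qed

lemma jet2_cong:
  assumes "jet2 S f a b c" "\<And>s x. s \<in> S \<Longrightarrow> x \<in> {0..1/6} \<Longrightarrow> f x s = f' x s"
    "\<And>s. s \<in> S \<Longrightarrow> a s = a' s" "\<And>s. s \<in> S \<Longrightarrow> b s = b' s" "\<And>s. s \<in> S \<Longrightarrow> c s = c' s"
  shows "jet2 S f' a' b' c'"
  using assms unfolding jet2_def by (metis (no_types, lifting))

lemma jet2_poly:
  assumes "\<And>s. s \<in> S \<Longrightarrow> \<bar>a s\<bar> \<le> M" "\<And>s. s \<in> S \<Longrightarrow> \<bar>b s\<bar> \<le> M" "\<And>s. s \<in> S \<Longrightarrow> \<bar>c s\<bar> \<le> M"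
  shows "jet2 S (\<lambda>x s. a s + b s * x + c s * x\<^sup>2) a b c"
  unfolding jet2_def using assms by (intro conjI exI[of _ 0] exI[of _ M]) auto

lemma jet2_mult:
  assumes "jet2 S f a b c" "jet2 S f' a' b' c'"
  shows "jet2 S (\<lambda>x s. f x s * f' x s) (\<lambda>s. a s * a' s) (\<lambda>s. a s * b' s + b s * a' s)
    (\<lambda>s. a s * c' s + b s * b' s + c s * a' s)"
proof -
  obtain C where C: "C \<ge> 0"
    "\<And>s x. s \<in> S \<Longrightarrow> x \<in> {0..1/6} \<Longrightarrow> \<bar>f x s - (a s + b s * x + c s * x\<^sup>2)\<bar> \<le> C * x ^ 3"
    "\<And>s. s \<in> S \<Longrightarrow> \<bar>a s\<bar> \<le> C" "\<And>s. s \<in> S \<Longrightarrow> \<bar>b s\<bar> \<le> C" "\<And>s. s \<in> S \<Longrightarrow> \<bar>c s\<bar> \<le> C"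
    by (rule jet2E[OF assms(1)]) blast
  obtain D where D: "D \<ge> 0"
    "\<And>s x. s \<in> S \<Longrightarrow> x \<in> {0..1/6} \<Longrightarrow> \<bar>f' x s - (a' s + b' s * x + c' s * x\<^sup>2)\<bar> \<le> D * x ^ 3"
    "\<And>s. s \<in> S \<Longrightarrow> \<bar>a' s\<bar> \<le> D" "\<And>s. s \<in> S \<Longrightarrow> \<bar>b' s\<bar> \<le> D" "\<And>s. s \<in> S \<Longrightarrow> \<bar>c' s\<bar> \<le> D"
    by (rule jet2E[OF assms(2)]) blast
  have CD: "\<bar>u * v\<bar> \<le> C * D" if "\<bar>u\<bar> \<le> C" "\<bar>v\<bar> \<le> D" for u v
    using that C(1) by (simp add: abs_mult mult_mono)
  show ?thesis
    unfolding jet2_def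
  proof (intro conjI exI ballI)
    fix s and x :: real assume s: "s \<in> S" and x: "x \<in> {0..1/6}"
    define p where "p = a s + b s * x + c s * x\<^sup>2"
    define q where "q = a' s + b' s * x + c' s * x\<^sup>2"
    define r where "r = f x s - p"
    define t where "t = f' x s - q"
    have x3: "0 \<le> x ^ 3" "x ^ 3 \<le> 1" and x2: "0 \<le> x\<^sup>2" "x\<^sup>2 \<le> 1" and x1: "0 \<le> x" "x \<le> 1"
      using x by (auto simp: power_le_one)
    have r: "\<bar>r\<bar> \<le> C * x ^ 3" and t: "\<bar>t\<bar> \<le> D * x ^ 3"
      using C(2)[OF s x] D(2)[OF s x] by (auto simp: r_def t_def p_def q_def)
    have "\<bar>b s * x\<bar> \<le> C * 1" "\<bar>c s * x\<^sup>2\<bar> \<le> C * 1"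
      unfolding abs_mult using C s x1 x2 by (intro mult_mono; auto)+
    then have p: "\<bar>p\<bar> \<le> 3 * C" using C(3)[OF s] unfolding p_def by linarith
    have "\<bar>b' s * x\<bar> \<le> D * 1" "\<bar>c' s * x\<^sup>2\<bar> \<le> D * 1"
      unfolding abs_mult using D s x1 x2 by (intro mult_mono; auto)+
    then have q: "\<bar>q\<bar> \<le> 3 * D" using D(3)[OF s] unfolding q_def by linarith
    \<comment> \<open>With \<open>r\<close> and \<open>t\<close> the remainders, the error consists
      of the cubic and quartic terms of \<open>p * q\<close> (at most 3 C D), of
      \<open>p * t\<close> and \<open>q * r\<close> (3 C D each) and of \<open>r * t\<close> (C D);
      hence the constant 10.\<close>
    have e: "f x s * f' x s - (a s * a' s + (a s * b' s + b s * a' s) * x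
        + (a s * c' s + b s * b' s + c s * a' s) * x\<^sup>2)
      = (b s * c' s + c s * b' s + (c s * c' s) * x) * x ^ 3 + p * t + q * r + r * t"
      unfolding r_def t_def p_def q_def by (simp add: algebra_simps power2_eq_square power3_eq_cube)
    have "\<bar>c s * c' s * x\<bar> \<le> (C * D) * 1"
      unfolding abs_mult[of "c s * c' s"] using CD[OF C(5) D(5)] s x1 C(1) D(1) by (intro mult_mono) auto
    moreover have "\<bar>b s * c' s\<bar> \<le> C * D" "\<bar>c s * b' s\<bar> \<le> C * D" using CD C D s by auto
    ultimately have "\<bar>b s * c' s + c s * b' s + (c s * c' s) * x\<bar> \<le> 3 * (C * D)" by linarith
    then have 1: "\<bar>(b s * c' s + c s * b' s + (c s * c' s) * x) * x ^ 3\<bar> \<le> 3 * (C * D) * x ^ 3"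
      unfolding abs_mult[of _ "x ^ 3"] using x3 by (simp add: mult_right_mono)
    have 2: "\<bar>p * t\<bar> \<le> (3 * C) * (D * x ^ 3)" unfolding abs_mult using p t C by (intro mult_mono) auto
    have 3: "\<bar>q * r\<bar> \<le> (3 * D) * (C * x ^ 3)" unfolding abs_mult using q r D by (intro mult_mono) auto
    have "\<bar>r * t\<bar> \<le> (C * x ^ 3) * (D * x ^ 3)" unfolding abs_mult using r t C x3 by (intro mult_mono) auto
    also have "\<dots> \<le> (C * 1) * (D * x ^ 3)" using C D x3 by (intro mult_mono) auto
    finally have 4: "\<bar>r * t\<bar> \<le> C * (D * x ^ 3)" by simp
    show "\<bar>f x s * f' x s - (a s * a' s + (a s * b' s + b s * a' s) * x
        + (a s * c' s + b s * b' s + c s * a' s) * x\<^sup>2)\<bar> \<le> (10 * (C * D)) * x ^ 3"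
      unfolding e using 1 2 3 4 by (simp add: algebra_simps)
  next
    fix s assume s: "s \<in> S"
    have ab: "\<bar>a s * a' s\<bar> \<le> C * D" "\<bar>a s * b' s\<bar> \<le> C * D" "\<bar>b s * a' s\<bar> \<le> C * D" "\<bar>a s * c' s\<bar> \<le> C * D"
      "\<bar>b s * b' s\<bar> \<le> C * D" "\<bar>c s * a' s\<bar> \<le> C * D" using CD C D s by auto
    have "0 \<le> C * D" using C D by simp
    then show "\<bar>a s * a' s\<bar> \<le> 3 * (C * D)"
      "\<bar>a s * b' s + b s * a' s\<bar> \<le> 3 * (C * D)"
      "\<bar>a s * c' s + b s * b' s + c s * a' s\<bar> \<le> 3 * (C * D)"
      using ab by linarith+
  qed
qed

text \<open>Truncated subtraction is harmless here: where \<open>j - 1\<close> or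
  \<open>j - 2\<close> is cut off at 0, the prefactor j or j (j - 1) vanishes.\<close>

lemma jet2_power:
  assumes "jet2 S f a b c"
  shows "jet2 S (\<lambda>x s. f x s ^ j) (\<lambda>s. a s ^ j) (\<lambda>s. real j * a s ^ (j - 1) * b s)
    (\<lambda>s. real j * a s ^ (j - 1) * c s + real j * (real j - 1) / 2 * a s ^ (j - 2) * (b s)\<^sup>2)"
proof (induction j)
  case 0
  show ?case unfolding jet2_def by (auto intro: exI[of _ 0] exI[of _ 1])
next
  case (Suc j)
  show ?case
  proof (rule jet2_cong[OF jet2_mult[OF assms Suc]])
    fix s
    show "a s * (real j * a s ^ (j - 1) * b s) + b s * a s ^ j = real (Suc j) * a s ^ (Suc j - 1) * b s"
      by (cases j) (auto simp: algebra_simps)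
    consider "j = 0" | "j = 1" | i where "j = Suc (Suc i)" by (metis One_nat_def not0_implies_Suc)
    then show "a s * (real j * a s ^ (j - 1) * c s + real j * (real j - 1) / 2 * a s ^ (j - 2) * (b s)\<^sup>2)
       + b s * (real j * a s ^ (j - 1) * b s) + c s * a s ^ j =
      real (Suc j) * a s ^ (Suc j - 1) * c s +
       real (Suc j) * (real (Suc j) - 1) / 2 * a s ^ (Suc j - 2) * (b s)\<^sup>2"
      by cases (auto simp: field_simps power2_eq_square)
  qed auto
qed

text \<open>The formal inverse \<open>q\<close> of the jet satisfies f q = 1 + O(x^3) by the product
  rule. The lower bound \<open>l\<close> allows division by f at the cost of a factor 1 / l,
  uniformly in the parameter.\<close>

lemma jet2_inverse:
  assumes f: "jet2 S f (\<lambda>_. 1) b c"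
    and l: "l > 0" "\<And>s x. s \<in> S \<Longrightarrow> x \<in> {0..1/6} \<Longrightarrow> f x s \<ge> l"
  shows "jet2 S (\<lambda>x s. inverse (f x s)) (\<lambda>_. 1) (\<lambda>s. - b s) (\<lambda>s. (b s)\<^sup>2 - c s)"
proof -
  define q where "q x s = 1 + (- b s) * x + ((b s)\<^sup>2 - c s) * x\<^sup>2" for s and x :: real
  obtain C where C: "C \<ge> 0" "\<And>s. s \<in> S \<Longrightarrow> \<bar>b s\<bar> \<le> C" "\<And>s. s \<in> S \<Longrightarrow> \<bar>c s\<bar> \<le> C"
    by (rule jet2E[OF f]) blast
  have b2: "\<bar>(b s)\<^sup>2 - c s\<bar> \<le> C\<^sup>2 + C" if "s \<in> S" for s
  proof -
    have "(b s)\<^sup>2 \<le> C\<^sup>2" using C(2)[OF that] by (metis abs_le_square_iff abs_of_nonneg C(1))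
    then show ?thesis using C(3)[OF that] zero_le_power2[of "b s"] by linarith
  qed
  have q: "jet2 S q (\<lambda>_. 1) (\<lambda>s. - b s) (\<lambda>s. (b s)\<^sup>2 - c s)"
    unfolding q_def
  proof (rule jet2_poly[of S _ "1 + C + C\<^sup>2"])
    fix s assume "s \<in> S"
    then show "\<bar>1::real\<bar> \<le> 1 + C + C\<^sup>2" "\<bar>- b s\<bar> \<le> 1 + C + C\<^sup>2" "\<bar>(b s)\<^sup>2 - c s\<bar> \<le> 1 + C + C\<^sup>2"
      using C(1) C(2)[of s] b2[of s] zero_le_power2[of C] by linarith+
  qed
  have "jet2 S (\<lambda>x s. f x s * q x s) (\<lambda>_. 1) (\<lambda>_. 0) (\<lambda>_. 0)"
    by (rule jet2_cong[OF jet2_mult[OF f q]]) (auto simp: power2_eq_square)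
  then obtain D where D: "D \<ge> 0"
    "\<And>s x. s \<in> S \<Longrightarrow> x \<in> {0..1/6} \<Longrightarrow> \<bar>f x s * q x s - 1\<bar> \<le> D * x ^ 3"
    by (rule jet2E) auto
  show ?thesis
    unfolding jet2_def
  proof (intro conjI exI ballI)
    fix s and x :: real assume s: "s \<in> S" and x: "x \<in> {0..1/6}"
    have fl: "f x s \<ge> l" using l s x by auto
    then have "inverse (f x s) - q x s = inverse (f x s) * (1 - f x s * q x s)"
      using l(1) by (simp add: field_simps)
    then have "\<bar>inverse (f x s) - q x s\<bar> = inverse (f x s) * \<bar>f x s * q x s - 1\<bar>"
      using fl l(1) by (simp add: abs_mult abs_minus_commute)
    also have "\<dots> \<le> inverse l * (D * x ^ 3)"
      using fl l(1) D s x by (intro mult_mono le_imp_inverse_le) auto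
    finally show "\<bar>inverse (f x s) - (1 + - b s * x + ((b s)\<^sup>2 - c s) * x\<^sup>2)\<bar> \<le> (inverse l * D) * x ^ 3"
      unfolding q_def by (simp add: mult.assoc)
  next
    fix s assume "s \<in> S"
    then show "\<bar>1::real\<bar> \<le> 1 + C + C\<^sup>2" "\<bar>- b s\<bar> \<le> 1 + C + C\<^sup>2" "\<bar>(b s)\<^sup>2 - c s\<bar> \<le> 1 + C + C\<^sup>2"
      using C(1) C(2)[of s] b2[of s] zero_le_power2[of C] by linarith+
  qed
qed

text \<open>The error constant is uniform in s, so it integrates against a finite measure. The
  integrals no longer depend on a parameter, which is why the new parameter set \<open>U\<close> is
  arbitrary.\<close>

lemma jet2_integral:
  assumes "finite_measure M" and jet: "jet2 (space M) f a b c"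
    and f: "\<And>x. x \<in> {0..1/6} \<Longrightarrow> f x \<in> borel_measurable M"
    and abc: "a \<in> borel_measurable M" "b \<in> borel_measurable M" "c \<in> borel_measurable M"
  shows "jet2 U (\<lambda>x _. \<integral>s. f x s \<partial>M) (\<lambda>_. \<integral>s. a s \<partial>M) (\<lambda>_. \<integral>s. b s \<partial>M) (\<lambda>_. \<integral>s. c s \<partial>M)"
proof -
  interpret finite_measure M by fact
  obtain C where C: "C \<ge> 0"
    "\<And>s x. s \<in> space M \<Longrightarrow> x \<in> {0..1/6} \<Longrightarrow> \<bar>f x s - (a s + b s * x + c s * x\<^sup>2)\<bar> \<le> C * x ^ 3"
    "\<And>s. s \<in> space M \<Longrightarrow> \<bar>a s\<bar> \<le> C" "\<And>s. s \<in> space M \<Longrightarrow> \<bar>b s\<bar> \<le> C" "\<And>s. s \<in> space M \<Longrightarrow> \<bar>c s\<bar> \<le> C"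
    by (rule jet2E[OF jet]) blast
  have ia: "integrable M a" and ib: "integrable M b" and ic: "integrable M c"
    using C abc by (auto intro!: integrable_const_bound[of _ C])
  show ?thesis
    unfolding jet2_def
  proof (intro conjI exI ballI)
    fix u and x :: real assume x: "x \<in> {0..1/6}"
    let ?p = "\<lambda>s. a s + b s * x + c s * x\<^sup>2"
    have ip: "integrable M ?p" using ia ib ic by auto
    have id: "integrable M (\<lambda>s. f x s - ?p s)"
      using C(2)[OF _ x] f[OF x] abc by (intro integrable_const_bound[of _ "C * x ^ 3"]) auto
    have "integrable M (\<lambda>s. (f x s - ?p s) + ?p s)" using id ip by (rule Bochner_Integration.integrable_add)
    then have if': "integrable M (f x)" by simp
    have "(\<integral>s. f x s \<partial>M) - ((\<integral>s. a s \<partial>M) + (\<integral>s. b s \<partial>M) * x + (\<integral>s. c s \<partial>M) * x\<^sup>2)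
       = (\<integral>s. f x s - ?p s \<partial>M)"
      using ia ib ic if' by simp
    also have "\<bar>\<dots>\<bar> \<le> (\<integral>s. C * x ^ 3 \<partial>M)"
      using C(2)[OF _ x] id by (intro order_trans[OF integral_abs_bound integral_mono]) auto
    finally show "\<bar>(\<integral>s. f x s \<partial>M) - ((\<integral>s. a s \<partial>M) + (\<integral>s. b s \<partial>M) * x + (\<integral>s. c s \<partial>M) * x\<^sup>2)\<bar>
       \<le> (C * measure M (space M)) * x ^ 3" by (simp add: algebra_simps)
  next
    let ?m = "\<bar>\<integral>s. a s \<partial>M\<bar> + \<bar>\<integral>s. b s \<partial>M\<bar> + \<bar>\<integral>s. c s \<partial>M\<bar>"
    show "\<bar>\<integral>s. a s \<partial>M\<bar> \<le> ?m" "\<bar>\<integral>s. b s \<partial>M\<bar> \<le> ?m" "\<bar>\<integral>s. c s \<partial>M\<bar> \<le> ?m" by auto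
  qed
qed

lemma jet2_scale:
  assumes "jet2 S f a b c"
  shows "jet2 S (\<lambda>x s. r * f x s) (\<lambda>s. r * a s) (\<lambda>s. r * b s) (\<lambda>s. r * c s)"
proof -
  have "jet2 S (\<lambda>x s. r + 0 * x + 0 * x\<^sup>2) (\<lambda>_. r) (\<lambda>_. 0) (\<lambda>_. 0)"
    by (rule jet2_poly[of S _ "\<bar>r\<bar>"]) auto
  from jet2_mult[OF this assms] show ?thesis by simp
qed

text \<open>Turns an expansion in \<tau> into one in t when \<tau> = t p with p depending on the
  subspace. Since p lies in [0, 1], t p stays in the admissible interval and the cubic error does
  not grow.\<close>

lemma jet2_subst:
  assumes f: "jet2 {u} (\<lambda>x _. f x) (\<lambda>_. a) (\<lambda>_. b) (\<lambda>_. c)"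
    and p: "\<And>s. s \<in> S \<Longrightarrow> 0 \<le> p s \<and> p s \<le> 1"
  shows "jet2 S (\<lambda>x s. f (x * p s)) (\<lambda>_. a) (\<lambda>s. b * p s) (\<lambda>s. c * (p s)\<^sup>2)"
proof -
  obtain C where C: "C \<ge> 0"
    "\<And>x. x \<in> {0..1/6} \<Longrightarrow> \<bar>f x - (a + b * x + c * x\<^sup>2)\<bar> \<le> C * x ^ 3"
    "\<bar>a\<bar> \<le> C" "\<bar>b\<bar> \<le> C" "\<bar>c\<bar> \<le> C"
    by (rule jet2E[OF f]) auto
  show ?thesis
    unfolding jet2_def
  proof (intro conjI exI ballI)
    fix s and x :: real assume s: "s \<in> S" and x: "x \<in> {0..1/6}"
    have xp: "x * p s \<le> x * 1" using p[OF s] x by (intro mult_left_mono) auto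
    then have y: "x * p s \<in> {0..1/6}" using p[OF s] x by auto
    have "(x * p s) ^ 3 \<le> x ^ 3" using xp y by (intro power_mono) auto
    then have "C * (x * p s) ^ 3 \<le> C * x ^ 3" using C(1) by (rule mult_left_mono)
    then show "\<bar>f (x * p s) - (a + b * p s * x + c * (p s)\<^sup>2 * x\<^sup>2)\<bar> \<le> C * x ^ 3"
      using C(2)[OF y] by (simp add: algebra_simps power_mult_distrib)
  next
    fix s assume s: "s \<in> S"
    show "\<bar>a\<bar> \<le> C" by fact
    have "\<bar>b\<bar> * p s \<le> C * 1" "\<bar>c\<bar> * (p s)\<^sup>2 \<le> C * 1"
      using p[OF s] C by (intro mult_mono; auto simp: power_le_one)+
    then show "\<bar>b * p s\<bar> \<le> C" "\<bar>c * (p s)\<^sup>2\<bar> \<le> C" using p[OF s] by (auto simp: abs_mult)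
  qed
qed

lemma jet2_less:
  assumes f: "jet2 {u} (\<lambda>x _. f x) (\<lambda>_. a) (\<lambda>_. b) (\<lambda>_. c)"
    and f': "jet2 {u} (\<lambda>x _. f' x) (\<lambda>_. a) (\<lambda>_. b) (\<lambda>_. c')" and "c < c'"
  shows "\<exists>x. 0 < x \<and> x \<le> 1/6 \<and> f x < f' x"
proof -
  obtain C where C: "C \<ge> 0" "\<And>x. x \<in> {0..1/6} \<Longrightarrow> \<bar>f x - (a + b * x + c * x\<^sup>2)\<bar> \<le> C * x ^ 3"
    by (rule jet2E[OF f]) auto
  obtain D where D: "D \<ge> 0" "\<And>x. x \<in> {0..1/6} \<Longrightarrow> \<bar>f' x - (a + b * x + c' * x\<^sup>2)\<bar> \<le> D * x ^ 3"
    by (rule jet2E[OF f']) auto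
  \<comment> \<open>Small enough that (C + D) x < c' - c, so the two cubic errors together stay
    below the quadratic gap.\<close>
  define x where "x = min (1/6) ((c' - c) / (2 * (C + D + 1)))"
  have x: "0 < x" "x \<le> 1/6" unfolding x_def using \<open>c < c'\<close> C D by (simp_all del: min_less_iff_conj add: min_def)
  have "x \<le> (c' - c) / (2 * (C + D + 1))" by (simp add: x_def)
  then have "2 * (C + D + 1) * x \<le> c' - c" using C D by (simp add: field_simps)
  then have "2 * ((C + D + 1) * x) \<le> c' - c" by linarith
  moreover have "(C + D + 1) * x = (C + D) * x + x" by (simp add: algebra_simps)
  moreover have "0 \<le> (C + D) * x" using C D x by simp
  ultimately have "(C + D) * x < c' - c" using x(1) by linarith
  then have "x\<^sup>2 * ((C + D) * x) < x\<^sup>2 * (c' - c)" using x by (intro mult_strict_left_mono) auto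
  then have "C * x ^ 3 + D * x ^ 3 < c' * x\<^sup>2 - c * x\<^sup>2"
    by (simp add: algebra_simps power2_eq_square power3_eq_cube)
  with C(2)[of x] D(2)[of x] x have "f x < f' x" by auto
  with x show ?thesis by blast
qed

text \<open>Serves to equate the second-order coefficients of one function expanded in two ways. The
  coefficients are peeled off in turn: the value at 0, then a division by x, then one by x^2, each
  time letting x tend to 0.\<close>

lemma jet2_unique:
  assumes f: "jet2 {u} (\<lambda>x _. f x) (\<lambda>_. a) (\<lambda>_. b) (\<lambda>_. c)"
    and f': "jet2 {u} (\<lambda>x _. f x) (\<lambda>_. a') (\<lambda>_. b') (\<lambda>_. c')"
  shows "c = c'"
proof -
  obtain C where C: "C \<ge> 0" "\<And>x. x \<in> {0..1/6} \<Longrightarrow> \<bar>f x - (a + b * x + c * x\<^sup>2)\<bar> \<le> C * x ^ 3"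
    by (rule jet2E[OF f]) auto
  obtain D where D: "D \<ge> 0" "\<And>x. x \<in> {0..1/6} \<Longrightarrow> \<bar>f x - (a' + b' * x + c' * x\<^sup>2)\<bar> \<le> D * x ^ 3"
    by (rule jet2E[OF f']) auto
  have aa: "a = a'" using C(2)[of 0] D(2)[of 0] by auto
  have lim: "d = 0" if "\<And>x. 0 < x \<Longrightarrow> x \<le> 1/6 \<Longrightarrow> \<bar>d\<bar> \<le> B * x" for d B :: real
  proof -
    have "((\<lambda>x. B * x) \<longlongrightarrow> B * 0) (at_right 0)" by (intro tendsto_intros)
    moreover have "eventually (\<lambda>x. \<bar>d\<bar> \<le> B * x) (at_right 0)"
      unfolding eventually_at_right_field using that by (intro exI[of _ "1/6"]) auto
    ultimately have "\<bar>d\<bar> \<le> B * 0" by (rule tendsto_lowerbound) auto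
    then show ?thesis by simp
  qed
  have bb: "b - b' = 0"
  proof (rule lim)
    fix x :: real assume x: "0 < x" "x \<le> 1/6"
    let ?d = "(b - b') * x + (c - c') * x\<^sup>2"
    have "\<bar>?d\<bar> \<le> (C + D) * x ^ 3"
      using C(2)[of x] D(2)[of x] x aa by (auto simp: algebra_simps)
    moreover have "(b - b') * x = ?d - (c - c') * x\<^sup>2" by simp
    ultimately have "\<bar>(b - b') * x\<bar> \<le> (C + D) * x ^ 3 + \<bar>(c - c') * x\<^sup>2\<bar>" by linarith
    also have "(C + D) * x ^ 3 \<le> (C + D) * x\<^sup>2"
      using x C D by (intro mult_left_mono power_decreasing) auto
    finally have "\<bar>(b - b') * x\<bar> \<le> (C + D) * x\<^sup>2 + \<bar>(c - c') * x\<^sup>2\<bar>" by simp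
    then have "\<bar>b - b'\<bar> * \<bar>x\<bar> \<le> (C + D) * x\<^sup>2 + \<bar>c - c'\<bar> * \<bar>x\<^sup>2\<bar>"
      by (simp only: abs_mult)
    then have "\<bar>b - b'\<bar> * x \<le> ((C + D + \<bar>c - c'\<bar>) * x) * x"
      using x by (simp add: algebra_simps power2_eq_square)
    then show "\<bar>b - b'\<bar> \<le> (C + D + \<bar>c - c'\<bar>) * x" using x by simp
  qed
  have "c - c' = 0"
  proof (rule lim)
    fix x :: real assume x: "0 < x" "x \<le> 1/6"
    have "\<bar>(c - c') * x\<^sup>2\<bar> \<le> (C + D) * x ^ 3"
      using C(2)[of x] D(2)[of x] x aa bb by (auto simp: algebra_simps)
    then have "\<bar>c - c'\<bar> * \<bar>x\<^sup>2\<bar> \<le> (C + D) * x ^ 3" by (simp only: abs_mult)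
    then have "\<bar>c - c'\<bar> * x\<^sup>2 \<le> ((C + D) * x) * x\<^sup>2"
      using x by (simp add: algebra_simps power2_eq_square power3_eq_cube)
    then show "\<bar>c - c'\<bar> \<le> (C + D) * x" using x by simp
  qed
  then show ?thesis by simp
qed

section \<open>The volume profile of a perturbed ball\<close>

text \<open>Up to the factor \<open>unit_ball_vol (k - 1)\<close>, for positive k this is the j-th
  moment of one coordinate over the k-dimensional unit ball; k - 1 is the dimension of the
  slices.\<close>

definition cap_moment :: "nat \<Rightarrow> nat \<Rightarrow> real" where
  "cap_moment k j = integral {-1..1} (\<lambda>z. z ^ j * sqrt (1 - z\<^sup>2) ^ (k - 1))"

text \<open>Integrate the derivative of z^(j + 1) (1 - z^2)^((k + 1) / 2), a function vanishing at
  both ends. Derivatives are taken in the open interval only, because the square root has none at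
  the endpoints.\<close>

lemma cap_moment_rec:
  assumes "k \<ge> 1"
  shows "cap_moment k (j + 2) = (real j + 1) / (real k + real j + 2) * cap_moment k j"
proof -
  let ?F = "\<lambda>z. z ^ (j + 1) * sqrt (1 - z\<^sup>2) ^ (k + 1)"
  let ?w = "\<lambda>z. sqrt (1 - z\<^sup>2) ^ (k - 1)"
  let ?D = "\<lambda>z. (real j + 1) * (z ^ j * ?w z) - (real k + real j + 2) * (z ^ (j + 2) * ?w z)"
  have s: "sqrt (1 - z\<^sup>2) ^ (k + 1) = (1 - z\<^sup>2) * ?w z" if "z \<in> {-1..1}" for z :: real
  proof -
    have "z\<^sup>2 \<le> 1" using that by (simp add: abs_square_le_1 abs_le_iff)
    moreover have "k + 1 = 2 + (k - 1)" using assms by simp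
    ultimately show ?thesis by (simp only: power_add) simp
  qed
  have "(?D has_integral (?F 1 - ?F (-1))) {-1..1}"
  proof (rule fundamental_theorem_of_calculus_interior)
    show "continuous_on {-1..1} ?F" by (intro continuous_intros)
    fix z :: real assume z: "z \<in> {-1<..<1}"
    have z': "z \<in> {-1..1}" using z by auto
    have z2: "z\<^sup>2 < 1" using z by (simp add: abs_square_less_1 abs_less_iff)
    let ?q = "sqrt (1 - z\<^sup>2)"
    have q: "?q > 0" "?q\<^sup>2 = 1 - z\<^sup>2" using z2 by auto
    have "(?F has_real_derivative (real (j + 1) * z ^ j * ?q ^ (k + 1) +
        z ^ (j + 1) * (real (k + 1) * ?q ^ k * ((- (2 * z)) * (inverse ?q / 2))))) (at z)"
    proof -
      have d1: "((\<lambda>z. z ^ (j + 1)) has_real_derivative real (j + 1) * z ^ j) (at z)"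
        by (rule DERIV_cong[OF DERIV_pow]) simp
      have "((\<lambda>z. sqrt (1 - z\<^sup>2)) has_real_derivative (- (2 * z)) * (inverse ?q / 2)) (at z)"
        using z2 by (auto intro!: derivative_eq_intros)
      from DERIV_power[OF this, of "k + 1"]
      have d2: "((\<lambda>z. sqrt (1 - z\<^sup>2) ^ (k + 1)) has_real_derivative
          real (k + 1) * ?q ^ k * ((- (2 * z)) * (inverse ?q / 2))) (at z)"
        by (rule DERIV_cong) (simp add: mult_ac)
      show ?thesis by (rule DERIV_cong[OF DERIV_mult[OF d1 d2]]) (simp add: algebra_simps)
    qed
    also have "real (j + 1) * z ^ j * ?q ^ (k + 1) +
        z ^ (j + 1) * (real (k + 1) * ?q ^ k * ((- (2 * z)) * (inverse ?q / 2))) = ?D z"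
    proof -
      have e: "?q ^ k * inverse ?q = ?w z" using q assms by (cases k) (auto simp: field_simps)
      have "real (j + 1) * z ^ j * ?q ^ (k + 1) +
          z ^ (j + 1) * (real (k + 1) * ?q ^ k * ((- (2 * z)) * (inverse ?q / 2))) =
        real (j + 1) * z ^ j * ?q ^ (k + 1) - (z ^ (j + 2) * real (k + 1)) * (?q ^ k * inverse ?q)"
        by (simp add: algebra_simps)
      also have "\<dots> = ?D z" unfolding e s[OF z'] by (simp add: algebra_simps power2_eq_square)
      finally show ?thesis .
    qed
    finally show "(?F has_vector_derivative ?D z) (at z)"
      by (simp add: has_real_derivative_iff_has_vector_derivative)
  qed simp
  then have "integral {-1..1} ?D = 0"
    using assms by (auto dest!: integral_unique)
  moreover have i: "(\<lambda>z. z ^ i * ?w z) integrable_on {-1..1}" for i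
    by (intro integrable_continuous_real continuous_intros)
  then have "integral {-1..1} ?D = (real j + 1) * cap_moment k j - (real k + real j + 2) * cap_moment k (j + 2)"
    unfolding cap_moment_def using i[of j] i[of "j + 2"]
    by (subst Henstock_Kurzweil_Integration.integral_diff) (simp_all only: integrable_on_mult_right integral_mult_right)
  ultimately show ?thesis by (simp add: field_simps)
qed

lemma cap_moment_0_pos: "cap_moment k 0 > 0"
proof -
  let ?w = "\<lambda>z::real. z ^ 0 * sqrt (1 - z\<^sup>2) ^ (k - 1)"
  have c: "continuous_on {-1..1} ?w" by (intro continuous_intros)
  have nn: "?w z \<ge> 0" if "z \<in> {-1..1}" for z
    using that by (auto simp: abs_square_le_1)
  have "integral {-1..1} ?w \<noteq> 0"
  proof
    assume "integral {-1..1} ?w = 0"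
    have "\<forall>z\<in>{-1..1}. ?w z = 0"
      by (rule iffD1[OF integral_eq_0_iff[OF c]]) (use nn \<open>integral {-1..1} ?w = 0\<close> in blast | simp)+
    then have "?w 0 = 0" by (rule bspec) simp
    then show False by simp
  qed
  moreover have "integral {-1..1} ?w \<ge> 0" using nn by (rule integral_nonneg[OF integrable_continuous_real[OF c]])
  ultimately show ?thesis by (simp add: cap_moment_def)
qed

lemma cap_moment_values:
  assumes "k \<ge> 1"
  shows "cap_moment k 2 = 1 / (real k + 2) * cap_moment k 0"
    "cap_moment k 4 = 3 / ((real k + 2) * (real k + 4)) * cap_moment k 0"
    "cap_moment k 6 = 15 / ((real k + 2) * (real k + 4) * (real k + 6)) * cap_moment k 0"
    "cap_moment k 8 = 105 / ((real k + 2) * (real k + 4) * (real k + 6) * (real k + 8)) * cap_moment k 0"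
  using cap_moment_rec[OF assms, of 0] cap_moment_rec[OF assms, of 2]
    cap_moment_rec[OF assms, of 4] cap_moment_rec[OF assms, of 6]
  by (simp_all add: mult_ac add_ac del: add_2_eq_Suc add_2_eq_Suc')

text \<open>Up to the factor \<open>unit_ball_vol (k - 1)\<close>, the volume of the \<open>k\<close>-dimensional body with
  support function \<open>1 + \<tau> (u \<bullet> f)\<^sup>4\<close> on the unit sphere, cut into slices orthogonal to \<open>f\<close>.\<close>

definition slice_radius :: "real \<Rightarrow> real \<Rightarrow> real" where
  "slice_radius \<tau> z = (1 - 3 * \<tau> * z ^ 4) * sqrt (1 - z\<^sup>2)"

text \<open>At a unit vector u with u \<bullet> f = z, the gradient of |x| + \<tau> (x \<bullet>
  f)^4 / |x|^3 is u + \<tau> (4 z^3 f - 3 z^4 u). This is its component along f, and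
  \<open>slice_radius\<close> is the length of the component orthogonal to f. The parameter z
  describes the normal and not the position, which keeps both formulas explicit.\<close>

definition slice_height :: "real \<Rightarrow> real \<Rightarrow> real" where
  "slice_height \<tau> z = z + \<tau> * (4 * z ^ 3 - 3 * z ^ 5)"

definition slice_height' :: "real \<Rightarrow> real \<Rightarrow> real" where
  "slice_height' \<tau> z = 1 + \<tau> * (12 * z\<^sup>2 - 15 * z ^ 4)"

definition profile :: "nat \<Rightarrow> real \<Rightarrow> real" where
  "profile k \<tau> = integral {-1..1} (\<lambda>z. slice_radius \<tau> z ^ (k - 1) * slice_height' \<tau> z)"

definition rel_profile :: "nat \<Rightarrow> real \<Rightarrow> real" where
  "rel_profile k \<tau> = profile k \<tau> / profile k 0"

lemma slice_height_deriv: "(slice_height \<tau> has_real_derivative slice_height' \<tau> z) (at z)"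
  unfolding slice_height_def[abs_def] slice_height'_def
  by (auto intro!: derivative_eq_intros simp: algebra_simps)

lemma power4_le_power2:
  fixes z :: real
  assumes "\<bar>z\<bar> \<le> 1"
  shows "z ^ 4 \<le> z\<^sup>2"
  using power_decreasing[of 2 4 "\<bar>z\<bar>"] assms by simp

lemma slice_height'_ge:
  assumes "0 \<le> \<tau>" "z \<in> {-1..1}"
  shows "slice_height' \<tau> z \<ge> 1 - 3 * \<tau>"
proof -
  have "\<bar>z\<bar> \<le> 1" "z\<^sup>2 \<le> 1" using assms by (auto simp: abs_square_le_1)
  then have "12 * z\<^sup>2 - 15 * z ^ 4 \<ge> - 3"
    using power4_le_power2[of z] by linarith
  then have "\<tau> * (12 * z\<^sup>2 - 15 * z ^ 4) \<ge> \<tau> * (-3)" using assms by (intro mult_left_mono) auto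
  then show ?thesis by (simp add: slice_height'_def)
qed

lemma slice_radius_factor_ge:
  fixes z \<tau> :: real
  assumes "0 \<le> \<tau>" "z \<in> {-1..1}"
  shows "1 - 3 * \<tau> * z ^ 4 \<ge> 1 - 3 * \<tau>"
proof -
  have "\<bar>z\<bar> \<le> 1" "z\<^sup>2 \<le> 1" using assms by (auto simp: abs_square_le_1)
  then have "z ^ 4 \<le> 1" using power4_le_power2[of z] by linarith
  then have "3 * \<tau> * z ^ 4 \<le> 3 * \<tau> * 1" using assms by (intro mult_left_mono) auto
  then show ?thesis by simp
qed

lemma profile_0: "profile k 0 = cap_moment k 0"
  by (simp add: profile_def cap_moment_def slice_radius_def slice_height'_def)

text \<open>For \<tau> at most 1/6 each of the k factors, k - 1 from the radius and one from the
  height, is at least 1/2. The resulting bound does not depend on \<tau>, as the inversion of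
  expansions demands.\<close>

lemma profile_lower:
  assumes "k \<ge> 1" "\<tau> \<in> {0..1/6}"
  shows "profile k \<tau> \<ge> (1/2) ^ k * profile k 0"
proof -
  have "(1/2) ^ k * profile k 0 = integral {-1..1} (\<lambda>z. (1/2) ^ k * sqrt (1 - z\<^sup>2) ^ (k - 1))"
    by (simp add: profile_0 cap_moment_def)
  also have "\<dots> \<le> profile k \<tau>"
    unfolding profile_def
  proof (rule integral_le)
    show "(\<lambda>z. (1/2) ^ k * sqrt (1 - z\<^sup>2) ^ (k - 1)) integrable_on {-1..1}"
      by (intro integrable_continuous_real continuous_intros)
    show "(\<lambda>z. slice_radius \<tau> z ^ (k - 1) * slice_height' \<tau> z) integrable_on {-1..1}"
      unfolding slice_radius_def slice_height'_def
      by (intro integrable_continuous_real continuous_intros)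
    fix z :: real assume z: "z \<in> {-1..1}"
    have s: "0 \<le> sqrt (1 - z\<^sup>2)" using z by (auto simp: abs_square_le_1)
    have a: "1/2 \<le> 1 - 3 * \<tau> * z ^ 4" "1/2 \<le> slice_height' \<tau> z"
      using slice_radius_factor_ge[of \<tau> z] slice_height'_ge[of \<tau> z] assms z by auto
    have "(1/2) ^ k = (1/2) ^ (k - 1) * (1/2 :: real)" using assms by (cases k) auto
    then have "(1/2) ^ k * sqrt (1 - z\<^sup>2) ^ (k - 1) = ((1/2) ^ (k - 1) * (1/2)) * sqrt (1 - z\<^sup>2) ^ (k - 1)" by simp
    also have "\<dots> \<le> ((1 - 3 * \<tau> * z ^ 4) ^ (k - 1) * slice_height' \<tau> z) * sqrt (1 - z\<^sup>2) ^ (k - 1)"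
      using a s by (intro mult_right_mono mult_mono power_mono) auto
    finally show "(1/2) ^ k * sqrt (1 - z\<^sup>2) ^ (k - 1) \<le> slice_radius \<tau> z ^ (k - 1) * slice_height' \<tau> z"
      by (simp add: slice_radius_def power_mult_distrib mult_ac)
  qed
  finally show ?thesis .
qed

lemma rel_profile_lower:
  assumes "k \<ge> 1" "\<tau> \<in> {0..1/6}"
  shows "rel_profile k \<tau> \<ge> (1/2) ^ k"
  using profile_lower[OF assms] cap_moment_0_pos[of k]
  by (simp add: rel_profile_def profile_0 field_simps)

text \<open>The integrand is expanded pointwise in z and then integrated over [-1, 1]; the
  coefficients reduce to the moments of order 2, 4, 6 and 8. For k = 1 the result reads 1 + \<tau>,
  the relative length of an interval.\<close>

lemma jet2_rel_profile:
  assumes k: "k \<ge> 1"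
  shows "jet2 {u} (\<lambda>\<tau> _. rel_profile k \<tau>) (\<lambda>_. 1) (\<lambda>_. 3 / (real k + 2))
    (\<lambda>_. - 135 * (real k - 1) / (2 * (real k + 2) * (real k + 4) * (real k + 6)))"
proof -
  let ?I = "{-1..1::real}"
  let ?k = "real (k - 1)"
  define w where "w z = sqrt (1 - z\<^sup>2) ^ (k - 1)" for z :: real
  define M where "M = restrict_space lborel ?I"
  have sp: "space M = ?I" by (simp add: M_def space_restrict_space)
  interpret M: finite_measure M
    by (rule finite_measureI) (simp add: M_def emeasure_restrict_space space_restrict_space)
  have meas: "f \<in> borel_measurable M" if "continuous_on UNIV f" for f :: "real \<Rightarrow> real"
    using borel_measurable_continuous_onI[OF that] unfolding M_def
    by (intro measurable_restrict_space1) simp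
  have int: "(\<integral>z. f z \<partial>M) = integral ?I f" if "continuous_on UNIV f" for f :: "real \<Rightarrow> real"
  proof -
    have "set_integrable lborel ?I f"
      using that by (intro borel_integrable_atLeastAtMost') (auto intro: continuous_on_subset)
    then show ?thesis
      unfolding M_def using set_borel_integral_eq_integral(2)[of "?I" f]
      by (subst integral_restrict_space) (auto simp: set_lebesgue_integral_def)
  qed
  have pw: "\<bar>z ^ i\<bar> \<le> 1" if "z \<in> ?I" for z :: real and i
    using that by (auto simp: power_abs intro!: power_le_one)
  have j1: "jet2 ?I (\<lambda>\<tau> z. 1 - 3 * \<tau> * z ^ 4) (\<lambda>_. 1) (\<lambda>z. - 3 * z ^ 4) (\<lambda>_. 0)"
  proof (rule jet2_cong[OF jet2_poly[of ?I "\<lambda>_. 1" 3 "\<lambda>z. - 3 * z ^ 4" "\<lambda>_. 0"]])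
    show "\<bar>- 3 * z ^ 4\<bar> \<le> 3" if "z \<in> ?I" for z :: real
      using pw[OF that, of 4] by simp
  qed auto
  have j2: "jet2 ?I slice_height' (\<lambda>_. 1) (\<lambda>z. 12 * z ^ 2 - 15 * z ^ 4) (\<lambda>_. 0)"
  proof (rule jet2_cong[OF jet2_poly[of ?I "\<lambda>_. 1" 27 "\<lambda>z. 12 * z ^ 2 - 15 * z ^ 4" "\<lambda>_. 0"]])
    show "\<bar>12 * z ^ 2 - 15 * z ^ 4\<bar> \<le> 27" if "z \<in> ?I" for z :: real
      using pw[OF that, of 2] pw[OF that, of 4] by linarith
  qed (auto simp: slice_height'_def)
  have j3: "jet2 ?I (\<lambda>_. w) w (\<lambda>_. 0) (\<lambda>_. 0)"
  proof -
    have "jet2 ?I (\<lambda>x z. w z + 0 * x + 0 * x\<^sup>2) w (\<lambda>_. 0) (\<lambda>_. 0)"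
      by (rule jet2_poly[of _ _ 1]) (auto simp: w_def power_abs abs_square_le_1 intro!: power_le_one)
    then show ?thesis by simp
  qed
  \<comment> \<open>\<open>B\<close> and \<open>C\<close> are the coefficients of \<tau> and
    \<tau>^2 in (1 - 3 \<tau> z^4)^(k - 1) (1 + \<tau> (12 z^2 - 15 z^4)); the weight
    \<open>w\<close> is carried along as a third factor.\<close>
  define B where "B z = 12 * z ^ 2 - (15 + 3 * ?k) * z ^ 4" for z :: real
  define C where "C z = 9 * (?k * (?k - 1) / 2) * z ^ 8 - 3 * ?k * (12 * z ^ 6 - 15 * z ^ 8)" for z :: real
  have "jet2 ?I (\<lambda>\<tau> z. slice_radius \<tau> z ^ (k - 1) * slice_height' \<tau> z) w (\<lambda>z. B z * w z) (\<lambda>z. C z * w z)"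
  proof (rule jet2_cong[OF jet2_mult[OF jet2_mult[OF jet2_power[OF j1, of "k - 1"] j2] j3]])
    fix \<tau> z :: real
    show "(1 - 3 * \<tau> * z ^ 4) ^ (k - 1) * slice_height' \<tau> z * w z = slice_radius \<tau> z ^ (k - 1) * slice_height' \<tau> z"
      by (simp add: slice_radius_def w_def power_mult_distrib)
  next
    fix z :: real
    have "z ^ 4 * (12 * z\<^sup>2 - 15 * z ^ 4) = 12 * z ^ 6 - 15 * z ^ 8"
      by algebra
    then have "- 3 * z ^ 4 * (12 * z\<^sup>2 - 15 * z ^ 4) = - 3 * (12 * z ^ 6 - 15 * z ^ 8)" by simp
    moreover have "(- 3 * z ^ 4)\<^sup>2 = 9 * z ^ 8" by algebra
    ultimately show "1 ^ (k - 1) * 1 * 0 + (1 ^ (k - 1) * (12 * z\<^sup>2 - 15 * z ^ 4) + ?k * 1 ^ (k - 1 - 1) * (- 3 * z ^ 4) * 1) * 0 +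
         (1 ^ (k - 1) * 0 + ?k * 1 ^ (k - 1 - 1) * (- 3 * z ^ 4) * (12 * z\<^sup>2 - 15 * z ^ 4) +
          (?k * 1 ^ (k - 1 - 1) * 0 + ?k * (?k - 1) / 2 * 1 ^ (k - 1 - 2) * (- 3 * z ^ 4)\<^sup>2) * 1) * w z = C z * w z"
      by (simp only: C_def mult.assoc power_one mult_1_left mult_1_right mult_zero_right add_0_left) (simp add: algebra_simps)
    show "1 ^ (k - 1) * 1 * 0 + (1 ^ (k - 1) * (12 * z\<^sup>2 - 15 * z ^ 4) + ?k * 1 ^ (k - 1 - 1) * (- 3 * z ^ 4) * 1) * w z = B z * w z"
      by (simp add: B_def algebra_simps)
  qed simp
  then have "jet2 {u} (\<lambda>\<tau> _. \<integral>z. slice_radius \<tau> z ^ (k - 1) * slice_height' \<tau> z \<partial>M)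
     (\<lambda>_. \<integral>z. w z \<partial>M) (\<lambda>_. \<integral>z. B z * w z \<partial>M) (\<lambda>_. \<integral>z. C z * w z \<partial>M)"
    by (intro jet2_integral meas M.finite_measure_axioms)
      (auto simp: sp slice_radius_def slice_height'_def w_def[abs_def] B_def C_def intro!: continuous_intros)
  then have "jet2 {u} (\<lambda>\<tau> _. 1 / cap_moment k 0 * (\<integral>z. slice_radius \<tau> z ^ (k - 1) * slice_height' \<tau> z \<partial>M))
     (\<lambda>_. 1 / cap_moment k 0 * (\<integral>z. w z \<partial>M)) (\<lambda>_. 1 / cap_moment k 0 * (\<integral>z. B z * w z \<partial>M))
     (\<lambda>_. 1 / cap_moment k 0 * (\<integral>z. C z * w z \<partial>M))"
    by (rule jet2_scale)
  moreover have "(\<integral>z. slice_radius \<tau> z ^ (k - 1) * slice_height' \<tau> z \<partial>M) = profile k \<tau>" for \<tau>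
    unfolding profile_def by (rule int) (auto simp: slice_radius_def slice_height'_def intro!: continuous_intros)
  moreover have "(\<integral>z. w z \<partial>M) = cap_moment k 0"
    unfolding cap_moment_def by (subst int) (auto simp: w_def[abs_def] intro!: continuous_intros)
  moreover have mi: "integrable M (\<lambda>z. z ^ i * w z)" for i
  proof (rule M.integrable_const_bound[of _ 1])
    show "AE z in M. norm (z ^ i * w z) \<le> 1"
      by (rule AE_I2) (auto simp: sp w_def abs_mult power_abs abs_square_le_1 intro!: mult_le_one power_le_one)
  qed (auto simp: w_def intro!: meas continuous_intros)
  have mv: "(\<integral>z. z ^ i * w z \<partial>M) = cap_moment k i" for i
    unfolding cap_moment_def by (subst int) (auto simp: w_def[abs_def] intro!: continuous_intros)
  have nz: "cap_moment k 0 \<noteq> 0" using cap_moment_0_pos[of k] by simp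
  have kk: "?k = real k - 1" using k by simp
  have b: "(\<integral>z. B z * w z \<partial>M) / cap_moment k 0 = 3 / (real k + 2)"
  proof -
    have "(\<integral>z. B z * w z \<partial>M) = 12 * cap_moment k 2 - (15 + 3 * ?k) * cap_moment k 4"
      using mi[of 2] mi[of 4] mv[of 2] mv[of 4]
      by (simp add: B_def left_diff_distrib mult.assoc)
    also have "\<dots> = (12 * (1 / (real k + 2)) - (12 + 3 * real k) * (3 / ((real k + 2) * (real k + 4)))) * cap_moment k 0"
      unfolding cap_moment_values[OF k] kk by (simp add: algebra_simps)
    also have "12 * (1 / (real k + 2)) - (12 + 3 * real k) * (3 / ((real k + 2) * (real k + 4))) = 3 / (real k + 2)"
      by (simp add: divide_simps)
    finally show ?thesis
      using nz by simp
  qed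
  have c: "(\<integral>z. C z * w z \<partial>M) / cap_moment k 0
      = - 135 * (real k - 1) / (2 * (real k + 2) * (real k + 4) * (real k + 6))"
  proof -
  have "(\<integral>z. C z * w z \<partial>M) = (9 * (?k * (?k - 1) / 2) + 45 * ?k) * cap_moment k 8 - 36 * ?k * cap_moment k 6"
  proof -
    have "C z * w z = (9 * (?k * (?k - 1) / 2) + 45 * ?k) * (z ^ 8 * w z) - (36 * ?k) * (z ^ 6 * w z)" for z
      by (simp add: C_def algebra_simps)
    then show ?thesis using mi[of 8] mi[of 6] mv[of 8] mv[of 6] by simp
  qed
  also have "\<dots> = ((9 * ((real k - 1) * (real k - 1 - 1) / 2) + 45 * (real k - 1)) * (105 / ((real k + 2) * (real k + 4) * (real k + 6) * (real k + 8)))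
      - 36 * (real k - 1) * (15 / ((real k + 2) * (real k + 4) * (real k + 6)))) * cap_moment k 0"
      unfolding cap_moment_values[OF k] kk by (simp add: algebra_simps)
  also have "(9 * ((real k - 1) * (real k - 1 - 1) / 2) + 45 * (real k - 1)) * (105 / ((real k + 2) * (real k + 4) * (real k + 6) * (real k + 8)))
      - 36 * (real k - 1) * (15 / ((real k + 2) * (real k + 4) * (real k + 6)))
      = - 135 * (real k - 1) / (2 * (real k + 2) * (real k + 4) * (real k + 6))"
    by (simp add: divide_simps) algebra
  finally show ?thesis using nz by simp
  qed
  ultimately show ?thesis using nz b c by (simp add: rel_profile_def profile_0)
qed

lemma measurable_profile [measurable]: "profile k \<in> borel_measurable borel"
proof -
  have "profile k \<tau> = (\<integral>z. indicator {-1..1} z * (slice_radius \<tau> z ^ (k - 1) * slice_height' \<tau> z) \<partial>lborel)" for \<tau>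
  proof -
    have "set_integrable lborel {-1..1} (\<lambda>z. slice_radius \<tau> z ^ (k - 1) * slice_height' \<tau> z)"
      unfolding slice_radius_def slice_height'_def
      by (intro borel_integrable_atLeastAtMost' continuous_intros)
    from set_borel_integral_eq_integral(2)[OF this] show ?thesis
      by (simp add: profile_def set_lebesgue_integral_def)
  qed
  then have "profile k = (\<lambda>\<tau>. \<integral>z. indicator {-1..1} z * (slice_radius \<tau> z ^ (k - 1) * slice_height' \<tau> z) \<partial>lborel)"
    by (rule ext)
  then show ?thesis unfolding slice_radius_def slice_height'_def by simp
qed

lemma measurable_rel_profile [measurable]: "rel_profile k \<in> borel_measurable borel"
  unfolding rel_profile_def[abs_def] by measurable

section \<open>Second-order comparison of negative moments\<close>

definition moment_coeff :: "real \<Rightarrow> real \<Rightarrow> real" where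
  "moment_coeff n k = n * (135 * (k - 1) / (2 * (k + 2) * (k + 4) * (k + 6))) + n * (n + 1) / 2 * (3 / (k + 2))\<^sup>2"

text \<open>The power -n is handled as the n-th power of the inverse, so only polynomial operations
  on jets occur. If the relative profile is 1 + \<alpha> \<tau> + \<beta> \<tau>^2, the inverse
  power has second coefficient -n \<beta> + n (n + 1) / 2 \<alpha>^2, which is
  \<open>moment_coeff\<close>. The function \<open>a\<close> stands for the length of the projection
  of e.\<close>

lemma jet2_profile_moment:
  fixes a :: "'f \<Rightarrow> real"
  assumes "prob_space M" and k: "k \<ge> 1"
    and a [measurable]: "a \<in> borel_measurable M" and a01: "\<And>F. F \<in> space M \<Longrightarrow> 0 \<le> a F \<and> a F \<le> 1"
  shows "jet2 U (\<lambda>t _. \<integral>F. inverse (rel_profile k (t * a F ^ 4)) ^ n \<partial>M) (\<lambda>_. 1)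
    (\<lambda>_. - (3 * real n / (real k + 2)) * (\<integral>F. a F ^ 4 \<partial>M))
    (\<lambda>_. moment_coeff n k * (\<integral>F. a F ^ 8 \<partial>M))"
proof -
  interpret prob_space M by fact
  let ?b = "- (3 * real n / (real k + 2))"
  let ?c = "moment_coeff n k"
  have "jet2 {()} (\<lambda>\<tau> _. inverse (rel_profile k \<tau>)) (\<lambda>_. 1) (\<lambda>_. - (3 / (real k + 2)))
    (\<lambda>_. (3 / (real k + 2))\<^sup>2 - (- 135 * (real k - 1) / (2 * (real k + 2) * (real k + 4) * (real k + 6))))"
    by (rule jet2_inverse[OF jet2_rel_profile[OF k], of "(1/2) ^ k"]) (use rel_profile_lower[OF k] in auto)
  from jet2_power[OF this, of n]
  have j: "jet2 {()} (\<lambda>\<tau> _. inverse (rel_profile k \<tau>) ^ n) (\<lambda>_. 1) (\<lambda>_. ?b) (\<lambda>_. ?c)"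
    by (rule jet2_cong) (simp_all add: moment_coeff_def algebra_simps add_divide_distrib diff_divide_distrib)
  have "jet2 (space M) (\<lambda>t F. inverse (rel_profile k (t * a F ^ 4)) ^ n) (\<lambda>_. 1) (\<lambda>F. ?b * a F ^ 4) (\<lambda>F. ?c * (a F ^ 4)\<^sup>2)"
    using a01 by (intro jet2_subst[OF j]) (auto intro: power_le_one)
  from jet2_integral[OF finite_measure_axioms this]
  show ?thesis by (rule jet2_cong) (simp_all add: prob_space flip: power_mult)
qed

text \<open>\<open>A\<close> and \<open>B\<close> are the first two coefficients of the mean with
  the projection moments inserted, so the two sides of the inequality are the second coefficients of
  its powers m and k. After cancellation A k = -3 k / (n + 2), which is linear in k; hence the
  agreement at first order.\<close>

lemma second_order_gap:
  fixes m k n :: real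
  assumes m: "1 \<le> m" "m < k" "1 \<le> n" and gap: "(m + 2) * (k + 2) < n + 2"
  defines "A \<equiv> \<lambda>k. - (3 * n / (k + 2)) * (k * (k + 2) / (n * (n + 2)))"
    and "B \<equiv> \<lambda>k. moment_coeff n k
        * (k * (k + 2) * (k + 4) * (k + 6) / (n * (n + 2) * (n + 4) * (n + 6)))"
  shows "k * A m = m * A k"
    and "m * B k + m * (m - 1) / 2 * (A k)\<^sup>2 < k * B m + k * (k - 1) / 2 * (A m)\<^sup>2"
proof -
  have A: "A k = - 3 * k / (n + 2)" if "k > 0" for k
    unfolding A_def using that m(3) by (simp add: divide_simps)
  show "k * A m = m * A k" using m by (simp add: A)
  let ?P = "2 * (n + 2) * (n + 4) * (n + 6)"
  \<comment> \<open>The moment cancels the denominators except for one factor k + 2, and (k + 4) (k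
    + 6) / (k + 2) = k + 8 + 8 / (k + 2). The last fraction is the source of (m + 2) (k + 2) in the
    final condition.\<close>
  have B: "B k = 9 * k * (15 * (k - 1) + (n + 1) * (k + 8 + 8 / (k + 2))) / ?P" if "k > 0" for k
  proof -
    have "B k * ?P = n * (135 * (k - 1) / (2 * (k + 2) * (k + 4) * (k + 6))) * (k * (k + 2) * (k + 4) * (k + 6) / (n * (n + 2) * (n + 4) * (n + 6))) * ?P
       + n * (n + 1) / 2 * (3 / (k + 2))\<^sup>2 * (k * (k + 2) * (k + 4) * (k + 6) / (n * (n + 2) * (n + 4) * (n + 6))) * ?P"
      by (simp only: B_def moment_coeff_def distrib_right)
    also have "n * (135 * (k - 1) / (2 * (k + 2) * (k + 4) * (k + 6))) * (k * (k + 2) * (k + 4) * (k + 6) / (n * (n + 2) * (n + 4) * (n + 6))) * ?P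
       = 135 * (k - 1) * k"
      using that m(3) by (simp add: divide_simps) (algebra | (intro disjI2, algebra))
    also have "n * (n + 1) / 2 * (3 / (k + 2))\<^sup>2 * (k * (k + 2) * (k + 4) * (k + 6) / (n * (n + 2) * (n + 4) * (n + 6))) * ?P
       = 9 * k * (n + 1) * ((k + 4) * (k + 6) / (k + 2))"
      using that m(3) by (simp add: divide_simps power2_eq_square) algebra
    also have "(k + 4) * (k + 6) / (k + 2) = k + 8 + 8 / (k + 2)"
      using that by (simp add: divide_simps) (simp add: algebra_simps)
    finally have "B k * ?P = 9 * k * (15 * (k - 1) + (n + 1) * (k + 8 + 8 / (k + 2)))"
      by (simp add: algebra_simps add_divide_distrib)
    moreover have "?P \<noteq> 0" using m(3) by simp
    ultimately show ?thesis by (metis nonzero_eq_divide_eq)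
  qed
  have km: "0 < k" "0 < m" using m by auto
  \<comment> \<open>This is 8 (n + 1) times (n + 2) / ((m + 2) (k + 2)) - 1, so its sign is exactly
    the dimension condition.\<close>
  define D where "D = 8 * (n + 1) * (n + 2) / ((m + 2) * (k + 2)) - 8 * (n + 1)"
  have "D > 0"
    using gap m km unfolding D_def by (simp add: divide_simps mult_strict_left_mono mult.assoc)
  have "k * B m + k * (k - 1) / 2 * (A m)\<^sup>2 - (m * B k + m * (m - 1) / 2 * (A k)\<^sup>2)
      = 9 * m * k * (k - m) / (2 * (n + 2)\<^sup>2 * (n + 4) * (n + 6)) * D"
  proof -
    have 1: "8 / (m + 2) - 8 / (k + 2) = (k - m) * (8 / ((m + 2) * (k + 2)))"
      using km by (simp add: divide_simps)
    have g: "k * (9 * m * X / Q) - m * (9 * k * Y / Q) = 9 * m * k * (X - Y) / Q" for X Y Q :: real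
      by (simp add: algebra_simps diff_divide_distrib)
    have "k * B m - m * B k = 9 * m * k * ((15 * (m - 1) + (n + 1) * (m + 8 + 8 / (m + 2))) - (15 * (k - 1) + (n + 1) * (k + 8 + 8 / (k + 2)))) / ?P"
      unfolding B[OF km(1)] B[OF km(2)] by (rule g)
    also have "(15 * (m - 1) + (n + 1) * (m + 8 + 8 / (m + 2))) - (15 * (k - 1) + (n + 1) * (k + 8 + 8 / (k + 2)))
        = (n + 1) * (8 / (m + 2) - 8 / (k + 2)) - (n + 16) * (k - m)"
      by (simp add: algebra_simps)
    also have "\<dots> = (k - m) * ((n + 1) * (8 / ((m + 2) * (k + 2))) - (n + 16))"
      unfolding 1 by (simp add: algebra_simps)
    finally have 2: "k * B m - m * B k = 9 * m * k * (k - m) / ?P * ((n + 1) * (8 / ((m + 2) * (k + 2))) - (n + 16))"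
      by simp
    have 3: "k * (k - 1) / 2 * (A m)\<^sup>2 - m * (m - 1) / 2 * (A k)\<^sup>2 = 9 * m * k * (k - m) / (2 * (n + 2)\<^sup>2)"
      unfolding A[OF km(1)] A[OF km(2)] using m(3) by (simp add: divide_simps) (simp add: algebra_simps power2_eq_square)
    define Y where "Y = 8 / ((m + 2) * (k + 2))"
    have D: "D = (n + 1) * (n + 2) * Y - 8 * (n + 1)" by (simp add: D_def Y_def)
    have "9 * m * k * (k - m) / ?P * ((n + 1) * Y - (n + 16)) + 9 * m * k * (k - m) / (2 * (n + 2)\<^sup>2)
       = 9 * m * k * (k - m) / (2 * (n + 2)\<^sup>2 * (n + 4) * (n + 6)) * ((n + 2) * ((n + 1) * Y - (n + 16)) + (n + 4) * (n + 6))"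
      using m(3) by (simp add: divide_simps) (simp add: algebra_simps power2_eq_square)
    \<comment> \<open>The quadratic terms in n cancel: (n + 4) (n + 6) - (n + 2) (n + 16) = -8 (n +
      1).\<close>
    also have "(n + 2) * ((n + 1) * Y - (n + 16)) + (n + 4) * (n + 6) = D"
      by (simp add: D algebra_simps)
    finally show ?thesis using 2 3 unfolding Y_def by linarith
  qed
  also have "\<dots> > 0" using \<open>D > 0\<close> m km by (intro mult_pos_pos divide_pos_pos) auto
  finally show "m * B k + m * (m - 1) / 2 * (A k)\<^sup>2 < k * B m + k * (k - 1) / 2 * (A m)\<^sup>2" by simp
qed

text \<open>The two means live on different Grassmannians, so two unrelated probability spaces are
  allowed. All that enters about the random lengths are their fourth and eighth moments.\<close>

lemma profile_moment_less:
  fixes a :: "'f \<Rightarrow> real" and a' :: "'g \<Rightarrow> real" and n :: nat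
  assumes M: "prob_space M" "a \<in> borel_measurable M" "\<And>F. F \<in> space M \<Longrightarrow> 0 \<le> a F \<and> a F \<le> 1"
    and M': "prob_space M'" "a' \<in> borel_measurable M'" "\<And>F. F \<in> space M' \<Longrightarrow> 0 \<le> a' F \<and> a' F \<le> 1"
    and mk: "1 \<le> m" "m < k" "(m + 2) * (k + 2) < n + 2"
    and a: "(\<integral>F. a F ^ 4 \<partial>M) = real m * (real m + 2) / (real n * (real n + 2))"
      "(\<integral>F. a F ^ 8 \<partial>M) = real m * (real m + 2) * (real m + 4) * (real m + 6) / (real n * (real n + 2) * (real n + 4) * (real n + 6))"
    and a': "(\<integral>F. a' F ^ 4 \<partial>M') = real k * (real k + 2) / (real n * (real n + 2))"
      "(\<integral>F. a' F ^ 8 \<partial>M') = real k * (real k + 2) * (real k + 4) * (real k + 6) / (real n * (real n + 2) * (real n + 4) * (real n + 6))"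
  shows "\<exists>t. 0 < t \<and> t \<le> 1/6 \<and>
    (\<integral>F. inverse (rel_profile k (t * a' F ^ 4)) ^ n \<partial>M') ^ m < (\<integral>F. inverse (rel_profile m (t * a F ^ 4)) ^ n \<partial>M) ^ k"
proof -
  have k: "1 \<le> k" using mk by simp
  have n: "1 \<le> n"
  proof (rule ccontr)
    assume "\<not> 1 \<le> n"
    with mk(3) show False by simp
  qed
  have g: "(real m + 2) * (real k + 2) < real n + 2"
  proof -
    have "real ((m + 2) * (k + 2)) < real (n + 2)" using mk(3) by (simp only: of_nat_less_iff)
    then show ?thesis by (simp only: of_nat_mult of_nat_add of_nat_numeral)
  qed
  note gap = second_order_gap[of "real m" "real k" "real n", OF _ _ _ g, folded a a']
  have mkn: "1 \<le> real m" "real m < real k" "1 \<le> real n" using mk n by auto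
  note jm = jet2_power[OF jet2_profile_moment[OF M(1) mk(1) M(2,3), where U="{()}" and n=n], of k]
  note jk = jet2_power[OF jet2_profile_moment[OF M'(1) k M'(2,3), where U="{()}" and n=n], of m]
  show ?thesis
  proof (rule jet2_less)
    show "jet2 {()} (\<lambda>t _. (\<integral>F. inverse (rel_profile k (t * a' F ^ 4)) ^ n \<partial>M') ^ m) (\<lambda>_. 1)
       (\<lambda>_. real m * (- (3 * real n / (real k + 2)) * (\<integral>F. a' F ^ 4 \<partial>M')))
       (\<lambda>_. real m * (moment_coeff n k * (\<integral>F. a' F ^ 8 \<partial>M')) +
         real m * (real m - 1) / 2 * (- (3 * real n / (real k + 2)) * (\<integral>F. a' F ^ 4 \<partial>M'))\<^sup>2)"
      by (rule jet2_cong[OF jk]) (simp_all only: power_one mult_1_right)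
    show "jet2 {()} (\<lambda>t _. (\<integral>F. inverse (rel_profile m (t * a F ^ 4)) ^ n \<partial>M) ^ k) (\<lambda>_. 1)
       (\<lambda>_. real m * (- (3 * real n / (real k + 2)) * (\<integral>F. a' F ^ 4 \<partial>M')))
       (\<lambda>_. real k * (moment_coeff n m * (\<integral>F. a F ^ 8 \<partial>M)) +
         real k * (real k - 1) / 2 * (- (3 * real n / (real m + 2)) * (\<integral>F. a F ^ 4 \<partial>M))\<^sup>2)"
      by (rule jet2_cong[OF jm]) (simp_all only: power_one mult_1_right gap(1)[OF mkn])
  qed (rule gap(2)[OF mkn])
qed

section \<open>Lebesgue measure from an orthonormal basis\<close>

text \<open>Fubini applied to \<open>\<nu>(A) \<lambda>(B)\<close> after the shear \<open>(x, y) \<mapsto> (x, x + y)\<close>.\<close>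

lemma invariant_measure_proportional:
  fixes \<nu> \<rho> :: "'b::euclidean_space measure"
  assumes sf: "sigma_finite_measure \<nu>" "sigma_finite_measure \<rho>"
    and s [simp, measurable_cong]: "sets \<nu> = sets borel" "sets \<rho> = sets borel"
    and conc: "AE x in \<nu>. x \<in> S" "AE x in \<rho>. x \<in> S"
    and \<nu>: "\<And>v. v \<in> S \<Longrightarrow> distr \<nu> borel (\<lambda>x. x + v) = \<nu>"
    and \<rho>: "\<And>v. v \<in> S \<Longrightarrow> distr \<rho> borel (\<lambda>x. x + v) = \<rho>"
    and refl: "distr \<rho> borel uminus = \<rho>" and S: "\<And>v. v \<in> S \<Longrightarrow> - v \<in> S"
    and A [measurable]: "A \<in> sets borel" and B [measurable]: "B \<in> sets borel"
  shows "emeasure \<nu> A * emeasure \<rho> B = emeasure \<nu> B * emeasure \<rho> A"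
proof -
  interpret pair_sigma_finite \<nu> \<rho> using sf by (rule pair_sigma_finite.intro)
  have "emeasure \<nu> A * emeasure \<rho> B = (\<integral>\<^sup>+x. indicator A x * emeasure \<rho> B \<partial>\<nu>)"
    by (simp add: nn_integral_multc)
  also have "\<dots> = (\<integral>\<^sup>+x. (\<integral>\<^sup>+y. indicator A x * indicator B (y + x) \<partial>\<rho>) \<partial>\<nu>)"
  proof (rule nn_integral_cong_AE, use conc(1) in eventually_elim)
    fix x assume x: "x \<in> S"
    have "emeasure \<rho> B = emeasure (distr \<rho> borel (\<lambda>y. y + x)) B" using \<rho>[OF x] by simp
    also have "\<dots> = (\<integral>\<^sup>+y. indicator B y \<partial>distr \<rho> borel (\<lambda>y. y + x))" by simp
    also have "\<dots> = (\<integral>\<^sup>+y. indicator B (y + x) \<partial>\<rho>)" by (subst nn_integral_distr) auto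
    finally show "indicator A x * emeasure \<rho> B = (\<integral>\<^sup>+y. indicator A x * indicator B (y + x) \<partial>\<rho>)"
      by (simp add: nn_integral_cmult)
  qed
  also have "\<dots> = (\<integral>\<^sup>+y. (\<integral>\<^sup>+x. indicator A x * indicator B (y + x) \<partial>\<nu>) \<partial>\<rho>)"
    by (rule Fubini'[symmetric]) measurable
  also have "\<dots> = (\<integral>\<^sup>+y. (\<integral>\<^sup>+x. indicator A (x - y) * indicator B x \<partial>\<nu>) \<partial>\<rho>)"
  proof (rule nn_integral_cong_AE, use conc(2) in eventually_elim)
    fix y assume y: "y \<in> S"
    have "(\<integral>\<^sup>+x. indicator A x * indicator B (y + x) \<partial>\<nu>) = (\<integral>\<^sup>+x. indicator A x * indicator B (y + x) \<partial>distr \<nu> borel (\<lambda>x. x + - y))"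
      using \<nu>[OF S[OF y]] by simp
    also have "\<dots> = (\<integral>\<^sup>+x. indicator A (x - y) * indicator B x \<partial>\<nu>)"
      by (subst nn_integral_distr) auto
    finally show "(\<integral>\<^sup>+x. indicator A x * indicator B (y + x) \<partial>\<nu>) = (\<integral>\<^sup>+x. indicator A (x - y) * indicator B x \<partial>\<nu>)" .
  qed
  also have "\<dots> = (\<integral>\<^sup>+x. (\<integral>\<^sup>+y. indicator A (x - y) * indicator B x \<partial>\<rho>) \<partial>\<nu>)"
    by (rule Fubini') measurable
  also have "\<dots> = (\<integral>\<^sup>+x. indicator B x * emeasure \<rho> A \<partial>\<nu>)"
  proof (rule nn_integral_cong_AE, use conc(1) in eventually_elim)
    fix x assume x: "x \<in> S"
    have "(\<integral>\<^sup>+y. indicator A (x - y) \<partial>\<rho>) = (\<integral>\<^sup>+y. indicator A (x - y) \<partial>distr \<rho> borel uminus)"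
      using refl by simp
    also have "\<dots> = (\<integral>\<^sup>+y. indicator A (y + x) \<partial>\<rho>)" by (subst nn_integral_distr) (auto simp: add.commute)
    also have "\<dots> = (\<integral>\<^sup>+y. indicator A y \<partial>distr \<rho> borel (\<lambda>y. y + x))" by (subst nn_integral_distr) auto
    also have "\<dots> = emeasure \<rho> A" using \<rho>[OF x] by simp
    finally show "(\<integral>\<^sup>+y. indicator A (x - y) * indicator B x \<partial>\<rho>) = indicator B x * emeasure \<rho> A"
      by (cases "x \<in> B") auto
  qed
  also have "\<dots> = emeasure \<nu> B * emeasure \<rho> A" by (simp add: nn_integral_multc)
  finally show ?thesis .
qed

text \<open>Proportionality plus one test set of positive finite measure. The set \<open>S\<close>
  lets the measures be singular: both are carried by \<open>S\<close>, and translation invariance is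
  asked only along it, as for Lebesgue measure on a proper subspace.\<close>

lemma invariant_measure_eq:
  fixes \<nu> \<rho> :: "'b::euclidean_space measure"
  assumes sf: "sigma_finite_measure \<nu>" "sigma_finite_measure \<rho>"
    and s: "sets \<nu> = sets borel" "sets \<rho> = sets borel"
    and conc: "AE x in \<nu>. x \<in> S" "AE x in \<rho>. x \<in> S"
    and \<nu>: "\<And>v. v \<in> S \<Longrightarrow> distr \<nu> borel (\<lambda>x. x + v) = \<nu>"
    and \<rho>: "\<And>v. v \<in> S \<Longrightarrow> distr \<rho> borel (\<lambda>x. x + v) = \<rho>"
    and refl: "distr \<rho> borel uminus = \<rho>" and S: "\<And>v. v \<in> S \<Longrightarrow> - v \<in> S"
    and B: "B \<in> sets borel" "emeasure \<nu> B = emeasure \<rho> B" "emeasure \<rho> B \<noteq> 0" "emeasure \<rho> B \<noteq> \<infinity>"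
  shows "\<nu> = \<rho>"
proof (rule measure_eqI)
  fix A assume "A \<in> sets \<nu>"
  then have "A \<in> sets borel" using s by simp
  from invariant_measure_proportional[OF sf s conc \<nu> \<rho> refl S this B(1)] B
  show "emeasure \<nu> A = emeasure \<rho> A"
    by (simp add: ennreal_mult_cancel_left mult.commute[of _ "emeasure \<rho> B"])
qed (use s in simp)

section \<open>Product Lebesgue measure in orthonormal coordinates\<close>

abbreviation lborel_prod :: "'a set \<Rightarrow> ('a \<Rightarrow> real) measure" where
  "lborel_prod B \<equiv> \<Pi>\<^sub>M b\<in>B. lborel"

text \<open>The measure inside \<open>subspace_lborel\<close> with the basis as a parameter, so that
  independence of the chosen basis can be stated.\<close>

definition onb_measure :: "'a::real_inner set \<Rightarrow> 'a measure" where
  "onb_measure B = distr (lborel_prod B) borel (\<lambda>c. \<Sum>b\<in>B. c b *\<^sub>R b)"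

definition orthonormal :: "'a::real_inner set \<Rightarrow> bool" where
  "orthonormal B \<longleftrightarrow> finite B \<and> pairwise orthogonal B \<and> (\<forall>b\<in>B. norm b = 1)"

lemma orthonormal_inner:
  assumes "orthonormal B" "b \<in> B" "b' \<in> B"
  shows "b \<bullet> b' = (if b = b' then 1 else 0)"
  using assms by (auto simp: orthonormal_def pairwise_def orthogonal_def norm_eq_1)

lemma orthonormal_inner_sum:
  assumes "orthonormal B" "b \<in> B"
  shows "(\<Sum>x\<in>B. c x *\<^sub>R x) \<bullet> b = c b"
proof -
  have "(\<Sum>x\<in>B. c x *\<^sub>R x) \<bullet> b = (\<Sum>x\<in>B. if x = b then c x else 0)"
    unfolding inner_sum_left using assms by (intro sum.cong) (auto simp: orthonormal_inner)
  also have "\<dots> = c b" using assms by (simp add: orthonormal_def)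
  finally show ?thesis .
qed

lemma orthonormal_norm_sum:
  assumes "orthonormal B"
  shows "(norm (\<Sum>x\<in>B. c x *\<^sub>R x))\<^sup>2 = (\<Sum>x\<in>B. (c x)\<^sup>2)"
proof -
  let ?s = "\<Sum>x\<in>B. c x *\<^sub>R x"
  have "(norm ?s)\<^sup>2 = ?s \<bullet> ?s" by (simp add: dot_square_norm)
  also have "\<dots> = (\<Sum>x\<in>B. c x * (?s \<bullet> x))" by (simp only: inner_sum_right inner_scaleR_right)
  also have "\<dots> = (\<Sum>x\<in>B. (c x)\<^sup>2)"
    using assms by (intro sum.cong) (auto simp: orthonormal_inner_sum power2_eq_square)
  finally show ?thesis .
qed

lemma orthonormal_span_eq:
  assumes B: "orthonormal B" and x: "x \<in> span B"
  shows "(\<Sum>b\<in>B. (x \<bullet> b) *\<^sub>R b) = x"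
proof -
  have "finite B" using B by (simp add: orthonormal_def)
  then obtain c where c: "x = (\<Sum>b\<in>B. c b *\<^sub>R b)" using x by (auto simp: span_finite)
  show ?thesis by (subst (2) c, rule sum.cong) (use orthonormal_inner_sum[OF B] c in auto)
qed

lemma orthonormal_independent: "orthonormal B \<Longrightarrow> independent B"
proof (rule independent_if_scalars_zero)
  fix f x assume B: "orthonormal B" and "(\<Sum>x\<in>B. f x *\<^sub>R x) = 0" "x \<in> B"
  with orthonormal_inner_sum[OF B, of x f] show "f x = 0" by simp
qed (simp add: orthonormal_def)

lemma orthonormal_card: "orthonormal B \<Longrightarrow> card B = dim (span B)"
  using orthonormal_independent by (metis dim_span dim_eq_card_independent)

interpretation lborel_product: product_sigma_finite "\<lambda>_. lborel :: real measure"
  by standard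

lemma sets_onb_measure [simp, measurable_cong]: "sets (onb_measure B) = sets borel"
  by (simp add: onb_measure_def)

lemma measurable_onb_map:
  fixes B :: "'b::euclidean_space set"
  shows "(\<lambda>c. \<Sum>b\<in>B. c b *\<^sub>R b) \<in> measurable (lborel_prod B) borel"
  by measurable

lemma emeasure_onb_cball:
  fixes B :: "'b::euclidean_space set"
  assumes B: "orthonormal B" and r: "r > 0"
  shows "emeasure (onb_measure B) (cball 0 r) = ennreal (unit_ball_vol (real (card B)) * r ^ card B)"
proof -
  have "emeasure (onb_measure B) (cball 0 r)
      = emeasure (lborel_prod B) ((\<lambda>c. \<Sum>b\<in>B. c b *\<^sub>R b) -` cball 0 r \<inter> space (lborel_prod B))"
    unfolding onb_measure_def by (rule emeasure_distr[OF measurable_onb_map]) simp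
  also have "(\<lambda>c. \<Sum>b\<in>B. c b *\<^sub>R b) -` cball 0 r \<inter> space (lborel_prod B)
     = {f. sqrt (\<Sum>i\<in>B. (f i)\<^sup>2) \<le> r} \<inter> space (lborel_prod B)"
    using orthonormal_norm_sum[OF B] r by (auto simp: real_sqrt_le_iff' simp flip: orthonormal_norm_sum[OF B])
  also have "emeasure (lborel_prod B) \<dots> = ennreal (unit_ball_vol (real (card B)) * r ^ card B)"
    using B r by (intro emeasure_cball_aux) (auto simp: orthonormal_def)
  finally show ?thesis .
qed

text \<open>One statement covers translations (s = 1) and the reflection at the origin (s = -1), the
  two invariances that the uniqueness argument takes.\<close>

lemma distr_PiM_affine:
  assumes B: "finite B" and s: "s = 1 \<or> s = (-1::real)"
  shows "distr (lborel_prod B) (lborel_prod B) (\<lambda>c. \<lambda>b\<in>B. v b + s * c b) = lborel_prod B"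
proof (rule lborel_product.PiM_eqI[OF B])
  fix A :: "'a \<Rightarrow> real set" assume A: "\<And>i. i \<in> B \<Longrightarrow> A i \<in> sets lborel"
  have l: "emeasure lborel ((\<lambda>x. v b + s * x) -` A b) = emeasure lborel (A b)" if "b \<in> B" for b
  proof -
    have "lborel = density (distr lborel borel (\<lambda>x. v b + s * x)) (\<lambda>_. ennreal \<bar>s\<bar>)"
      using s by (intro lborel_real_affine) auto
    also have "\<dots> = distr lborel borel (\<lambda>x. v b + s * x)" using s by (auto simp: density_1)
    finally have "emeasure lborel (A b) = emeasure (distr lborel borel (\<lambda>x. v b + s * x)) (A b)" by simp
    also have "\<dots> = emeasure lborel ((\<lambda>x. v b + s * x) -` A b)"
      using A[OF that] by (subst emeasure_distr) auto
    finally show ?thesis ..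
  qed
  have "emeasure (distr (lborel_prod B) (lborel_prod B) (\<lambda>c. \<lambda>b\<in>B. v b + s * c b)) (Pi\<^sub>E B A)
     = emeasure (lborel_prod B) ((\<lambda>c. \<lambda>b\<in>B. v b + s * c b) -` Pi\<^sub>E B A \<inter> space (lborel_prod B))"
    using A B by (intro emeasure_distr sets_PiM_I_finite) auto
  also have "(\<lambda>c. \<lambda>b\<in>B. v b + s * c b) -` Pi\<^sub>E B A \<inter> space (lborel_prod B)
     = (\<Pi>\<^sub>E b\<in>B. (\<lambda>x. v b + s * x) -` A b)"
    by (auto simp: space_PiM PiE_iff)
  also have "emeasure (lborel_prod B) \<dots> = (\<Prod>b\<in>B. emeasure lborel ((\<lambda>x. v b + s * x) -` A b))"
    using A B by (intro lborel_product.emeasure_PiM) (auto intro!: measurable_sets_borel[of _ lborel])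
  also have "\<dots> = (\<Prod>b\<in>B. emeasure lborel (A b))" using l by (intro prod.cong) auto
  finally show "emeasure (distr (lborel_prod B) (lborel_prod B) (\<lambda>c. \<lambda>b\<in>B. v b + s * c b)) (Pi\<^sub>E B A)
     = (\<Prod>b\<in>B. emeasure lborel (A b))" .
qed simp

lemma onb_measure_affine:
  fixes B :: "'b::euclidean_space set"
  assumes B: "orthonormal B" and v: "v \<in> span B" and s: "s = 1 \<or> s = (-1::real)"
  shows "distr (onb_measure B) borel (\<lambda>x. v + s *\<^sub>R x) = onb_measure B"
proof -
  have fin: "finite B" using B by (simp add: orthonormal_def)
  have "distr (onb_measure B) borel (\<lambda>x. v + s *\<^sub>R x)
     = distr (lborel_prod B) borel (\<lambda>c. v + s *\<^sub>R (\<Sum>b\<in>B. c b *\<^sub>R b))"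
    unfolding onb_measure_def by (subst distr_distr) (auto simp: comp_def intro!: measurable_onb_map)
  also have "(\<lambda>c. v + s *\<^sub>R (\<Sum>b\<in>B. c b *\<^sub>R b)) = (\<lambda>c. \<Sum>b\<in>B. (\<lambda>b\<in>B. v \<bullet> b + s * c b) b *\<^sub>R b)"
  proof
    fix c
    have "v + s *\<^sub>R (\<Sum>b\<in>B. c b *\<^sub>R b) = (\<Sum>b\<in>B. (v \<bullet> b) *\<^sub>R b) + s *\<^sub>R (\<Sum>b\<in>B. c b *\<^sub>R b)"
      using orthonormal_span_eq[OF B v] by simp
    also have "\<dots> = (\<Sum>b\<in>B. (v \<bullet> b + s * c b) *\<^sub>R b)"
      by (simp add: scaleR_sum_right sum.distrib scaleR_add_left)
    finally show "v + s *\<^sub>R (\<Sum>b\<in>B. c b *\<^sub>R b) = (\<Sum>b\<in>B. (\<lambda>b\<in>B. v \<bullet> b + s * c b) b *\<^sub>R b)" by simp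
  qed
  also have "distr (lborel_prod B) borel \<dots>
     = distr (distr (lborel_prod B) (lborel_prod B) (\<lambda>c. \<lambda>b\<in>B. v \<bullet> b + s * c b)) borel (\<lambda>c. \<Sum>b\<in>B. c b *\<^sub>R b)"
    by (subst distr_distr) (auto simp: comp_def intro!: measurable_onb_map)
  also have "\<dots> = onb_measure B"
    unfolding onb_measure_def by (subst distr_PiM_affine[OF fin s]) simp
  finally show ?thesis .
qed

lemma AE_onb_measure: 
  fixes B :: "'b::euclidean_space set"
  shows "AE x in onb_measure B. x \<in> span B"
  unfolding onb_measure_def
  by (subst AE_distr_iff[OF measurable_onb_map])
    (simp_all add: closed_subspace borel_closed span_sum span_scale span_base)

lemma UN_cball_UNIV: "(\<Union>n. cball 0 (real (Suc n))) = (UNIV :: 'b::real_normed_vector set)"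
proof -
  have "\<exists>n. norm x \<le> real (Suc n)" for x :: 'b
    using real_arch_simple[of "norm x"] by (metis order.trans of_nat_le_iff le_SucI order_refl)
  then show ?thesis by auto
qed

lemma sigma_finite_onb_measure:
  fixes B :: "'b::euclidean_space set"
  assumes B: "orthonormal B"
  shows "sigma_finite_measure (onb_measure B)"
proof
  have "emeasure (onb_measure B) (cball 0 (real (Suc n))) \<noteq> \<infinity>" for n
    by (subst emeasure_onb_cball[OF B]) auto
  moreover have "(\<Union>n. cball 0 (real (Suc n))) = (UNIV :: 'b set)" by (rule UN_cball_UNIV)
  ultimately show "\<exists>A. countable A \<and> A \<subseteq> sets (onb_measure B) \<and> \<Union> A = space (onb_measure B) \<and> (\<forall>a\<in>A. emeasure (onb_measure B) a \<noteq> \<infinity>)"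
    by (intro exI[of _ "range (\<lambda>n. cball 0 (real (Suc n)))"]) (auto simp: onb_measure_def)
qed

text \<open>Both measures are invariant under translations by the common span, and they agree on the
  unit ball because its measure depends only on the number of basis vectors. This neutralises the
  choice in \<open>subspace_lborel\<close>.\<close>

lemma onb_measure_unique:
  fixes B B' :: "'b::euclidean_space set"
  assumes B: "orthonormal B" and B': "orthonormal B'" and sp: "span B = span B'"
  shows "onb_measure B = onb_measure B'"
proof (rule invariant_measure_eq[where S = "span B" and B = "cball 0 1"])
  show "distr (onb_measure B) borel (\<lambda>x. x + v) = onb_measure B" if "v \<in> span B" for v
    using onb_measure_affine[OF B that, of 1] by (simp add: add.commute)
  show "distr (onb_measure B') borel (\<lambda>x. x + v) = onb_measure B'" if "v \<in> span B" for v
    using onb_measure_affine[OF B', of v 1] that sp by (simp add: add.commute)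
  show "distr (onb_measure B') borel uminus = onb_measure B'"
    using onb_measure_affine[OF B', of 0 "-1"] by (simp add: span_zero)
  show "emeasure (onb_measure B) (cball 0 1) = emeasure (onb_measure B') (cball 0 1)"
    by (simp add: emeasure_onb_cball B B' orthonormal_card sp)
  show "emeasure (onb_measure B') (cball 0 1) \<noteq> 0"
    using unit_ball_vol_pos[of "real (card B')"]
    by (simp add: emeasure_onb_cball B' order.strict_implies_not_eq[symmetric])
  show "emeasure (onb_measure B') (cball 0 1) \<noteq> \<infinity>" by (simp add: emeasure_onb_cball B')
  show "AE x in onb_measure B'. x \<in> span B" unfolding sp by (rule AE_onb_measure)
qed (use B B' in \<open>auto intro: span_neg AE_onb_measure sigma_finite_onb_measure\<close>)

lemma orthonormal_Basis: "orthonormal Basis"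
  by (auto simp: orthonormal_def pairwise_def orthogonal_def inner_Basis)

text \<open>The image measure is again translation invariant, since every shift is by some T w and
  comes from the shift by w, and T preserves the unit ball. It is used below on the space of
  matrices.\<close>

lemma lborel_orthogonal_image:
  fixes T :: "'b::euclidean_space \<Rightarrow> 'b"
  assumes T: "orthogonal_transformation T"
  shows "distr lborel borel T = lborel"
proof -
  have lin: "linear T" using T by (simp add: orthogonal_transformation_def)
  then have [measurable]: "T \<in> borel_measurable borel"
    by (intro borel_measurable_continuous_onI linear_continuous_on linear_conv_bounded_linear[THEN iffD1])
  have fx: "norm (T x) = norm x" for x using T by (rule orthogonal_transformation_norm)
  have lb: "lborel = onb_measure (Basis :: 'b set)" unfolding onb_measure_def by (rule lborel_eq)
  have trans: "distr lborel borel (\<lambda>x. v + s *\<^sub>R x) = (lborel :: 'b measure)" if "s = 1 \<or> s = -1" for v s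
    unfolding lb using that by (intro onb_measure_affine orthonormal_Basis) simp_all
  have vim: "T -` cball (0::'b) r = cball 0 r" for r by (auto simp: fx)
  have em: "emeasure (distr lborel borel T) (cball 0 r) = emeasure lborel (cball (0::'b) r)" for r
    by (subst emeasure_distr) (auto simp: vim)
  show ?thesis
  proof (rule invariant_measure_eq[where S = UNIV and B = "cball 0 1"])
    show "sigma_finite_measure (distr lborel borel T)"
    proof
      have "(\<Union>n. cball 0 (real (Suc n))) = (UNIV :: 'b set)"
        by (rule UN_cball_UNIV)
      then show "\<exists>A. countable A \<and> A \<subseteq> sets (distr lborel borel T) \<and> \<Union> A = space (distr lborel borel T) \<and>
          (\<forall>a\<in>A. emeasure (distr lborel borel T) a \<noteq> \<infinity>)"
        by (intro exI[of _ "range (\<lambda>n. cball 0 (real (Suc n)))"]) (auto simp: em emeasure_cball)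
    qed
    fix v :: 'b
    obtain w where w: "v = T w" using orthogonal_transformation_surj[OF T] by (metis surjD)
    have "distr (distr lborel borel T) borel (\<lambda>x. x + v) = distr lborel borel (\<lambda>x. T (w + 1 *\<^sub>R x))"
      by (subst distr_distr) (auto simp: comp_def w linear_add[OF lin] add.commute)
    also have "\<dots> = distr (distr lborel borel (\<lambda>x. w + 1 *\<^sub>R x)) borel T"
      by (subst distr_distr) (auto simp: comp_def)
    also have "\<dots> = distr lborel borel T" by (subst trans) simp_all
    finally show "distr (distr lborel borel T) borel (\<lambda>x. x + v) = distr lborel borel T" .
    show "distr lborel borel (\<lambda>x. x + v) = lborel" using trans[of 1 v] by (simp add: add.commute)
  next
    show "distr lborel borel uminus = (lborel :: 'b measure)" using trans[of "-1" 0] by simp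
    show "emeasure lborel (cball (0::'b) 1) \<noteq> 0"
      using unit_ball_vol_pos[of "real DIM('b)"]
      by (simp add: emeasure_cball order.strict_implies_not_eq[symmetric])
  qed (auto simp: em emeasure_cball sigma_finite_lborel)
qed

text \<open>Fubini in the coordinate along f. Measurability of the slice function is recorded too,
  as the later change of variables asks for it.\<close>

lemma emeasure_onb_insert:
  fixes C :: "'b::euclidean_space set"
  assumes C: "finite C" and f: "f \<notin> C" and A [measurable]: "A \<in> sets borel"
  shows "emeasure (onb_measure (insert f C)) A = (\<integral>\<^sup>+z. emeasure (onb_measure C) {w. z *\<^sub>R f + w \<in> A} \<partial>lborel)"
    and "(\<lambda>z. emeasure (onb_measure C) {w. z *\<^sub>R f + w \<in> A}) \<in> borel_measurable borel"
proof -
  interpret C: sigma_finite_measure "lborel_prod C"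
    using lborel_product.sigma_finite[OF C] .
  have e: "emeasure (onb_measure C) {w. z *\<^sub>R f + w \<in> A}
     = (\<integral>\<^sup>+c. indicator A (z *\<^sub>R f + (\<Sum>b\<in>C. c b *\<^sub>R b)) \<partial>(lborel_prod C))" for z
  proof -
    have "emeasure (onb_measure C) {w. z *\<^sub>R f + w \<in> A} = (\<integral>\<^sup>+w. indicator {w. z *\<^sub>R f + w \<in> A} w \<partial>onb_measure C)"
      by simp
    also have "\<dots> = (\<integral>\<^sup>+w. indicator A (z *\<^sub>R f + w) \<partial>onb_measure C)"
      by (rule nn_integral_cong) (simp add: indicator_def)
    also have "\<dots> = (\<integral>\<^sup>+c. indicator A (z *\<^sub>R f + (\<Sum>b\<in>C. c b *\<^sub>R b)) \<partial>(lborel_prod C))"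
      unfolding onb_measure_def by (rule nn_integral_distr[OF measurable_onb_map]) measurable
    finally show ?thesis .
  qed
  show "(\<lambda>z. emeasure (onb_measure C) {w. z *\<^sub>R f + w \<in> A}) \<in> borel_measurable borel"
    unfolding e by measurable
  have "emeasure (onb_measure (insert f C)) A = (\<integral>\<^sup>+w. indicator A w \<partial>onb_measure (insert f C))" by simp
  also have "\<dots> = (\<integral>\<^sup>+c. indicator A (\<Sum>b\<in>insert f C. c b *\<^sub>R b) \<partial>(lborel_prod (insert f C)))"
    unfolding onb_measure_def by (rule nn_integral_distr[OF measurable_onb_map]) measurable
  also have "\<dots> = (\<integral>\<^sup>+z. (\<integral>\<^sup>+c. indicator A (\<Sum>b\<in>insert f C. (c(f := z)) b *\<^sub>R b) \<partial>(lborel_prod C)) \<partial>lborel)"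
    by (rule lborel_product.product_nn_integral_insert_rev[OF C f]) measurable
  also have "\<dots> = (\<integral>\<^sup>+z. emeasure (onb_measure C) {w. z *\<^sub>R f + w \<in> A} \<partial>lborel)"
  proof (rule nn_integral_cong)
    fix z
    have "(\<Sum>b\<in>insert f C. (c(f := z)) b *\<^sub>R b) = z *\<^sub>R f + (\<Sum>b\<in>C. c b *\<^sub>R b)" for c
      using C f by (auto intro!: sum.cong)
    then show "(\<integral>\<^sup>+c. indicator A (\<Sum>b\<in>insert f C. (c(f := z)) b *\<^sub>R b) \<partial>(lborel_prod C))
        = emeasure (onb_measure C) {w. z *\<^sub>R f + w \<in> A}"
      unfolding e by simp
  qed
  finally show "emeasure (onb_measure (insert f C)) A = (\<integral>\<^sup>+z. emeasure (onb_measure C) {w. z *\<^sub>R f + w \<in> A} \<partial>lborel)" .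
qed

section \<open>Volume of a body of revolution\<close>

lemma slice_height_1: "slice_height \<tau> 1 = 1 + \<tau>" "slice_height \<tau> (-1) = - (1 + \<tau>)"
  by (simp_all add: slice_height_def)

text \<open>Fubini along f, then the substitution of \<open>slice_height\<close> for the height,
  turns slice volumes into the integral defining \<open>profile\<close>. The slices are prescribed
  for |z| < 1 only: the poles z = 1 and z = -1 form a null set. They are prescribed on
  \<open>span C\<close> only, because this subspace carries \<open>onb_measure C\<close>.\<close>

lemma emeasure_revolution:
  fixes C :: "'b::euclidean_space set"
  assumes B: "orthonormal (insert f C)" and f: "f \<notin> C" and A: "A \<in> sets borel" and \<tau>: "\<tau> \<in> {0..1/6}"
    and sl: "\<And>z w. \<bar>z\<bar> < 1 \<Longrightarrow> w \<in> span C \<Longrightarrow> slice_height \<tau> z *\<^sub>R f + w \<in> A \<longleftrightarrow> norm w \<le> slice_radius \<tau> z"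
    and bd: "\<And>z w. w \<in> span C \<Longrightarrow> z *\<^sub>R f + w \<in> A \<Longrightarrow> \<bar>z\<bar> \<le> 1 + \<tau>"
  shows "emeasure (onb_measure (insert f C)) A = ennreal (unit_ball_vol (card C) * profile (card C + 1) \<tau>)"
proof -
  have C: "orthonormal C" using B by (auto simp: orthonormal_def pairwise_def)
  then have fin: "finite C" by (simp add: orthonormal_def)
  let ?h = "\<lambda>z. emeasure (onb_measure C) {w. z *\<^sub>R f + w \<in> A}"
  let ?v = "\<lambda>z. slice_radius \<tau> z ^ card C * slice_height' \<tau> z"
  have AE_span: "AE w in onb_measure C. w \<in> span C" by (rule AE_onb_measure)
  have mset: "{w. z *\<^sub>R f + w \<in> A} \<in> sets (onb_measure C)" for z
  proof -
    have "(\<lambda>w. z *\<^sub>R f + w) -` A \<inter> space borel \<in> sets borel" using A by (intro measurable_sets) auto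
    then show ?thesis by (simp add: vimage_def)
  qed
  have h0: "?h z = 0" if "\<not> \<bar>z\<bar> \<le> 1 + \<tau>" for z
  proof -
    have "AE w in onb_measure C. \<not> z *\<^sub>R f + w \<in> A" using AE_span by eventually_elim (use that bd in blast)
    then show ?thesis using AE_iff_measurable[OF mset] by (simp add: onb_measure_def)
  qed
  have h1: "?h (slice_height \<tau> z) = ennreal (unit_ball_vol (card C) * slice_radius \<tau> z ^ card C)" if z: "\<bar>z\<bar> < 1" for z
  proof -
    have "z\<^sup>2 < 1" using z by (simp add: abs_square_less_1)
    moreover have "1 - 3 * \<tau> * z ^ 4 \<ge> 1 - 3 * \<tau>" using \<tau> z by (intro slice_radius_factor_ge) auto
    ultimately have r: "slice_radius \<tau> z > 0" using \<tau> unfolding slice_radius_def by (intro mult_pos_pos) auto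
    have "?h (slice_height \<tau> z) = emeasure (onb_measure C) (cball 0 (slice_radius \<tau> z))"
    proof (rule emeasure_eq_AE)
      show "AE w in onb_measure C. w \<in> {w. slice_height \<tau> z *\<^sub>R f + w \<in> A} \<longleftrightarrow> w \<in> cball 0 (slice_radius \<tau> z)"
        using AE_span by eventually_elim (use sl[OF z] in auto)
    qed (use mset in auto)
    then show ?thesis using emeasure_onb_cball[OF C r] by simp
  qed
  have v0: "0 \<le> ?v z" if "z \<in> {-1..1}" for z
    using slice_radius_factor_ge[of \<tau> z] slice_height'_ge[of \<tau> z] that \<tau>
    unfolding slice_radius_def by (intro mult_nonneg_nonneg zero_le_power) (auto simp: abs_square_le_1 abs_le_iff)
  have "emeasure (onb_measure (insert f C)) A = (\<integral>\<^sup>+z. ?h z \<partial>lborel)"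
    by (rule emeasure_onb_insert[OF fin f A])
  \<comment> \<open>Slices beyond the poles are null, so the range of heights is exactly the image
    of [-1, 1].\<close>
  also have "\<dots> = (\<integral>\<^sup>+z. ?h z * indicator {slice_height \<tau> (-1)..slice_height \<tau> 1} z \<partial>lborel)"
    by (rule nn_integral_cong) (use h0 in \<open>auto simp: slice_height_1 indicator_def abs_le_iff\<close>)
  also have "\<dots> = (\<integral>\<^sup>+z. ?h (slice_height \<tau> z) * slice_height' \<tau> z * indicator {-1..1} z \<partial>lborel)"
  proof (rule nn_integral_substitution_aux)
    show "?h \<in> borel_measurable borel" by (rule emeasure_onb_insert[OF fin f A])
    show "continuous_on {-1..1} (slice_height' \<tau>)" unfolding slice_height'_def[abs_def] by (intro continuous_intros)
    show "slice_height' \<tau> z \<ge> 0" if "z \<in> {-1..1}" for z using slice_height'_ge[of \<tau> z] that \<tau> by auto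
  qed (auto intro: slice_height_deriv)
  also have "\<dots> = (\<integral>\<^sup>+z. ennreal (unit_ball_vol (card C) * (?v z * indicator {-1..1} z)) \<partial>lborel)"
  proof (rule nn_integral_cong_AE)
    have "AE z in lborel. z \<noteq> (1::real)" "AE z in lborel. z \<noteq> (-1::real)"
      by (auto intro!: AE_lborel_singleton)
    then show "AE z in lborel. ?h (slice_height \<tau> z) * slice_height' \<tau> z * indicator {-1..1} z
        = ennreal (unit_ball_vol (card C) * (?v z * indicator {-1..1} z))"
    proof eventually_elim
      fix z :: real assume z: "z \<noteq> 1" "z \<noteq> -1"
      show "?h (slice_height \<tau> z) * slice_height' \<tau> z * indicator {-1..1} z
        = ennreal (unit_ball_vol (card C) * (?v z * indicator {-1..1} z))"
      proof (cases "z \<in> {-1..1}")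
        case True
        then have "\<bar>z\<bar> < 1" using z by auto
        moreover have "slice_height' \<tau> z \<ge> 0" using slice_height'_ge[of \<tau> z] True \<tau> by auto
        ultimately show ?thesis using True by (simp add: h1 ennreal_mult''[symmetric] mult.assoc)
      qed simp
    qed
  qed
  also have "\<dots> = ennreal (unit_ball_vol (card C) * profile (card C + 1) \<tau>)"
  proof -
    have si: "set_integrable lborel {-1..1} ?v"
      unfolding slice_radius_def slice_height'_def by (intro borel_integrable_atLeastAtMost' continuous_intros)
    then have "integrable lborel (\<lambda>z. unit_ball_vol (card C) * (?v z * indicator {-1..1} z))"
      by (simp add: set_integrable_def mult.commute)
    then have "(\<integral>\<^sup>+z. ennreal (unit_ball_vol (card C) * (?v z * indicator {-1..1} z)) \<partial>lborel)
      = ennreal (\<integral>z. unit_ball_vol (card C) * (?v z * indicator {-1..1} z) \<partial>lborel)"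
      using v0 by (intro nn_integral_eq_integral) (auto intro!: AE_I2 mult_nonneg_nonneg simp: indicator_def)
    also have "(\<integral>z. unit_ball_vol (card C) * (?v z * indicator {-1..1} z) \<partial>lborel) = unit_ball_vol (card C) * profile (card C + 1) \<tau>"
      using set_borel_integral_eq_integral(2)[OF si]
      by (simp add: profile_def set_lebesgue_integral_def mult.commute)
    finally show ?thesis .
  qed
  finally show ?thesis .
qed

section \<open>Orthogonal projections and the gap metric\<close>

text \<open>Stands for "finite-dimensional subspace". It gives projections a formula in arbitrary
  inner product spaces, including the infinite-dimensional type of sequences.\<close>

definition has_onb :: "'a::real_inner set \<Rightarrow> bool" where
  "has_onb F \<longleftrightarrow> (\<exists>B. orthonormal B \<and> span B = F)"

lemma has_onb_subspace: "has_onb F \<Longrightarrow> subspace F"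
  by (auto simp: has_onb_def)

lemma orth_proj_unique:
  assumes F: "subspace F" and y: "y \<in> F" "\<And>z. z \<in> F \<Longrightarrow> (x - y) \<bullet> z = 0"
  shows "orth_proj F x = y"
  unfolding orth_proj_def
proof (rule the_equality)
  fix y' assume y': "y' \<in> F \<and> (\<forall>z\<in>F. (x - y') \<bullet> z = 0)"
  have d: "y - y' \<in> F" using F y y' by (simp add: subspace_diff)
  have "(y - y') \<bullet> (y - y') = (x - y') \<bullet> (y - y') - (x - y) \<bullet> (y - y')"
    by (simp add: inner_diff_left)
  also have "\<dots> = 0" using y' y(2)[OF d] d by simp
  finally show "y' = y" by simp
qed (use y in auto)

lemma orth_proj_onb:
  assumes B: "orthonormal B"
  shows "orth_proj (span B) x = (\<Sum>b\<in>B. (x \<bullet> b) *\<^sub>R b)"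
proof (rule orth_proj_unique)
  let ?y = "\<Sum>b\<in>B. (x \<bullet> b) *\<^sub>R b"
  fix z assume "z \<in> span B"
  then have "z = (\<Sum>b\<in>B. (z \<bullet> b) *\<^sub>R b)" using orthonormal_span_eq[OF B] by simp
  then have "(x - ?y) \<bullet> z = (\<Sum>b\<in>B. (z \<bullet> b) * ((x - ?y) \<bullet> b))"
    by (metis (no_types, lifting) inner_scaleR_right inner_sum_right sum.cong)
  also have "\<dots> = 0" by (intro sum.neutral) (simp add: inner_diff_left orthonormal_inner_sum[OF B])
  finally show "(x - ?y) \<bullet> z = 0" .
qed (auto intro!: span_sum span_scale intro: span_base)

lemma orth_proj_in: "has_onb F \<Longrightarrow> orth_proj F x \<in> F"
  unfolding has_onb_def by (auto simp: orth_proj_onb intro!: span_sum span_scale intro: span_base)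

lemma orth_proj_orth:
  assumes "has_onb F" "z \<in> F"
  shows "(x - orth_proj F x) \<bullet> z = 0"
proof -
  obtain B where B: "orthonormal B" "F = span B" using assms(1) by (auto simp: has_onb_def)
  have z: "z = (\<Sum>b\<in>B. (z \<bullet> b) *\<^sub>R b)" using assms(2) B orthonormal_span_eq by metis
  have "(x - orth_proj F x) \<bullet> z = (\<Sum>b\<in>B. (z \<bullet> b) * ((x - orth_proj F x) \<bullet> b))"
    by (subst z) (simp add: inner_sum_right)
  also have "\<dots> = 0"
    unfolding B(2) orth_proj_onb[OF B(1)]
    by (intro sum.neutral) (simp add: inner_diff_left orthonormal_inner_sum[OF B(1)])
  finally show ?thesis .
qed

lemma orth_proj_inner: "has_onb F \<Longrightarrow> z \<in> F \<Longrightarrow> orth_proj F x \<bullet> z = x \<bullet> z"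
  using orth_proj_orth[of F z x] by (simp add: inner_diff_left)

lemma orth_proj_id: "has_onb F \<Longrightarrow> x \<in> F \<Longrightarrow> orth_proj F x = x"
  by (rule orth_proj_unique) (auto intro: has_onb_subspace)

lemma linear_orth_proj: "has_onb F \<Longrightarrow> linear (orth_proj F)"
  unfolding has_onb_def
  by (auto simp: orth_proj_onb linear_iff inner_add_left scaleR_add_left sum.distrib scaleR_sum_right)

lemma orth_proj_diff: "has_onb F \<Longrightarrow> orth_proj F (x - y) = orth_proj F x - orth_proj F y"
  by (simp add: linear_diff linear_orth_proj)

lemma norm_orth_proj_sq:
  assumes "has_onb F"
  shows "(norm (orth_proj F x))\<^sup>2 = orth_proj F x \<bullet> x"
  using orth_proj_inner[OF assms orth_proj_in[OF assms], of x x] by (simp add: dot_square_norm inner_commute)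

lemma norm_orth_proj_le:
  assumes "has_onb F"
  shows "norm (orth_proj F x) \<le> norm x"
proof -
  have "(norm (orth_proj F x))\<^sup>2 \<le> norm (orth_proj F x) * norm x"
    using norm_cauchy_schwarz[of "orth_proj F x" x] norm_orth_proj_sq[OF assms, of x] by simp
  then show ?thesis
    by (cases "norm (orth_proj F x) = 0") (auto simp: power2_eq_square)
qed

text \<open>The projection is the nearest point of F. In the gap estimate this lets any convenient
  approximant in F bound the distance to the projection.\<close>

lemma norm_orth_proj_compl_le:
  assumes F: "has_onb F" and y: "y \<in> F"
  shows "norm (x - orth_proj F x) \<le> norm (x - y)"
proof -
  let ?d = "x - orth_proj F x"
  have e: "orth_proj F x - y \<in> F" using F y by (simp add: subspace_diff has_onb_subspace orth_proj_in)
  have "?d \<bullet> (x - y) = ?d \<bullet> ?d + ?d \<bullet> (orth_proj F x - y)"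
    by (simp add: inner_diff_right)
  then have "(norm ?d)\<^sup>2 = ?d \<bullet> (x - y)" using orth_proj_orth[OF F e] by (simp add: dot_square_norm)
  also have "\<dots> \<le> norm ?d * norm (x - y)" by (rule norm_cauchy_schwarz)
  finally show ?thesis by (cases "norm ?d = 0") (auto simp: power2_eq_square)
qed

lemma norm_orth_proj_compl_le':
  assumes F: "has_onb F"
  shows "norm (x - orth_proj F x) \<le> norm x"
  using norm_orth_proj_compl_le[OF F, of 0 x] F by (simp add: has_onb_subspace subspace_0)

lemma orth_proj_cball:
  assumes F: "has_onb F" "F \<subseteq> E"
  shows "orth_proj F ` (cball 0 r \<inter> E) = cball 0 r \<inter> F"
proof -
  have "orth_proj F x \<in> cball 0 r \<inter> F" if "x \<in> cball 0 r" for x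
    using that norm_orth_proj_le[OF F(1), of x] orth_proj_in[OF F(1)] by auto
  moreover have "x \<in> orth_proj F ` (cball 0 r \<inter> E)" if "x \<in> cball 0 r \<inter> F" for x
    using that F orth_proj_id[OF F(1), of x] by (intro image_eqI[of _ _ x]) auto
  ultimately show ?thesis by blast
qed

section \<open>Estimates for the gap metric\<close>

lemma bounded_linear_orth_proj_diff:
  assumes "has_onb F" "has_onb F'"
  shows "bounded_linear (\<lambda>x. orth_proj F x - orth_proj F' x)"
proof (rule bounded_linear_intro[where K = 2])
  fix x y :: 'a and r :: real
  note l = linear_orth_proj[OF assms(1)] linear_orth_proj[OF assms(2)]
  show "orth_proj F (x + y) - orth_proj F' (x + y) = orth_proj F x - orth_proj F' x + (orth_proj F y - orth_proj F' y)"
    by (simp add: linear_add[OF l(1)] linear_add[OF l(2)])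
  show "orth_proj F (r *\<^sub>R x) - orth_proj F' (r *\<^sub>R x) = r *\<^sub>R (orth_proj F x - orth_proj F' x)"
    by (simp add: linear_cmul[OF l(1)] linear_cmul[OF l(2)] scaleR_diff_right)
  show "norm (orth_proj F x - orth_proj F' x) \<le> norm x * 2"
    using norm_triangle_ineq4[of "orth_proj F x" "orth_proj F' x"] norm_orth_proj_le[OF assms(1), of x]
      norm_orth_proj_le[OF assms(2), of x] by linarith
qed

lemma gap_bound:
  assumes "has_onb F" "has_onb F'"
  shows "norm (orth_proj F x - orth_proj F' x) \<le> gap F F' * norm x"
  unfolding gap_def by (rule onorm[OF bounded_linear_orth_proj_diff[OF assms]])

lemma gap_le:
  assumes "\<And>x. norm (orth_proj F x - orth_proj F' x) \<le> c * norm x" "0 \<le> c"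
  shows "gap F F' \<le> c"
  unfolding gap_def using assms by (intro onorm_bound) auto

text \<open>\<open>P - P' = (1 - P') P - P' (1 - P)\<close>, and \<open>P' (1 - P)\<close> is the adjoint of \<open>(1 - P) P'\<close>.\<close>

lemma gap_le_approx:
  assumes F: "has_onb F" "has_onb F'" and c: "0 \<le> c"
    and FF': "\<And>y. y \<in> F \<Longrightarrow> \<exists>y'\<in>F'. norm (y - y') \<le> c * norm y"
    and F'F: "\<And>y. y \<in> F' \<Longrightarrow> \<exists>y'\<in>F. norm (y - y') \<le> c * norm y"
  shows "gap F F' \<le> 2 * c"
proof (rule gap_le)
  fix x
  let ?P = "orth_proj F" and ?P' = "orth_proj F'"
  obtain y' where y': "y' \<in> F'" "norm (?P x - y') \<le> c * norm (?P x)"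
    using FF'[OF orth_proj_in[OF F(1)]] by blast
  have "c * norm (?P x) \<le> c * norm x" using norm_orth_proj_le[OF F(1)] c by (rule mult_left_mono)
  then have 1: "norm (?P x - ?P' (?P x)) \<le> c * norm x"
    using norm_orth_proj_compl_le[OF F(2) y'(1), of "?P x"] y'(2) by linarith
  define u where "u = x - ?P x"
  obtain y where y: "y \<in> F" "norm (?P' u - y) \<le> c * norm (?P' u)"
    using F'F[OF orth_proj_in[OF F(2)]] by blast
  have "(norm (?P' u))\<^sup>2 = u \<bullet> ?P' u"
    using norm_orth_proj_sq[OF F(2)] by (simp add: inner_commute)
  also have "\<dots> = u \<bullet> (?P' u - y)"
    using orth_proj_orth[OF F(1) y(1), of x] by (simp add: inner_diff_right u_def)
  also have "\<dots> \<le> norm u * norm (?P' u - y)" by (rule norm_cauchy_schwarz)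
  also have "\<dots> \<le> norm x * (c * norm (?P' u))"
    using norm_orth_proj_compl_le'[OF F(1)] y(2) unfolding u_def by (intro mult_mono) auto
  finally have 2: "norm (?P' u) \<le> c * norm x"
    using c by (cases "norm (?P' u) = 0") (auto simp: power2_eq_square mult_ac)
  have "?P x - ?P' x = (?P x - ?P' (?P x)) - ?P' u"
    unfolding u_def orth_proj_diff[OF F(2)] by simp
  then have "norm (?P x - ?P' x) \<le> norm (?P x - ?P' (?P x)) + norm (?P' u)"
    by (simp only: norm_triangle_ineq4)
  then show "norm (?P x - ?P' x) \<le> 2 * c * norm x" using 1 2 by linarith
qed (use c in simp)

lemma orthonormal_isometry_image:
  assumes "linear T" "\<And>x. norm (T x) = norm x" "orthonormal B"
  shows "orthonormal (T ` B)"
proof -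
  have "T x \<bullet> T y = x \<bullet> y" for x y
    using assms(1,2) by (simp add: dot_norm linear_add[symmetric])
  then show ?thesis using assms by (auto simp: orthonormal_def pairwise_def orthogonal_def)
qed

lemma orth_proj_isometry_image:
  assumes T: "orthogonal_transformation T" and F: "has_onb F"
  shows "orth_proj (T ` F) (T x) = T (orth_proj F x)"
proof (rule orth_proj_unique)
  have l: "linear T" using T by (simp add: orthogonal_transformation_def)
  show "subspace (T ` F)" using F l by (simp add: has_onb_subspace linear_subspace_image)
  show "T (orth_proj F x) \<in> T ` F" using orth_proj_in[OF F] by simp
  fix z assume "z \<in> T ` F"
  then obtain y where y: "y \<in> F" "z = T y" by auto
  have "(T x - T (orth_proj F x)) \<bullet> z = T (x - orth_proj F x) \<bullet> T y"
    using y l by (simp add: linear_diff)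
  also have "\<dots> = (x - orth_proj F x) \<bullet> y" using T by (simp add: orthogonal_transformation_def)
  finally show "(T x - T (orth_proj F x)) \<bullet> z = 0" using orth_proj_orth[OF F y(1)] by simp
qed

text \<open>Bases, compactness and measures are handled in coordinates and carried to E by \<phi>.
  One argument then serves both ambient spaces: the whole Euclidean space with \<phi> the identity,
  and \<open>coord_space n\<close> inside the sequences.\<close>

locale linear_isometry =
  fixes \<phi> :: "real ^ 'n \<Rightarrow> 'a::real_inner" and E :: "'a set"
  assumes lin: "linear \<phi>" and norm_phi: "norm (\<phi> x) = norm x" and range_phi: "range \<phi> = E"
begin

lemma inner_phi: "\<phi> x \<bullet> \<phi> y = x \<bullet> y"
  using lin by (simp add: dot_norm norm_phi linear_add[symmetric])

lemma inj_phi: "inj \<phi>"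
  using lin norm_phi by (metis linear_injective_0 norm_eq_zero)

lemma inj_on_phi: "inj_on \<phi> A"
  by (rule inj_on_subset[OF inj_phi subset_UNIV])

lemma continuous_phi: "continuous_on S \<phi>"
  by (rule linear_continuous_on, rule bounded_linear_intro[where K=1])
    (use lin norm_phi in \<open>auto simp: linear_add linear_cmul\<close>)

lemma measurable_phi [measurable]: "\<phi> \<in> borel_measurable borel"
  by (rule borel_measurable_continuous_onI[OF continuous_phi])

lemma phi_in [simp]: "\<phi> x \<in> E"
  using range_phi by auto

lemma phi_surj: "x \<in> E \<Longrightarrow> \<exists>y. x = \<phi> y"
  using range_phi by auto

lemma phi_vimage_image: "\<phi> -` (\<phi> ` A) = A"
  by (rule inj_vimage_image_eq[OF inj_phi])

lemma phi_image_vimage: "A \<subseteq> E \<Longrightarrow> \<phi> ` (\<phi> -` A) = A"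
  using range_phi by auto

lemma subspace_E: "subspace E"
  using linear_subspace_image[OF lin subspace_UNIV] range_phi by simp

lemma orthonormal_phi: "orthonormal (\<phi> ` B) \<longleftrightarrow> orthonormal B"
proof
  assume "orthonormal (\<phi> ` B)"
  then show "orthonormal B"
    using inj_phi by (auto simp: orthonormal_def pairwise_def orthogonal_def inner_phi norm_phi inj_eq
        dest: finite_imageD[OF _ inj_on_phi])
qed (rule orthonormal_isometry_image[OF lin norm_phi])

lemma span_phi: "span (\<phi> ` B) = \<phi> ` span B"
  by (rule span_linear_image[OF lin])

lemma onb_exists:
  assumes F: "subspace F" "F \<subseteq> E"
  obtains B where "orthonormal B" "F = \<phi> ` span B" "card B = dim F"
proof -
  have "subspace (\<phi> -` F)" using lin F by (simp add: linear_subspace_vimage)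
  from orthonormal_basis_subspace[OF this] obtain B where B: "pairwise orthogonal B" "\<And>x. x \<in> B \<Longrightarrow> norm x = 1"
    "independent B" "span B = \<phi> -` F" by metis
  have o: "orthonormal B"
    using B by (auto simp: orthonormal_def independent_imp_finite)
  have e: "F = \<phi> ` span B" using B(4) phi_image_vimage[OF F(2)] by simp
  have "card (\<phi> ` B) = dim (span (\<phi> ` B))" using o orthonormal_phi orthonormal_card by blast
  then have "card B = dim F" using e span_phi card_image[OF inj_on_phi] by metis
  with o e that show thesis by blast
qed

lemma has_onb_subspace_E: "subspace F \<Longrightarrow> F \<subseteq> E \<Longrightarrow> has_onb F"
  using onb_exists orthonormal_phi span_phi unfolding has_onb_def by metis

lemma dim_E: "dim E = CARD('n)"
proof -
  have "card (\<phi> ` (Basis :: (real^'n) set)) = dim (span (\<phi> ` Basis))"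
    using orthonormal_card orthonormal_phi orthonormal_Basis by blast
  moreover have "card (\<phi> ` (Basis :: (real^'n) set)) = CARD('n)"
    by (simp add: card_image[OF inj_on_phi])
  ultimately show ?thesis by (simp add: span_phi range_phi)
qed

lemma has_onb_E: "has_onb E"
  using has_onb_subspace_E subspace_E by blast

lemma grassmannian_has_onb: "F \<in> grassmannian E k \<Longrightarrow> has_onb F"
  by (auto simp: grassmannian_def intro: has_onb_subspace_E)

lemma measurable_onb_phi: "(\<lambda>c. \<Sum>b\<in>\<phi> ` B. c b *\<^sub>R b) \<in> measurable (lborel_prod (\<phi> ` B)) borel"
proof -
  have "(\<lambda>c. \<Sum>b\<in>\<phi> ` B. c b *\<^sub>R b) = (\<lambda>c. \<phi> (\<Sum>b\<in>B. c (\<phi> b) *\<^sub>R b))"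
    by (simp add: linear_sum[OF lin] linear_cmul[OF lin] sum.reindex inj_on_phi)
  then show ?thesis by simp
qed

text \<open>Only the index set of the coordinates changes, from \<open>B\<close> to its image; the
  product measures correspond under the reindexing \<open>?r\<close>.\<close>

lemma onb_measure_phi:
  assumes B: "finite B"
  shows "onb_measure (\<phi> ` B) = distr (onb_measure B) borel \<phi>"
proof -
  let ?r = "\<lambda>c. \<lambda>b\<in>\<phi> ` B. c (inv \<phi> b)"
  have re: "distr (lborel_prod B) (lborel_prod (\<phi> ` B)) ?r = lborel_prod (\<phi> ` B)"
  proof (rule lborel_product.PiM_eqI)
    fix A :: "'a \<Rightarrow> real set" assume A: "\<And>i. i \<in> \<phi> ` B \<Longrightarrow> A i \<in> sets lborel"
    have [measurable]: "?r \<in> measurable (lborel_prod B) (lborel_prod (\<phi> ` B))"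
      by (rule measurable_restrict, rule measurable_component_singleton) (auto simp: inv_f_f[OF inj_phi])
    have "emeasure (distr (lborel_prod B) (lborel_prod (\<phi> ` B)) ?r) (Pi\<^sub>E (\<phi> ` B) A)
       = emeasure (lborel_prod B) (?r -` Pi\<^sub>E (\<phi> ` B) A \<inter> space (lborel_prod B))"
      using A B by (intro emeasure_distr sets_PiM_I_finite) auto
    also have "?r -` Pi\<^sub>E (\<phi> ` B) A \<inter> space (lborel_prod B) = (\<Pi>\<^sub>E b\<in>B. A (\<phi> b))"
      by (auto simp: space_PiM PiE_iff inv_f_f[OF inj_phi])
    also have "emeasure (lborel_prod B) \<dots> = (\<Prod>b\<in>B. emeasure lborel (A (\<phi> b)))"
      using A B by (intro lborel_product.emeasure_PiM) auto
    also have "\<dots> = (\<Prod>b\<in>\<phi> ` B. emeasure lborel (A b))"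
      by (simp add: prod.reindex inj_on_phi)
    finally show "emeasure (distr (lborel_prod B) (lborel_prod (\<phi> ` B)) ?r) (Pi\<^sub>E (\<phi> ` B) A) = (\<Prod>b\<in>\<phi> ` B. emeasure lborel (A b))" .
  qed (use B in auto)
  have [measurable]: "?r \<in> measurable (lborel_prod B) (lborel_prod (\<phi> ` B))"
    by (rule measurable_restrict, rule measurable_component_singleton) (auto simp: inv_f_f[OF inj_phi])
  have "onb_measure (\<phi> ` B) = distr (distr (lborel_prod B) (lborel_prod (\<phi> ` B)) ?r) borel (\<lambda>c. \<Sum>b\<in>\<phi> ` B. c b *\<^sub>R b)"
    unfolding re onb_measure_def ..
  also have "\<dots> = distr (lborel_prod B) borel (\<lambda>c. \<Sum>b\<in>\<phi> ` B. ?r c b *\<^sub>R b)"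
    by (subst distr_distr[OF measurable_onb_phi]) (auto simp: comp_def)
  also have "(\<lambda>c. \<Sum>b\<in>\<phi> ` B. ?r c b *\<^sub>R b) = (\<lambda>c. \<phi> (\<Sum>b\<in>B. c b *\<^sub>R b))"
    by (simp add: linear_sum[OF lin] linear_cmul[OF lin] sum.reindex inj_on_phi inv_f_f[OF inj_phi])
  also have "distr (lborel_prod B) borel \<dots> = distr (onb_measure B) borel \<phi>"
    unfolding onb_measure_def by (subst distr_distr) (auto simp: comp_def intro: measurable_onb_map)
  finally show ?thesis .
qed

text \<open>The basis picked by the choice operator is unknown, but it lies in E and so pulls back
  to an orthonormal set with the same span as \<open>B\<close>, where
  \<open>onb_measure_unique\<close> applies.\<close>

lemma subspace_lborel_eq:
  assumes B: "orthonormal B"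
  shows "subspace_lborel (\<phi> ` span B) = distr (onb_measure B) borel \<phi>"
proof -
  let ?F = "\<phi> ` span B"
  have "orthonormal_basis ?F (\<phi> ` B)"
    using B orthonormal_phi[of B] span_phi[of B] by (auto simp: orthonormal_basis_def orthonormal_def)
  then have "orthonormal_basis ?F (SOME B. orthonormal_basis ?F B)" by (rule someI)
  then obtain D where D: "D = (SOME B. orthonormal_basis ?F B)" "orthonormal_basis ?F D" by blast
  define D' where "D' = \<phi> -` D"
  have "D \<subseteq> ?F" using D(2) span_superset[of D] by (simp add: orthonormal_basis_def)
  also have "\<dots> \<subseteq> E" by auto
  finally have DD: "D = \<phi> ` D'" unfolding D'_def by (rule phi_image_vimage[symmetric])
  have po: "pairwise orthogonal D'"
    using D(2) inj_phi unfolding DD by (auto simp: orthonormal_basis_def pairwise_def orthogonal_def inner_phi inj_eq)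
  have n1: "norm b = 1" if "b \<in> D'" for b using D(2) that unfolding DD by (auto simp: orthonormal_basis_def norm_phi)
  have "finite D'" using po by (rule pairwise_orthogonal_imp_finite)
  with po n1 have oD: "orthonormal D'" by (simp add: orthonormal_def)
  have "\<phi> ` span D' = \<phi> ` span B" using D(2) span_phi[of D'] unfolding DD by (simp add: orthonormal_basis_def)
  then have "span D' = span B" using phi_vimage_image by metis
  then have "onb_measure D' = onb_measure B" by (rule onb_measure_unique[OF oD B])
  moreover have "subspace_lborel ?F = onb_measure D"
    unfolding subspace_lborel_def Let_def onb_measure_def D(1)[symmetric] ..
  ultimately show ?thesis using onb_measure_phi[OF \<open>finite D'\<close>] DD by simp
qed

lemma vol_eq:
  assumes B: "orthonormal B" and A: "A \<in> sets borel"
  shows "vol (\<phi> ` span B) A = measure (onb_measure B) (\<phi> -` A)"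
  unfolding vol_def subspace_lborel_eq[OF B]
  using A by (subst measure_distr) (auto simp: onb_measure_def)

lemma compact_phi_image: "compact A \<Longrightarrow> compact (\<phi> ` A)"
  by (rule compact_continuous_image[OF continuous_phi])

lemma vol_cball:
  assumes F: "subspace F" "F \<subseteq> E" and r: "r > 0"
  shows "vol F (cball 0 r \<inter> F) = unit_ball_vol (dim F) * r ^ dim F"
proof -
  obtain B where B: "orthonormal B" "F = \<phi> ` span B" "card B = dim F" by (rule onb_exists[OF F])
  have e: "cball 0 r \<inter> F = \<phi> ` (cball 0 r \<inter> span B)" using B by (auto simp: norm_phi)
  have "compact (cball 0 r \<inter> F)" unfolding e
    by (intro compact_phi_image compact_Int_closed compact_cball closed_subspace subspace_span)
  then have "vol F (cball 0 r \<inter> F) = measure (onb_measure B) (cball 0 r \<inter> span B)"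
    using B(2) vol_eq[OF B(1)] e phi_vimage_image by (metis borel_compact)
  also have "\<dots> = measure (onb_measure B) (cball 0 r)"
    by (rule measure_eq_AE) (use AE_onb_measure[of B] in \<open>auto intro!: borel_closed closed_subspace subspace_span sets.Int\<close>)
  also have "\<dots> = unit_ball_vol (dim F) * r ^ dim F"
    using r by (simp add: measure_def emeasure_onb_cball[OF B(1) r] B(3))
  finally show ?thesis .
qed

text \<open>Comparison with balls of radius tending to 0. It rules out radius 0 when the ball of
  given volume is shown to be unique.\<close>

lemma vol_zero:
  assumes F: "subspace F" "F \<subseteq> E" and k: "dim F \<ge> 1"
  shows "vol F {0} = 0"
proof (rule antisym)
  obtain B where B: "orthonormal B" "F = \<phi> ` span B" "card B = dim F" by (rule onb_exists[OF F])
  have "vol F {0} = measure (onb_measure B) {0}"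
    unfolding B(2) by (subst vol_eq[OF B(1)]) (auto intro!: arg_cong2[where f=measure] simp: linear_injective_0[OF lin, THEN iffD1, OF inj_phi] linear_0[OF lin])
  also have "\<dots> \<le> unit_ball_vol (dim F) * r ^ dim F" if "r > 0" for r
  proof -
    have "measure (onb_measure B) {0} \<le> measure (onb_measure B) (cball 0 r)"
      using that by (intro measure_mono_fmeasurable) (auto simp: fmeasurable_def emeasure_onb_cball[OF B(1)])
    also have "\<dots> = unit_ball_vol (dim F) * r ^ dim F"
      using that by (simp add: measure_def emeasure_onb_cball[OF B(1) that] B(3))
    finally show ?thesis .
  qed
  finally have le: "vol F {0} \<le> unit_ball_vol (dim F) * r ^ dim F" if "r > 0" for r using that .
  have "((\<lambda>r. unit_ball_vol (dim F) * r ^ dim F) \<longlongrightarrow> unit_ball_vol (dim F) * 0 ^ dim F) (at_right 0)"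
    by (intro tendsto_intros)
  moreover have "eventually (\<lambda>r. vol F {0} \<le> unit_ball_vol (dim F) * r ^ dim F) (at_right 0)"
    unfolding eventually_at_right_field using le by (intro exI[of _ 1]) auto
  ultimately have "vol F {0} \<le> unit_ball_vol (dim F) * 0 ^ dim F" by (rule tendsto_lowerbound) auto
  then show "vol F {0} \<le> 0" using k by (simp add: power_0_left)
qed (simp add: vol_def)

end

section \<open>The invariant measure on the Grassmannian\<close>

text \<open>The transpose of A applied to x. The rows of A are the images of the coordinate vectors,
  so rotating every row composes the rotation after \<open>row_comb A\<close> and is itself an
  orthogonal map on matrices.\<close>

definition row_comb :: "real ^ 'n ^ 'n \<Rightarrow> real ^ 'n \<Rightarrow> real ^ 'n" where
  "row_comb A x = (\<Sum>i\<in>UNIV. x $ i *\<^sub>R A $ i)"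

lemma linear_row_comb: "linear (row_comb A)"
  by (auto simp: linear_iff row_comb_def scaleR_add_left sum.distrib scaleR_sum_right)

lemma row_comb_scaleR: "row_comb (s *\<^sub>R A) x = s *\<^sub>R row_comb A x"
  by (simp add: row_comb_def scaleR_sum_right mult.commute)

lemma row_comb_diff: "row_comb (A - B) x = row_comb A x - row_comb B x"
  by (simp add: row_comb_def scaleR_diff_right sum_subtractf)

lemma norm_row_comb_le: "norm (row_comb A x) \<le> real CARD('n) * norm A * norm (x :: real ^ 'n)"
proof -
  have "norm (row_comb A x) \<le> (\<Sum>i\<in>(UNIV :: 'n set). norm (x $ i *\<^sub>R A $ i))"
    unfolding row_comb_def by (rule norm_sum)
  also have "\<dots> \<le> (\<Sum>i\<in>(UNIV :: 'n set). norm x * norm A)"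
  proof (rule sum_mono)
    fix i
    have "\<bar>x $ i\<bar> \<le> norm x" "norm (A $ i) \<le> norm A"
      by (auto simp: component_le_norm_cart Finite_Cartesian_Product.norm_nth_le)
    then show "norm (x $ i *\<^sub>R A $ i) \<le> norm x * norm A" by (simp add: mult_mono)
  qed
  finally show ?thesis by (simp add: mult_ac)
qed

lemma row_comb_mat_1: "row_comb (mat 1) x = x"
  by (simp add: vec_eq_iff row_comb_def mat_def if_distrib[of "\<lambda>c. _ * c"] cong: if_cong)

lemma dim_injective_image:
  fixes f :: "'b::euclidean_space \<Rightarrow> 'a::real_vector"
  assumes f: "linear f" "inj f" and F: "subspace F"
  shows "dim (f ` F) = dim F"
proof -
  obtain b where b: "b \<subseteq> F" "independent b" "F \<subseteq> span b" "card b = dim F" by (rule basis_exists)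
  have sp: "span b = F" using b F by (meson span_minimal subset_antisym)
  have "independent (f ` b)" using f b(2) by (simp add: linear_independent_injective_image inj_on_subset)
  moreover have "span (f ` b) = f ` F" using f sp by (simp add: span_linear_image)
  moreover have "card (f ` b) = card b" using f by (simp add: card_image inj_on_subset)
  ultimately show ?thesis using b(4) by (metis dim_span dim_eq_card_independent)
qed

lemma has_onb_dim_isometry_image:
  assumes T: "orthogonal_transformation T" and F: "has_onb F"
  shows "dim (T ` F) = dim F"
proof -
  obtain B where B: "orthonormal B" "F = span B" using F by (auto simp: has_onb_def)
  have "linear T" "\<And>x. norm (T x) = norm x" "inj T"
    using T by (auto simp: orthogonal_transformation orthogonal_transformation_inj)
  then show ?thesis
    using orthonormal_card[OF orthonormal_isometry_image[of T, OF _ _ B(1)]] orthonormal_card[OF B(1)]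
      span_linear_image[of T B] B(2) card_image[of T B] by (simp add: inj_on_subset)
qed

section \<open>Measurability with respect to gap-open sets\<close>

lemma space_grassmann_borel: "space (grassmann_borel E k) = grassmannian E k"
  and sets_grassmann_borel: "sets (grassmann_borel E k) = sigma_sets (grassmannian E k)
       {U. U \<subseteq> grassmannian E k \<and> (\<forall>F\<in>U. \<exists>e>0. \<forall>F'\<in>grassmannian E k. gap F F' < e \<longrightarrow> F' \<in> U)}"
proof -
  let ?O = "{U. U \<subseteq> grassmannian E k \<and> (\<forall>F\<in>U. \<exists>e>0. \<forall>F'\<in>grassmannian E k. gap F F' < e \<longrightarrow> F' \<in> U)}"
  have "?O \<subseteq> Pow (grassmannian E k)" by auto
  then show "space (grassmann_borel E k) = grassmannian E k" "sets (grassmann_borel E k) = sigma_sets (grassmannian E k) ?O"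
    unfolding grassmann_borel_def by (simp_all only: space_measure_of sets_measure_of)
qed

lemma measurable_grassmann_borelI:
  assumes f: "f \<in> space M \<rightarrow> grassmannian E k"
    and op: "\<And>U. U \<subseteq> grassmannian E k \<Longrightarrow> (\<And>F. F \<in> U \<Longrightarrow> \<exists>e>0. \<forall>F'\<in>grassmannian E k. gap F F' < e \<longrightarrow> F' \<in> U)
       \<Longrightarrow> f -` U \<inter> space M \<in> sets M"
  shows "f \<in> measurable M (grassmann_borel E k)"
  by (rule measurable_sigma_sets[OF sets_grassmann_borel]) (use assms in auto)

lemma open_in_grassmann_borel:
  assumes "U \<subseteq> grassmannian E k" "\<And>F. F \<in> U \<Longrightarrow> \<exists>e>0. \<forall>F'\<in>grassmannian E k. gap F F' < e \<longrightarrow> F' \<in> U"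
  shows "U \<in> sets (grassmann_borel E k)"
  unfolding sets_grassmann_borel using assms by (intro sigma_sets.Basic) auto

context linear_isometry
begin

lemma orth_image_grassmannian:
  assumes T: "orthogonal_transformation T" "T ` E = E" and F: "F \<in> grassmannian E k"
  shows "T ` F \<in> grassmannian E k"
proof -
  have "linear T" using T by (simp add: orthogonal_transformation_def)
  then show ?thesis
    using F T has_onb_dim_isometry_image[OF T(1) grassmannian_has_onb[OF F]]
    by (auto simp: grassmannian_def linear_subspace_image)
qed

text \<open>\<open>T\<close> need not be surjective on the ambient space, so vectors are first projected to \<open>E\<close>.\<close>

lemma gap_orth_image_le:
  assumes T: "orthogonal_transformation T" "T ` E = E"
    and F: "F \<in> grassmannian E k" "F' \<in> grassmannian E k"
  shows "gap (T ` F) (T ` F') \<le> gap F F'"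
proof (rule gap_le)
  have nT: "norm (T x) = norm x" for x using T by (simp add: orthogonal_transformation)
  have lT: "linear T" using T by (simp add: orthogonal_transformation)
  note o = grassmannian_has_onb[OF F(1)] grassmannian_has_onb[OF F(2)]
  show nn: "0 \<le> gap F F'"
    unfolding gap_def by (rule onorm_pos_le[OF bounded_linear_orth_proj_diff[OF o]])
  fix x
  have "orth_proj E x \<in> T ` E" using T(2) orth_proj_in[OF has_onb_E] by auto
  then obtain y where y: "y \<in> E" "orth_proj E x = T y" by auto
  have p: "orth_proj (T ` G) x = T (orth_proj G y)" if G: "G \<in> grassmannian E k" for G
  proof -
    note TG = orth_image_grassmannian[OF T G]
    have "orth_proj (T ` G) x = orth_proj (T ` G) (T y)"
    proof (rule orth_proj_unique)
      show "subspace (T ` G)" using TG by (simp add: grassmannian_def)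
      show "orth_proj (T ` G) (T y) \<in> T ` G" by (rule orth_proj_in[OF grassmannian_has_onb[OF TG]])
      fix z assume z: "z \<in> T ` G"
      have zE: "z \<in> E" using z TG by (auto simp: grassmannian_def)
      show "(x - orth_proj (T ` G) (T y)) \<bullet> z = 0"
        using orth_proj_orth[OF has_onb_E zE, of x] orth_proj_orth[OF grassmannian_has_onb[OF TG] z, of "T y"] y(2)
        by (simp add: inner_diff_left)
    qed
    then show ?thesis using orth_proj_isometry_image[OF T(1) grassmannian_has_onb[OF G]] by simp
  qed
  have "norm (orth_proj (T ` F) x - orth_proj (T ` F') x) = norm (orth_proj F y - orth_proj F' y)"
    unfolding p[OF F(1)] p[OF F(2)] linear_diff[OF lT, symmetric] by (rule nT)
  also have "\<dots> \<le> gap F F' * norm y" by (rule gap_bound[OF o])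
  also have "\<dots> \<le> gap F F' * norm x"
    using nn norm_orth_proj_le[OF has_onb_E, of x] nT[of y] y(2) by (intro mult_left_mono) auto
  finally show "norm (orth_proj (T ` F) x - orth_proj (T ` F') x) \<le> gap F F' * norm x" .
qed

lemma measurable_orth_image:
  assumes T: "orthogonal_transformation T" "T ` E = E"
  shows "(`) T \<in> measurable (grassmann_borel E k) (grassmann_borel E k)"
proof (rule measurable_grassmann_borelI)
  show "(`) T \<in> space (grassmann_borel E k) \<rightarrow> grassmannian E k"
    using orth_image_grassmannian[OF T] by (auto simp: space_grassmann_borel)
  fix U assume U: "U \<subseteq> grassmannian E k" "\<And>F. F \<in> U \<Longrightarrow> \<exists>e>0. \<forall>F'\<in>grassmannian E k. gap F F' < e \<longrightarrow> F' \<in> U"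
  show "(`) T -` U \<inter> space (grassmann_borel E k) \<in> sets (grassmann_borel E k)"
  proof (rule open_in_grassmann_borel)
    fix F assume "F \<in> (`) T -` U \<inter> space (grassmann_borel E k)"
    then have F: "T ` F \<in> U" "F \<in> grassmannian E k" by (auto simp: space_grassmann_borel)
    from U(2)[OF F(1)] obtain e where e: "e > 0" "\<And>F'. F' \<in> grassmannian E k \<Longrightarrow> gap (T ` F) F' < e \<Longrightarrow> F' \<in> U" by blast
    then show "\<exists>e>0. \<forall>F'\<in>grassmannian E k. gap F F' < e \<longrightarrow> F' \<in> (`) T -` U \<inter> space (grassmann_borel E k)"
      using gap_orth_image_le[OF T F(2)] orth_image_grassmannian[OF T]
      by (intro exI[of _ e]) (auto simp: space_grassmann_borel intro: le_less_trans)
  qed (auto simp: space_grassmann_borel)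
qed

text \<open>An injective linear map is bounded below by c |x|, so a small change of the matrix moves
  each image vector by little relative to its own length. This is the hypothesis of
  \<open>gap_le_approx\<close>. It yields both that injective matrices form an open set and that the
  image subspace varies continuously.\<close>

lemma row_comb_gap_continuous:
  assumes A: "inj (row_comb A)" and F0: "subspace F0" and e: "e > 0"
  shows "\<exists>\<delta>>0. \<forall>A'. norm (A' - A) < \<delta> \<longrightarrow>
    inj (row_comb A') \<and> gap (\<phi> ` row_comb A ` F0) (\<phi> ` row_comb A' ` F0) < e"
proof -
  obtain c where c: "c > 0" "\<And>x. c * norm x \<le> norm (row_comb A x)"
    using linear_inj_bounded_below_pos[OF linear_row_comb A] by metis
  define N where "N = real CARD('n)"
  have N: "N > 0" by (simp add: N_def)
  \<comment> \<open>The first term keeps the perturbed map bounded below by c / 2. The second makes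
    the relative error at most e / 4, whence a gap of at most e / 2.\<close>
  define \<delta> where "\<delta> = min (c / (2 * N)) (e * c / (8 * N))"
  have \<delta>: "\<delta> > 0" using c e N by (simp add: \<delta>_def)
  have N1: "N * \<delta> \<le> c / 2" and N2: "N * \<delta> \<le> e * c / 8"
    using N by (auto simp: \<delta>_def min_def field_simps)
  show ?thesis
  proof (intro exI[of _ \<delta>] conjI allI impI \<delta>)
    fix A' assume A': "norm (A' - A) < \<delta>"
    have d: "norm (row_comb A' x - row_comb A x) \<le> (N * \<delta>) * norm x" for x
    proof -
      have "norm (row_comb A' x - row_comb A x) \<le> N * norm (A' - A) * norm x"
        unfolding row_comb_diff[symmetric] N_def by (rule norm_row_comb_le)
      also have "\<dots> \<le> N * \<delta> * norm x"
        using A' N by (intro mult_right_mono mult_left_mono) auto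
      finally show ?thesis .
    qed
    have low: "c / 2 * norm x \<le> norm (row_comb A' x)" for x
    proof -
      have "norm (row_comb A x) \<le> norm (row_comb A' x) + norm (row_comb A' x - row_comb A x)"
        using norm_triangle_ineq4[of "row_comb A' x" "row_comb A' x - row_comb A x"] by simp
      also have "norm (row_comb A' x - row_comb A x) \<le> c / 2 * norm x"
        using d[of x] N1 by (meson mult_right_mono norm_ge_zero order_trans)
      finally show ?thesis using c(2)[of x] by simp
    qed
    show inj: "inj (row_comb A')"
      unfolding linear_injective_0[OF linear_row_comb]
    proof (intro allI impI)
      fix x assume "row_comb A' x = 0"
      then show "x = 0" using low[of x] c(1) by (simp add: mult_le_0_iff)
    qed
    have on: "has_onb (\<phi> ` row_comb B ` F0)" for B
      by (intro has_onb_subspace_E linear_subspace_image lin linear_row_comb F0) auto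
    have "gap (\<phi> ` row_comb A ` F0) (\<phi> ` row_comb A' ` F0) \<le> 2 * (e / 4)"
    proof (rule gap_le_approx[OF on on])
      have close: "norm (\<phi> (row_comb B x) - \<phi> (row_comb B' x)) \<le> e / 4 * norm (\<phi> (row_comb B x))"
        if B: "(B = A \<and> B' = A') \<or> (B = A' \<and> B' = A)" for B B' x
      proof -
        have "norm (\<phi> (row_comb B x) - \<phi> (row_comb B' x)) \<le> (N * \<delta>) * norm x"
          using d[of x] B by (auto simp: norm_phi linear_diff[OF lin, symmetric] norm_minus_commute)
        also have "\<dots> \<le> e * c / 8 * norm x" using N2 by (rule mult_right_mono) simp
        also have "\<dots> = e / 4 * (c / 2 * norm x)" by simp
        also have "c / 2 * norm x \<le> norm (row_comb B x)"
        proof (cases "B = A")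
          case True
          have "c / 2 * norm x \<le> c * norm x" using c(1) by (intro mult_right_mono) auto
          then show ?thesis using c(2)[of x] True by simp
        qed (use B low in auto)
        finally show ?thesis using e by (simp add: norm_phi)
      qed
      show "\<exists>y'\<in>\<phi> ` row_comb A' ` F0. norm (y - y') \<le> e / 4 * norm y" if "y \<in> \<phi> ` row_comb A ` F0" for y
        using that close[of A A'] by auto
      show "\<exists>y'\<in>\<phi> ` row_comb A ` F0. norm (y - y') \<le> e / 4 * norm y" if "y \<in> \<phi> ` row_comb A' ` F0" for y
        using that close[of A' A] by auto
    qed (use e in auto)
    then show "gap (\<phi> ` row_comb A ` F0) (\<phi> ` row_comb A' ` F0) < e" using e by simp
  qed
qed

text \<open>A random subspace is the image of a fixed \<open>F0\<close> under a matrix drawn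
  uniformly from the injective ones in the unit ball. Rotating all rows preserves Lebesgue measure,
  the norm and injectivity, and it rotates the image. Conditioning on injective matrices leaves no
  null-set argument for singular ones.\<close>

theorem rotation_invariant_prob_exists:
  assumes k: "k \<le> CARD('n)"
  shows "\<exists>\<mu>. rotation_invariant_prob E k \<mu>"
proof -
  obtain F0 :: "(real ^ 'n) set" where F0: "subspace F0" "dim F0 = k"
    using choose_subspace_of_subspace[of k "UNIV :: (real ^ 'n) set"] k by auto
  define U where "U = {A :: real ^ 'n ^ 'n. norm A < 1 \<and> inj (row_comb A)}"
  \<comment> \<open>The default value outside \<open>U\<close> keeps the map in the Grassmannian
    everywhere; the law of the matrix is concentrated on \<open>U\<close>.\<close>
  define Fm where "Fm A = (if A \<in> U then \<phi> ` row_comb A ` F0 else \<phi> ` F0)" for A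
  define M where "M = uniform_measure lborel U"
  let ?G = "grassmann_borel E k"
  have opU: "open U"
    unfolding open_dist
  proof
    fix A assume A: "A \<in> U"
    then obtain \<delta> where \<delta>: "\<delta> > 0" "\<And>A'. norm (A' - A) < \<delta> \<Longrightarrow> inj (row_comb A')"
      using row_comb_gap_continuous[of A F0 1] F0 by (auto simp: U_def)
    show "\<exists>e>0. \<forall>y. dist y A < e \<longrightarrow> y \<in> U"
    proof (intro exI[of _ "min \<delta> (1 - norm A)"] conjI allI impI)
      show "0 < min \<delta> (1 - norm A)" using \<delta> A by (auto simp: U_def)
      fix y assume "dist y A < min \<delta> (1 - norm A)"
      then have "norm (y - A) < \<delta>" "norm (y - A) < 1 - norm A" by (auto simp: dist_norm)
      moreover have "norm y \<le> norm (y - A) + norm A" using norm_triangle_ineq[of "y - A" A] by simp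
      ultimately show "y \<in> U" using \<delta> by (auto simp: U_def)
    qed
  qed
  have "U \<noteq> {}"
  proof -
    \<comment> \<open>A small multiple of the identity matrix witnesses that \<open>U\<close> is
      nonempty; being open, \<open>U\<close> then has positive measure.\<close>
    define s where "s = 1 / (2 * (norm (mat 1 :: real ^ 'n ^ 'n) + 1))"
    have s: "s > 0" by (simp add: s_def add_nonneg_pos)
    have "norm (s *\<^sub>R (mat 1 :: real ^ 'n ^ 'n)) < 1"
    proof -
      have "u / (2 * (u + 1)) < 1" if "0 \<le> u" for u :: real using that by (simp add: field_simps)
      from this[OF norm_ge_zero] show ?thesis by (simp add: s_def)
    qed
    moreover have "row_comb (s *\<^sub>R mat 1) x = s *\<^sub>R x" for x :: "real ^ 'n"
      by (simp add: row_comb_scaleR row_comb_mat_1)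
    then have "inj (row_comb (s *\<^sub>R (mat 1 :: real ^ 'n ^ 'n)))" using s by (auto simp: inj_on_def)
    ultimately show ?thesis unfolding U_def by blast
  qed
  then obtain A0 r where r: "r > 0" "ball A0 r \<subseteq> U" using opU by (meson ex_in_conv open_contains_ball)
  have "emeasure lborel (ball A0 r) > 0"
    using r unit_ball_vol_pos[of "real DIM(real ^ 'n ^ 'n)"] by (simp add: emeasure_ball)
  also have "emeasure lborel (ball A0 r) \<le> emeasure lborel U" using r opU by (intro emeasure_mono) auto
  finally have U0: "emeasure lborel U \<noteq> 0" by simp
  have "emeasure lborel U \<le> emeasure lborel (ball (0 :: real ^ 'n ^ 'n) 1)"
    by (intro emeasure_mono) (auto simp: U_def)
  then have Ui: "emeasure lborel U \<noteq> \<infinity>"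
    by (auto simp: emeasure_ball top_unique)
  interpret M: prob_space M unfolding M_def by (rule prob_space_uniform_measure[OF U0 Ui])
  have sM [simp]: "sets M = sets borel" "space M = UNIV" by (auto simp: M_def)
  have AEU: "AE A in M. A \<in> U"
    unfolding M_def by (rule AE_uniform_measureI) (use opU in auto)
  have dimF: "dim (\<phi> ` row_comb A ` F0) = k" if "inj (row_comb A)" for A
  proof -
    have "dim ((\<phi> \<circ> row_comb A) ` F0) = k"
      using dim_injective_image[of "\<phi> \<circ> row_comb A" F0] that inj_phi F0
      by (simp add: linear_compose[OF linear_row_comb lin] inj_compose)
    then show ?thesis by (simp add: image_comp)
  qed
  have FmG: "Fm A \<in> grassmannian E k" for A
    unfolding Fm_def grassmannian_def using dimF[of A] F0 dim_injective_image[OF lin inj_phi F0(1)]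
    by (auto simp: U_def intro!: linear_subspace_image lin linear_row_comb)
  have Fm: "Fm \<in> measurable M ?G"
  proof (rule measurable_grassmann_borelI)
    fix V assume V: "V \<subseteq> grassmannian E k" "\<And>F. F \<in> V \<Longrightarrow> \<exists>e>0. \<forall>F'\<in>grassmannian E k. gap F F' < e \<longrightarrow> F' \<in> V"
    have "open {A \<in> U. \<phi> ` row_comb A ` F0 \<in> V}"
      unfolding open_dist
    proof
      fix A assume "A \<in> {A \<in> U. \<phi> ` row_comb A ` F0 \<in> V}"
      then have A: "A \<in> U" "\<phi> ` row_comb A ` F0 \<in> V" by auto
      from V(2)[OF A(2)] obtain e where e: "e > 0"
        "\<And>F'. F' \<in> grassmannian E k \<Longrightarrow> gap (\<phi> ` row_comb A ` F0) F' < e \<Longrightarrow> F' \<in> V" by blast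
      obtain \<delta> where \<delta>: "\<delta> > 0" "\<And>A'. norm (A' - A) < \<delta> \<Longrightarrow> gap (\<phi> ` row_comb A ` F0) (\<phi> ` row_comb A' ` F0) < e"
        using row_comb_gap_continuous[of A F0 e] F0 A e by (auto simp: U_def)
      obtain d where d: "d > 0" "\<And>A'. dist A' A < d \<Longrightarrow> A' \<in> U" using opU A(1) by (meson open_dist)
      have "A' \<in> U \<and> \<phi> ` row_comb A' ` F0 \<in> V" if "dist A' A < min \<delta> d" for A'
      proof -
        have A': "A' \<in> U" using d that by auto
        then have "\<phi> ` row_comb A' ` F0 \<in> grassmannian E k" using FmG[of A'] by (simp add: Fm_def)
        then show ?thesis using A' \<delta>(2)[of A'] e(2) that by (auto simp: dist_norm)
      qed
      then show "\<exists>e>0. \<forall>y. dist y A < e \<longrightarrow> y \<in> {A \<in> U. \<phi> ` row_comb A ` F0 \<in> V}"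
        using d \<delta> by (intro exI[of _ "min \<delta> d"]) auto
    qed
    moreover have "Fm -` V \<inter> space M = {A \<in> U. \<phi> ` row_comb A ` F0 \<in> V} \<union> (if \<phi> ` F0 \<in> V then - U else {})"
      by (auto simp: Fm_def split: if_splits)
    ultimately show "Fm -` V \<inter> space M \<in> sets M" using opU by auto
  qed (use FmG in auto)
  define \<mu> where "\<mu> = distr M ?G Fm"
  have s\<mu>: "sets \<mu> = sets ?G" by (simp add: \<mu>_def)
  have "rotation_invariant_prob E k \<mu>"
    unfolding rotation_invariant_prob_def
  proof (intro conjI allI impI)
    show "sets \<mu> = sets ?G" by fact
    show "prob_space \<mu>" unfolding \<mu>_def by (rule M.prob_space_distr[OF Fm])
    fix T assume T: "orthogonal_transformation T \<and> T ` E = E"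
    have nT: "norm (T x) = norm x" and lT: "linear T" for x using T by (auto simp: orthogonal_transformation)
    have mT: "(`) T \<in> measurable ?G ?G" using T by (intro measurable_orth_image) auto
    \<comment> \<open>The rotation T read in the coordinates of E; \<open>Q\<close> below applies it
      to each row.\<close>
    define T' where "T' x = inv \<phi> (T (\<phi> x))" for x
    have T': "\<phi> (T' x) = T (\<phi> x)" for x
    proof -
      have "T (\<phi> x) \<in> range \<phi>" using T range_phi by auto
      then show ?thesis unfolding T'_def by (rule f_inv_into_f)
    qed
    have nT': "norm (T' x) = norm x" for x using T'[of x] nT norm_phi by metis
    have lT': "linear T'"
    proof (rule linearI)
      fix x y and c :: real
      have "\<phi> (T' (x + y)) = \<phi> (T' x + T' y)" by (simp add: T' linear_add[OF lin] linear_add[OF lT])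
      then show "T' (x + y) = T' x + T' y" using inj_phi by (simp add: inj_eq)
      have "\<phi> (T' (c *\<^sub>R x)) = \<phi> (c *\<^sub>R T' x)" by (simp add: T' linear_cmul[OF lin] linear_cmul[OF lT])
      then show "T' (c *\<^sub>R x) = c *\<^sub>R T' x" using inj_phi by (simp add: inj_eq)
    qed
    have oT': "orthogonal_transformation T'" using lT' nT' by (simp add: orthogonal_transformation)
    define Q where "Q A = (\<chi> i. T' (A $ i))" for A :: "real ^ 'n ^ 'n"
    have oQ: "orthogonal_transformation Q"
      unfolding orthogonal_transformation_def
    proof
      show "linear Q" by (auto simp: linear_iff Q_def vec_eq_iff linear_add[OF lT'] linear_cmul[OF lT'])
      show "\<forall>v w. Q v \<bullet> Q w = v \<bullet> w" using oT' by (simp add: inner_vec_def[where 'a="real^'n"] Q_def orthogonal_transformation_def)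
    qed
    have Qrc: "row_comb (Q A) x = T' (row_comb A x)" for A x
      by (simp add: row_comb_def Q_def linear_sum[OF lT'] linear_cmul[OF lT'])
    have injT': "inj T'" using oT' by (rule orthogonal_transformation_inj)
    have QU: "Q A \<in> U \<longleftrightarrow> A \<in> U" for A
    proof -
      have "norm (Q A) = norm A" using oQ by (simp add: orthogonal_transformation)
      moreover have "inj (row_comb (Q A)) \<longleftrightarrow> inj (row_comb A)"
        by (simp only: Qrc inj_on_def inj_eq[OF injT'])
      ultimately show ?thesis by (simp add: U_def)
    qed
    have [measurable]: "Q \<in> borel_measurable borel"
      using oQ by (intro borel_measurable_continuous_onI linear_continuous_on linear_conv_bounded_linear[THEN iffD1])
        (simp add: orthogonal_transformation_def)
    have mQ: "Q \<in> measurable M borel" by (simp cong: measurable_cong_sets)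
    have MQ: "distr M borel Q = M"
    proof (rule measure_eqI)
      fix X assume "X \<in> sets (distr M borel Q)"
      then have X [measurable]: "X \<in> sets borel" by simp
      have [measurable]: "U \<in> sets borel" using opU by simp
      have [measurable]: "Q -` X \<in> sets borel" using measurable_sets[of Q borel borel X] by simp
      have "emeasure (distr M borel Q) X = emeasure M (Q -` X)"
        using emeasure_distr[OF mQ X] by simp
      also have "\<dots> = emeasure lborel (U \<inter> Q -` X) / emeasure lborel U"
        unfolding M_def by (rule emeasure_uniform_measure) auto
      also have "U \<inter> Q -` X = Q -` (U \<inter> X)" using QU by auto
      also have "emeasure lborel \<dots> = emeasure (distr lborel borel Q) (U \<inter> X)"
        by (subst emeasure_distr) auto
      also have "distr lborel borel Q = lborel" by (rule lborel_orthogonal_image[OF oQ])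
      also have "emeasure lborel (U \<inter> X) / emeasure lborel U = emeasure M X"
        unfolding M_def by (rule emeasure_uniform_measure[symmetric]) auto
      finally show "emeasure (distr M borel Q) X = emeasure M X" .
    qed simp
    have mFb: "Fm \<in> measurable borel ?G" using Fm by (simp cong: measurable_cong_sets)
    have "distr \<mu> \<mu> ((`) T) = distr \<mu> ?G ((`) T)" by (rule distr_cong) (auto simp: s\<mu>)
    also have "\<dots> = distr M ?G ((`) T \<circ> Fm)" unfolding \<mu>_def by (rule distr_distr[OF mT Fm])
    also have "\<dots> = distr M ?G (Fm \<circ> Q)"
    proof (rule distr_cong_AE)
      show "AE A in M. ((`) T \<circ> Fm) A = (Fm \<circ> Q) A"
        using AEU
      proof eventually_elim
        fix A assume "A \<in> U"
        then show "((`) T \<circ> Fm) A = (Fm \<circ> Q) A"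
          by (simp add: Fm_def QU image_image Qrc T')
      qed
    qed (use mT Fm mQ mFb in \<open>auto intro: measurable_comp\<close>)
    also have "\<dots> = distr (distr M borel Q) ?G Fm" by (rule distr_distr[symmetric, OF mFb mQ])
    also have "\<dots> = \<mu>" unfolding MQ \<mu>_def ..
    finally show "distr \<mu> \<mu> ((`) T) = \<mu>" .
  qed
  then show ?thesis by blast
qed

lemma rotation_invariant_grassmann_measure:
  "k \<le> CARD('n) \<Longrightarrow> rotation_invariant_prob E k (grassmann_measure E k)"
  unfolding grassmann_measure_def using rotation_invariant_prob_exists by (rule someI_ex)

end

section \<open>Moments of the length of a random projection\<close>

abbreviation proj_sq :: "'a::real_inner set \<Rightarrow> 'a \<Rightarrow> real" where
  "proj_sq F x \<equiv> (norm (orth_proj F x))\<^sup>2"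

context linear_isometry
begin

context
  fixes k :: nat
  assumes k: "k \<le> CARD('n)"
begin

abbreviation "\<mu> \<equiv> grassmann_measure E k"

lemma sets_grassmann_measure [measurable_cong]: "sets \<mu> = sets (grassmann_borel E k)"
  using rotation_invariant_grassmann_measure[OF k] by (simp add: rotation_invariant_prob_def)

lemma space_grassmann_measure: "space \<mu> = grassmannian E k"
  using sets_eq_imp_space_eq[OF sets_grassmann_measure] by (simp add: space_grassmann_borel)

lemma prob_space_grassmann_measure: "prob_space \<mu>"
  using rotation_invariant_grassmann_measure[OF k] by (simp add: rotation_invariant_prob_def)

lemma has_onb_grassmann: "F \<in> space \<mu> \<Longrightarrow> has_onb F"
  by (simp add: space_grassmann_measure grassmannian_has_onb)

lemma measurable_norm_orth_proj [measurable]: "(\<lambda>F. norm (orth_proj F x)) \<in> borel_measurable \<mu>"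
proof (rule borel_measurableI_greater)
  fix a
  have "{F \<in> grassmannian E k. a < norm (orth_proj F x)} \<in> sets (grassmann_borel E k)"
  proof (rule open_in_grassmann_borel)
    fix F assume "F \<in> {F \<in> grassmannian E k. a < norm (orth_proj F x)}"
    then have F: "F \<in> grassmannian E k" "a < norm (orth_proj F x)" by auto
    \<comment> \<open>The summand 1 in the denominator covers x = 0 and makes the estimate
      strict.\<close>
    define e where "e = (norm (orth_proj F x) - a) / (norm x + 1)"
    have e: "e > 0" using F by (simp add: e_def add_nonneg_pos)
    have "a < norm (orth_proj F' x)" if F': "F' \<in> grassmannian E k" "gap F F' < e" for F'
    proof -
      have "norm (orth_proj F x - orth_proj F' x) \<le> gap F F' * norm x"
        using F F' by (intro gap_bound grassmannian_has_onb)
      also have "\<dots> \<le> e * norm x" using F' by (intro mult_right_mono) auto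
      also have "\<dots> < e * (norm x + 1)" using e by simp
      also have "\<dots> = norm (orth_proj F x) - a" using add_nonneg_pos[of "norm x" 1] by (simp add: e_def)
      finally show ?thesis
        using norm_triangle_ineq2[of "orth_proj F x" "orth_proj F' x"] by linarith
    qed
    then show "\<exists>e>0. \<forall>F'\<in>grassmannian E k. gap F F' < e \<longrightarrow> F' \<in> {F \<in> grassmannian E k. a < norm (orth_proj F x)}"
      using e by (intro exI[of _ e]) auto
  qed auto
  then show "{F \<in> space \<mu>. a < norm (orth_proj F x)} \<in> sets \<mu>"
    by (simp add: space_grassmann_measure sets_grassmann_measure)
qed

text \<open>By polarization, since only lengths of projections have been shown measurable.\<close>

lemma measurable_inner_orth_proj [measurable]: "(\<lambda>F. orth_proj F x \<bullet> y) \<in> borel_measurable \<mu>"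
proof -
  have eq: "orth_proj F x \<bullet> y = (proj_sq F (x + y) - proj_sq F x - proj_sq F y) / 2"
    if "F \<in> space \<mu>" for F
  proof -
    note o = has_onb_grassmann[OF that]
    have "orth_proj F x \<bullet> y = orth_proj F x \<bullet> orth_proj F y"
      using orth_proj_inner[OF o orth_proj_in[OF o], of y x] by (simp add: inner_commute)
    then show ?thesis by (simp add: linear_add[OF linear_orth_proj[OF o]] dot_norm)
  qed
  show ?thesis by (subst measurable_cong[OF eq]) measurable
qed

definition proj_moment2 :: "nat \<Rightarrow> 'a \<Rightarrow> real" where
  "proj_moment2 j x = (\<integral>F. proj_sq F x ^ j \<partial>\<mu>)"

lemma proj_moment2_orthogonal:
  assumes T: "orthogonal_transformation T" "T ` E = E"
  shows "proj_moment2 j (T x) = proj_moment2 j x"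
proof -
  have mT: "(`) T \<in> measurable \<mu> \<mu>"
    using measurable_orth_image[OF T] by (simp cong: measurable_cong_sets add: sets_grassmann_measure)
  have inv: "distr \<mu> \<mu> ((`) T) = \<mu>"
    using rotation_invariant_grassmann_measure[OF k] T by (simp add: rotation_invariant_prob_def)
  have "proj_moment2 j (T x) = (\<integral>F. (proj_sq F (T x)) ^ j \<partial>distr \<mu> \<mu> ((`) T))"
    unfolding proj_moment2_def inv ..
  also have "\<dots> = (\<integral>F. ((norm (orth_proj (T ` F) (T x)))\<^sup>2) ^ j \<partial>\<mu>)"
    by (rule integral_distr[OF mT]) measurable
  also have "\<dots> = proj_moment2 j x"
    unfolding proj_moment2_def using T
    by (intro Bochner_Integration.integral_cong)
      (auto simp: orth_proj_isometry_image[OF T(1) has_onb_grassmann] orthogonal_transformation)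
  finally show ?thesis .
qed

text \<open>The reflection in the hyperplane orthogonal to x - y. It acts on the whole ambient space
  and preserves E because x - y lies in E.\<close>

lemma reflection_exists:
  assumes x: "x \<in> E" and y: "y \<in> E" and n: "norm x = norm y"
  shows "\<exists>T. orthogonal_transformation T \<and> T ` E = E \<and> T x = y"
proof (cases "x = y")
  case True
  then show ?thesis by (intro exI[of _ "\<lambda>x. x"]) simp
next
  case False
  define w where "w = x - y"
  have w: "w \<in> E" "w \<bullet> w \<noteq> 0" using x y False by (auto simp: w_def subspace_E subspace_diff)
  define T where "T z = z - (2 * (z \<bullet> w) / (w \<bullet> w)) *\<^sub>R w" for z
  have lin: "linear T"
  proof (rule linearI)
    show "T (u + v) = T u + T v" for u v
      by (simp add: T_def inner_add_left distrib_left add_divide_distrib scaleR_add_left)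
    show "T (r *\<^sub>R v) = r *\<^sub>R T v" for r v
      by (simp add: T_def scaleR_diff_right mult.left_commute)
  qed
  have TT: "T (T z) = z" for z
  proof -
    have "T z \<bullet> w = - (z \<bullet> w)" using w(2) by (simp add: T_def inner_diff_left)
    then show ?thesis by (simp add: T_def[of "T z"]) (simp add: T_def)
  qed
  have in_T: "T u \<bullet> T v = u \<bullet> v" for u v
  proof -
    have "T u \<bullet> T v = u \<bullet> v - 2 * (v \<bullet> w) / (w \<bullet> w) * (u \<bullet> w) - 2 * (u \<bullet> w) / (w \<bullet> w) * (v \<bullet> w)
        + 2 * (u \<bullet> w) / (w \<bullet> w) * (2 * (v \<bullet> w) / (w \<bullet> w) * (w \<bullet> w))"
      by (simp add: T_def inner_diff_left inner_diff_right inner_commute[of w v])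
    then show ?thesis using w(2) by simp
  qed
  have TE: "T z \<in> E" if "z \<in> E" for z
    using that w by (simp add: T_def subspace_E subspace_diff subspace_scale)
  have "w \<bullet> w = 2 * (x \<bullet> w)"
  proof -
    have "x \<bullet> x = y \<bullet> y" using n by (simp add: norm_eq_sqrt_inner)
    then show ?thesis by (simp add: w_def inner_diff_left inner_diff_right inner_commute[of y x])
  qed
  then have "2 * (x \<bullet> w) / (w \<bullet> w) = 1" using w(2) by (metis divide_self)
  then have "T x = x - 1 *\<^sub>R w" by (simp only: T_def)
  then have "T x = y" by (simp add: w_def)
  moreover have "T ` E = E" using TE TT by (metis image_iff subsetI subset_antisym image_subsetI)
  ultimately show ?thesis using lin in_T by (auto simp: orthogonal_transformation_def)
qed

text \<open>Rotation invariance makes the moment a function of the norm alone, and homogeneity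
  determines that function up to one constant.\<close>

lemma proj_moment2_scale:
  assumes "e \<in> E" "norm e = 1" "x \<in> E"
  shows "proj_moment2 j x = proj_moment2 j e * ((norm x)\<^sup>2) ^ j"
proof -
  have "norm (norm x *\<^sub>R e) = norm x" "norm x *\<^sub>R e \<in> E" using assms by (auto simp: subspace_E subspace_scale)
  then obtain T where T: "orthogonal_transformation T" "T ` E = E" "T (norm x *\<^sub>R e) = x"
    using reflection_exists[of "norm x *\<^sub>R e" x] assms by auto
  have "proj_moment2 j x = proj_moment2 j (norm x *\<^sub>R e)" using proj_moment2_orthogonal[OF T(1,2)] T(3) by metis
  also have "\<dots> = (\<integral>F. proj_sq F e ^ j * ((norm x)\<^sup>2) ^ j \<partial>\<mu>)"
    unfolding proj_moment2_def
    by (intro Bochner_Integration.integral_cong)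
      (auto simp: linear_cmul[OF linear_orth_proj[OF has_onb_grassmann]] power_mult_distrib mult.commute)
  finally show ?thesis by (simp add: proj_moment2_def)
qed

lemma norm_orth_proj_add_scale:
  assumes F: "has_onb F"
  shows "proj_sq F (x + s *\<^sub>R b)
    = proj_sq F x + 2 * (orth_proj F x \<bullet> b) * s + proj_sq F b * s\<^sup>2"
proof -
  have "orth_proj F x \<bullet> orth_proj F b = orth_proj F x \<bullet> b"
    using orth_proj_inner[OF F orth_proj_in[OF F], of b x] by (simp add: inner_commute)
  then show ?thesis
    by (simp add: linear_add[OF linear_orth_proj[OF F]] linear_cmul[OF linear_orth_proj[OF F]]
      power2_norm_eq_inner inner_add_left inner_add_right inner_commute[of "orth_proj F b" "orth_proj F x"] power2_eq_square[of s] algebra_simps)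
qed

lemma integrable_grassmann:
  fixes f :: "'a set \<Rightarrow> real"
  assumes "f \<in> borel_measurable \<mu>" "\<And>F. F \<in> space \<mu> \<Longrightarrow> \<bar>f F\<bar> \<le> C"
  shows "integrable \<mu> f"
proof -
  interpret prob_space \<mu> by (rule prob_space_grassmann_measure)
  show ?thesis using assms by (intro integrable_const_bound[of _ C]) auto
qed

text \<open>Compares the \<open>s\<^sup>2\<close> coefficients in \<open>proj_moment2 j (e + s b) = c \<cdot> \<bar>e + s b\<bar>\<^sup>2\<^sup>j\<close>.\<close>

lemma proj_moment2_second_variation:
  assumes e: "e \<in> E" "norm e = 1" and b: "b \<in> E" "norm b = 1"
  shows "(\<integral>F. real j * proj_sq F e ^ (j - 1) * proj_sq F b
      + real j * (real j - 1) / 2 * proj_sq F e ^ (j - 2) * (2 * (orth_proj F e \<bullet> b))\<^sup>2 \<partial>\<mu>)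
    = proj_moment2 j e * (real j + real j * (real j - 1) / 2 * (2 * (e \<bullet> b))\<^sup>2)"
    (is "(\<integral>F. ?f F \<partial>\<mu>) = _")
proof -
  interpret prob_space \<mu> by (rule prob_space_grassmann_measure)
  have le1: "proj_sq F x \<le> 1" if "F \<in> space \<mu>" "norm x = 1" for F x
    using norm_orth_proj_le[OF has_onb_grassmann[OF that(1)], of x] that(2) by (simp add: power_le_one)
  have le2: "\<bar>orth_proj F e \<bullet> b\<bar> \<le> 1" if "F \<in> space \<mu>" for F
    using norm_orth_proj_le[OF has_onb_grassmann[OF that], of e] Cauchy_Schwarz_ineq2[of "orth_proj F e" b] e b by simp
  have "jet2 (space \<mu>) (\<lambda>s F. proj_sq F (e + s *\<^sub>R b)) (\<lambda>F. proj_sq F e)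
      (\<lambda>F. 2 * (orth_proj F e \<bullet> b)) (\<lambda>F. proj_sq F b)"
  proof (rule jet2_cong[OF jet2_poly[of "space \<mu>" "\<lambda>F. proj_sq F e" 2
        "\<lambda>F. 2 * (orth_proj F e \<bullet> b)" "\<lambda>F. proj_sq F b"]])
    show "\<bar>2 * (orth_proj F e \<bullet> b)\<bar> \<le> 2" if "F \<in> space \<mu>" for F
      using le2[OF that] by linarith
    show "\<bar>proj_sq F e\<bar> \<le> 2" "\<bar>proj_sq F b\<bar> \<le> 2" if "F \<in> space \<mu>" for F
      using le1[OF that e(2)] le1[OF that b(2)] by auto
  qed (auto simp: norm_orth_proj_add_scale[OF has_onb_grassmann])
  from jet2_integral[OF finite_measure_axioms jet2_power[OF this, of j], where U="{()}"]
  have 1: "jet2 {()} (\<lambda>s _. proj_moment2 j (e + s *\<^sub>R b)) (\<lambda>_. proj_moment2 j e)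
      (\<lambda>_. \<integral>F. real j * proj_sq F e ^ (j - 1) * (2 * (orth_proj F e \<bullet> b)) \<partial>\<mu>)
      (\<lambda>_. \<integral>F. ?f F \<partial>\<mu>)"
    unfolding proj_moment2_def by simp
  have "jet2 {()} (\<lambda>s _. 1 + 2 * (e \<bullet> b) * s + 1 * s\<^sup>2) (\<lambda>_. 1) (\<lambda>_. 2 * (e \<bullet> b)) (\<lambda>_. 1)"
    by (rule jet2_poly[of _ _ "1 + \<bar>2 * (e \<bullet> b)\<bar>"]) auto
  from jet2_scale[OF jet2_power[OF this, of j], of "proj_moment2 j e"]
  have 2: "jet2 {()} (\<lambda>s _. proj_moment2 j (e + s *\<^sub>R b)) (\<lambda>_. proj_moment2 j e)
      (\<lambda>_. proj_moment2 j e * (real j * (2 * (e \<bullet> b))))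
      (\<lambda>_. proj_moment2 j e * (real j + real j * (real j - 1) / 2 * (2 * (e \<bullet> b))\<^sup>2))"
  proof (rule jet2_cong)
    fix s :: real
    have "e + s *\<^sub>R b \<in> E" using e b by (simp add: subspace_E subspace_add subspace_scale)
    from proj_moment2_scale[OF e this, of j]
    show "proj_moment2 j e * (1 + 2 * (e \<bullet> b) * s + 1 * s\<^sup>2) ^ j = proj_moment2 j (e + s *\<^sub>R b)"
      using e b by (simp add: power2_norm_eq_inner inner_add_left inner_add_right inner_commute[of b e] norm_eq_1 power2_eq_square[of s] algebra_simps)
  qed auto
  show ?thesis by (rule jet2_unique[OF 1 2])
qed

text \<open>Summing the second variation over an orthonormal basis of E amounts to taking the
  Laplacian. On the left it produces the trace k of the projection and |P_F e|^2; on the right the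
  dimension and |e|^2 = 1. Comparing the two sides at order j + 1 relates consecutive
  moments.\<close>

lemma proj_moment2_rec:
  assumes e: "e \<in> E" "norm e = 1"
  shows "proj_moment2 (Suc j) e * (real CARD('n) + 2 * real j) = proj_moment2 j e * (real k + 2 * real j)"
proof -
  obtain B where B0: "orthonormal B" "E = \<phi> ` span B" "card B = CARD('n)"
    by (rule onb_exists[OF subspace_E order_refl, unfolded dim_E]) auto
  define D where "D = \<phi> ` B"
  have D: "orthonormal D" "span D = E" "card D = CARD('n)"
    using B0 by (auto simp: D_def orthonormal_phi span_phi card_image[OF inj_on_phi])
  have DE: "b \<in> E" "norm b = 1" if "b \<in> D" for b
    using that D span_base[of b D] by (auto simp: orthonormal_def)
  have pars: "(\<Sum>b\<in>D. (x \<bullet> b)\<^sup>2) = (norm x)\<^sup>2" if "x \<in> E" for x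
    using orthonormal_norm_sum[OF D(1), of "\<lambda>b. x \<bullet> b"] orthonormal_span_eq[OF D(1), of x] that D(2) by simp
  have trace: "(\<Sum>b\<in>D. proj_sq F b) = real k" if F: "F \<in> space \<mu>" for F
  proof -
    have FG: "subspace F" "F \<subseteq> E" "dim F = k" using F by (auto simp: space_grassmann_measure grassmannian_def)
    obtain B' where B': "orthonormal B'" "span B' = F" using has_onb_grassmann[OF F] by (auto simp: has_onb_def)
    have "(\<Sum>b\<in>D. proj_sq F b) = (\<Sum>b\<in>D. \<Sum>f\<in>B'. (b \<bullet> f)\<^sup>2)"
      unfolding B'(2)[symmetric] orth_proj_onb[OF B'(1)] orthonormal_norm_sum[OF B'(1)] ..
    also have "\<dots> = (\<Sum>f\<in>B'. \<Sum>b\<in>D. (f \<bullet> b)\<^sup>2)" by (subst sum.swap) (intro sum.cong refl arg_cong[where f="\<lambda>x. x\<^sup>2"] inner_commute)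
    also have "\<dots> = (\<Sum>f\<in>B'. 1)"
    proof (rule sum.cong)
      fix f assume f: "f \<in> B'"
      then have "f \<in> E" "norm f = 1" using B' FG span_base[of f B'] by (auto simp: orthonormal_def)
      then show "(\<Sum>b\<in>D. (f \<bullet> b)\<^sup>2) = 1" using pars by simp
    qed simp
    finally show ?thesis using orthonormal_card[OF B'(1)] B'(2) FG by simp
  qed
  let ?j = "real (Suc j)"
  let ?f = "\<lambda>b F. ?j * proj_sq F e ^ (Suc j - 1) * proj_sq F b
      + ?j * (?j - 1) / 2 * proj_sq F e ^ (Suc j - 2) * (2 * (orth_proj F e \<bullet> b))\<^sup>2"
  have q1: "0 \<le> proj_sq F e \<and> proj_sq F e \<le> 1" if "F \<in> space \<mu>" for F
    using norm_orth_proj_le[OF has_onb_grassmann[OF that], of e] e by (simp add: power_le_one)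
  have int: "integrable \<mu> (?f b)" if b: "b \<in> D" for b
  proof (rule integrable_grassmann)
    show "?f b \<in> borel_measurable \<mu>" by measurable
    fix F assume F: "F \<in> space \<mu>"
    have 1: "proj_sq F b \<le> 1"
      using norm_orth_proj_le[OF has_onb_grassmann[OF F], of b] DE[OF b] by (simp add: power_le_one)
    have "\<bar>orth_proj F e \<bullet> b\<bar> \<le> 1"
      using norm_orth_proj_le[OF has_onb_grassmann[OF F], of e] Cauchy_Schwarz_ineq2[of "orth_proj F e" b] e DE[OF b] by simp
    then have 2: "(orth_proj F e \<bullet> b)\<^sup>2 \<le> 1" by (simp add: abs_square_le_1)
    have qp: "proj_sq F e ^ i \<le> 1" "0 \<le> proj_sq F e ^ i" for i using q1[OF F] by (auto intro: power_le_one)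
    have a: "?j * (proj_sq F e ^ (Suc j - 1) * proj_sq F b) \<le> ?j * (1 * 1)"
      using qp 1 by (intro mult_left_mono mult_mono) auto
    have b: "?j * (?j - 1) / 2 * (proj_sq F e ^ (Suc j - 2) * (2 * (orth_proj F e \<bullet> b))\<^sup>2) \<le> ?j * (?j - 1) / 2 * (1 * 4)"
      using qp 2 by (intro mult_left_mono mult_mono) (auto simp: power_mult_distrib)
    have c: "0 \<le> ?f b F" by (intro add_nonneg_nonneg mult_nonneg_nonneg) auto
    show "\<bar>?f b F\<bar> \<le> ?j * (1 * 1) + ?j * (?j - 1) / 2 * (1 * 4)"
      using a b c by (simp only: abs_of_nonneg mult.assoc)
  qed
  have sumf: "(\<Sum>b\<in>D. ?f b F) = proj_sq F e ^ j * (?j * (real k + 2 * real j))" if F: "F \<in> space \<mu>" for F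
  proof -
    have "orth_proj F e \<in> E" using orth_proj_in[OF has_onb_grassmann[OF F], of e] F
      by (auto simp: space_grassmann_measure grassmannian_def)
    then have "(\<Sum>b\<in>D. (2 * (orth_proj F e \<bullet> b))\<^sup>2) = 4 * proj_sq F e"
      using pars by (simp add: power_mult_distrib flip: sum_distrib_left)
    then have "(\<Sum>b\<in>D. ?f b F) = ?j * proj_sq F e ^ (Suc j - 1) * real k + ?j * (?j - 1) / 2 * proj_sq F e ^ (Suc j - 2) * (4 * proj_sq F e)"
      unfolding sum.distrib sum_distrib_left[symmetric] trace[OF F] by (simp only:)
    also have "\<dots> = proj_sq F e ^ j * (?j * (real k + 2 * real j))"
      \<comment> \<open>For j = 0 the exponent \<open>Suc j - 2\<close> is truncated, but its
        prefactor is 0; otherwise it is j - 1 and combines with the extra factor.\<close>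
      by (cases j) (auto simp: algebra_simps)
    finally show ?thesis .
  qed
  have "proj_moment2 j e * (?j * (real k + 2 * real j)) = (\<integral>F. (\<Sum>b\<in>D. ?f b F) \<partial>\<mu>)"
    unfolding proj_moment2_def by (subst Bochner_Integration.integral_cong[OF refl sumf]) auto
  also have "\<dots> = (\<Sum>b\<in>D. \<integral>F. ?f b F \<partial>\<mu>)" using int by (rule Bochner_Integration.integral_sum)
  also have "\<dots> = (\<Sum>b\<in>D. proj_moment2 (Suc j) e * (?j + ?j * (?j - 1) / 2 * (2 * (e \<bullet> b))\<^sup>2))"
    using DE by (intro sum.cong refl proj_moment2_second_variation[OF e]) auto
  also have "\<dots> = proj_moment2 (Suc j) e * (?j * real CARD('n) + ?j * (?j - 1) / 2 * (4 * (\<Sum>b\<in>D. (e \<bullet> b)\<^sup>2)))"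
    using D(3) by (simp add: sum.distrib power_mult_distrib flip: sum_distrib_left)
  also have "\<dots> = ?j * (proj_moment2 (Suc j) e * (real CARD('n) + 2 * real j))"
    using pars[OF e(1)] e(2) by (simp add: algebra_simps)
  finally have "?j * (proj_moment2 j e * (real k + 2 * real j)) = ?j * (proj_moment2 (Suc j) e * (real CARD('n) + 2 * real j))"
    by (simp add: mult_ac)
  then show ?thesis by simp
qed

text \<open>For 0 < k < n these are the second and fourth moments of the Beta(k/2, (n - k)/2) law of
  |P_F e|^2, obtained here from the recursion alone.\<close>

lemma proj_moments:
  assumes e: "e \<in> E" "norm e = 1"
  defines "n \<equiv> real CARD('n)"
  shows "(\<integral>F. norm (orth_proj F e) ^ 4 \<partial>\<mu>) = real k * (real k + 2) / (n * (n + 2))"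
    and "(\<integral>F. norm (orth_proj F e) ^ 8 \<partial>\<mu>) = real k * (real k + 2) * (real k + 4) * (real k + 6) / (n * (n + 2) * (n + 4) * (n + 6))"
proof -
  interpret prob_space \<mu> by (rule prob_space_grassmann_measure)
  have n: "n > 0" by (simp add: n_def)
  have step: "proj_moment2 (Suc j) e = proj_moment2 j e * ((real k + 2 * real j) / (n + 2 * real j))" for j
  proof -
    have "n + 2 * real j > 0" using n by (simp add: add_pos_nonneg)
    then show ?thesis using proj_moment2_rec[OF e, of j] by (simp add: n_def[symmetric] eq_divide_eq)
  qed
  have "proj_moment2 0 e = 1" by (simp add: proj_moment2_def prob_space)
  then have 1: "proj_moment2 1 e = real k / n" using step[of 0] by simp
  then have 2: "proj_moment2 2 e = real k / n * ((real k + 2) / (n + 2))"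
    using step[of 1] by (simp add: eval_nat_numeral)
  then have 3: "proj_moment2 3 e = real k / n * ((real k + 2) / (n + 2)) * ((real k + 4) / (n + 4))"
    using step[of 2] by (simp add: eval_nat_numeral)
  then have 4: "proj_moment2 4 e = real k / n * ((real k + 2) / (n + 2)) * ((real k + 4) / (n + 4)) * ((real k + 6) / (n + 6))"
    using step[of 3] by (simp add: eval_nat_numeral)
  show "(\<integral>F. norm (orth_proj F e) ^ 4 \<partial>\<mu>) = real k * (real k + 2) / (n * (n + 2))"
    using 2 by (simp add: proj_moment2_def flip: power_mult)
  show "(\<integral>F. norm (orth_proj F e) ^ 8 \<partial>\<mu>) = real k * (real k + 2) * (real k + 4) * (real k + 6) / (n * (n + 2) * (n + 4) * (n + 6))"
    using 4 by (simp add: proj_moment2_def flip: power_mult)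
qed

end

end

section \<open>The perturbed ball\<close>

text \<open>As an intersection of half-spaces it is convex, closed and symmetric at once. What
  remains is that each half-space is tight, so that the prescribed function really is the support
  function.\<close>

definition bump_body :: "'a::real_inner set \<Rightarrow> 'a \<Rightarrow> real \<Rightarrow> 'a set" where
  "bump_body E e t = {x \<in> E. \<forall>u\<in>E. norm u = 1 \<longrightarrow> x \<bullet> u \<le> 1 + t * (u \<bullet> e) ^ 4}"

text \<open>The boundary point with outer normal \<open>u\<close>: the gradient at \<open>u\<close> of the 1-homogeneous
  extension of \<open>1 + t (u \<bullet> e)\<^sup>4\<close>.\<close>

definition bump_point :: "'a::real_inner \<Rightarrow> real \<Rightarrow> 'a \<Rightarrow> 'a" where
  "bump_point e t u = u + t *\<^sub>R ((4 * (u \<bullet> e) ^ 3) *\<^sub>R e - (3 * (u \<bullet> e) ^ 4) *\<^sub>R u)"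

lemma inner_power4_le_1:
  fixes u e :: "'a::real_inner"
  assumes "norm u = 1" "norm e = 1"
  shows "(u \<bullet> e) ^ 4 \<le> 1"
  using Cauchy_Schwarz_ineq2[of u e] power_le_one[of "\<bar>u \<bullet> e\<bar>" 4] assms by simp

text \<open>The slack in direction v splits into two nonnegative parts: (1 - c) (1 - 3 t a^4), and t
  times the remainder b^4 - 4 a^3 b + 3 a^4 = (b - a)^2 (b^2 + 2 a b + 3 a^2) of the tangent to the
  fourth power at a.\<close>

lemma bump_point_in:
  assumes E: "subspace E" and e: "e \<in> E" "norm e = 1" and t: "t \<in> {0..1/6}" and u: "u \<in> E" "norm u = 1"
  shows "bump_point e t u \<in> bump_body E e t"
  unfolding bump_body_def
proof (intro CollectI conjI ballI impI)
  show "bump_point e t u \<in> E"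
    unfolding bump_point_def using E e u by (intro subspace_add subspace_scale subspace_diff)
  fix v assume v: "v \<in> E" "norm v = 1"
  define a b c where "a = u \<bullet> e" and "b = v \<bullet> e" and "c = u \<bullet> v"
  have a4: "a ^ 4 \<le> 1" unfolding a_def by (rule inner_power4_le_1[OF u(2) e(2)])
  have c1: "c \<le> 1" using norm_cauchy_schwarz[of u v] u v by (simp add: c_def)
  have "3 * t * a ^ 4 \<le> 1 / 2 * 1" using t a4 by (intro mult_mono) auto
  then have "0 \<le> (1 - c) * (1 - 3 * t * a ^ 4)" using c1 by (intro mult_nonneg_nonneg) auto
  moreover have "0 \<le> b\<^sup>2 + 2 * a * b + 3 * a\<^sup>2"
  proof -
    have "b\<^sup>2 + 2 * a * b + 3 * a\<^sup>2 = (a + b)\<^sup>2 + 2 * a\<^sup>2" by algebra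
    moreover have "0 \<le> (a + b)\<^sup>2 + 2 * a\<^sup>2" by simp
    ultimately show ?thesis by (simp only:)
  qed
  then have "0 \<le> t * ((b - a)\<^sup>2 * (b\<^sup>2 + 2 * a * b + 3 * a\<^sup>2))" using t by simp
  moreover have "1 + t * b ^ 4 - (c + t * (4 * a ^ 3 * b - 3 * a ^ 4 * c))
     = (1 - c) * (1 - 3 * t * a ^ 4) + t * ((b - a)\<^sup>2 * (b\<^sup>2 + 2 * a * b + 3 * a\<^sup>2))" by algebra
  moreover have "bump_point e t u \<bullet> v = c + t * (4 * a ^ 3 * b - 3 * a ^ 4 * c)"
    by (simp add: bump_point_def a_def b_def c_def inner_add_left inner_diff_left inner_commute[of e])
  ultimately show "bump_point e t u \<bullet> v \<le> 1 + t * (v \<bullet> e) ^ 4" by (simp add: b_def)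
qed

lemma support_fun_bump_body:
  assumes E: "subspace E" and e: "e \<in> E" "norm e = 1" and t: "t \<in> {0..1/6}" and u: "u \<in> E" "norm u = 1"
  shows "support_fun (bump_body E e t) u = 1 + t * (u \<bullet> e) ^ 4"
  unfolding support_fun_def
proof (rule cSup_eq_maximum)
  have "bump_point e t u \<bullet> u = 1 + t * (u \<bullet> e) ^ 4"
    using u by (simp add: bump_point_def inner_add_left inner_diff_left norm_eq_1 inner_commute[of e] power_numeral_reduce algebra_simps)
  then show "1 + t * (u \<bullet> e) ^ 4 \<in> (\<lambda>x. x \<bullet> u) ` bump_body E e t"
    using bump_point_in[OF assms] by (metis image_eqI)
qed (use u in \<open>auto simp: bump_body_def\<close>)

lemma norm_bump_body_le:
  assumes E: "subspace E" and e: "norm e = 1" and t: "t \<ge> 0" and x: "x \<in> bump_body E e t"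
  shows "norm x \<le> 1 + t"
proof (cases "x = 0")
  case False
  let ?u = "sgn x"
  have u: "?u \<in> E" "norm ?u = 1" using x E False by (auto simp: bump_body_def sgn_div_norm subspace_scale)
  have "t * (?u \<bullet> e) ^ 4 \<le> t * 1" using inner_power4_le_1[OF u(2) e] t by (rule mult_left_mono)
  moreover have "x \<bullet> ?u \<le> 1 + t * (?u \<bullet> e) ^ 4" using x u by (auto simp: bump_body_def)
  moreover have "x \<bullet> ?u = norm x" using False by (simp add: sgn_div_norm dot_square_norm power2_eq_square)
  ultimately show ?thesis by simp
qed (use t in simp)

lemma bump_body_convex: "convex (bump_body E e t)" if "subspace E"
proof (rule convexI)
  fix x y and u v :: real assume x: "x \<in> bump_body E e t" and y: "y \<in> bump_body E e t" and uv: "0 \<le> u" "0 \<le> v" "u + v = 1"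
  have "(u *\<^sub>R x + v *\<^sub>R y) \<bullet> w \<le> 1 + t * (w \<bullet> e) ^ 4" if w: "w \<in> E" "norm w = 1" for w
  proof -
    have "u * (x \<bullet> w) + v * (y \<bullet> w) \<le> u * (1 + t * (w \<bullet> e) ^ 4) + v * (1 + t * (w \<bullet> e) ^ 4)"
      using x y w uv by (intro add_mono mult_left_mono) (auto simp: bump_body_def)
    also have "\<dots> = 1 + t * (w \<bullet> e) ^ 4" using uv by (simp flip: distrib_right)
    finally show ?thesis by (simp add: inner_add_left)
  qed
  then show "u *\<^sub>R x + v *\<^sub>R y \<in> bump_body E e t"
    using x y that by (auto simp: bump_body_def subspace_add subspace_scale)
qed

lemma bump_body_symmetric:
  assumes "subspace E"
  shows "origin_symmetric (bump_body E e t)"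
proof -
  have m: "- x \<in> bump_body E e t" if "x \<in> bump_body E e t" for x
    unfolding bump_body_def
  proof (intro CollectI conjI ballI impI)
    show "- x \<in> E" using that assms by (auto simp: bump_body_def subspace_neg)
    fix u assume u: "u \<in> E" "norm u = 1"
    then have "- u \<in> E" "norm (- u) = 1" using assms by (auto simp: subspace_neg)
    then have "x \<bullet> (- u) \<le> 1 + t * ((- u) \<bullet> e) ^ 4" using that by (auto simp: bump_body_def)
    then show "- x \<bullet> u \<le> 1 + t * (u \<bullet> e) ^ 4" by simp
  qed
  then show ?thesis unfolding origin_symmetric_def by (metis image_iff add.inverse_inverse subsetI subset_antisym image_subsetI)
qed

lemma cball_subset_bump_body:
  assumes "t \<ge> 0"
  shows "cball 0 1 \<inter> E \<subseteq> bump_body E e t"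
proof
  fix x assume x: "x \<in> cball 0 1 \<inter> E"
  have "x \<bullet> u \<le> 1 + t * (u \<bullet> e) ^ 4" if "norm u = 1" for u
  proof -
    have "x \<bullet> u \<le> norm x * norm u" by (rule norm_cauchy_schwarz)
    also have "\<dots> \<le> 1" using x that by simp
    also have "\<dots> \<le> 1 + t * (u \<bullet> e) ^ 4" using assms by simp
    finally show ?thesis .
  qed
  then show "x \<in> bump_body E e t" using x by (auto simp: bump_body_def)
qed

lemma bump_body_0:
  assumes E: "subspace E" and e: "norm e = 1"
  shows "bump_body E e 0 = cball 0 1 \<inter> E"
  using norm_bump_body_le[OF E e, of 0] cball_subset_bump_body[of 0 E e]
  by (auto simp: bump_body_def)

text \<open>The extension constant along rays is 1 + t (y \<bullet> e)^4 / (y \<bullet> y)^2, a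
  rational function away from 0. On tangent vectors v at u the curvature form is 12 t (u \<bullet>
  e)^2 (v \<bullet> e)^2 + (1 - 3 t (u \<bullet> e)^4) |v|^2, positive because 3 t is at most
  1/2.\<close>

lemma C2_plus_bump:
  fixes e :: "'b::real_inner"
  assumes e: "norm e = 1" and t: "t \<in> {0..1/6}"
    and h: "\<And>u. norm u = 1 \<Longrightarrow> support_fun K u = 1 + t * (u \<bullet> e) ^ 4"
  shows "C2_plus UNIV K"
proof -
  \<comment> \<open>The gradient is \<alpha> x e - \<beta> x x; the primed functions are the
    derivatives of these coefficients, all instances of \<open>quot\<close>.\<close>
  define \<alpha> where "\<alpha> x = 4 * t * ((x \<bullet> e) ^ 3 / (x \<bullet> x)\<^sup>2)" for x
  define \<beta> where "\<beta> x = 4 * t * ((x \<bullet> e) ^ 4 / (x \<bullet> x) ^ 3)" for x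
  define \<alpha>' where "\<alpha>' x v = 4 * t * (3 * (x \<bullet> e)\<^sup>2 * (v \<bullet> e) / (x \<bullet> x)\<^sup>2 - 4 * (x \<bullet> e) ^ 3 * (x \<bullet> v) / (x \<bullet> x) ^ 3)" for x v
  define \<beta>' where "\<beta>' x v = 4 * t * (4 * (x \<bullet> e) ^ 3 * (v \<bullet> e) / (x \<bullet> x) ^ 3 - 6 * (x \<bullet> e) ^ 4 * (x \<bullet> v) / (x \<bullet> x) ^ 4)" for x v
  define G where "G x = \<alpha> x *\<^sub>R e - \<beta> x *\<^sub>R x" for x
  define H where "H x v = \<alpha>' x v *\<^sub>R e - (\<beta> x *\<^sub>R v + \<beta>' x v *\<^sub>R x)" for x v
  have quot: "((\<lambda>y. (y \<bullet> e) ^ i / (y \<bullet> y) ^ j) has_derivative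
      (\<lambda>v. real i * (x \<bullet> e) ^ (i - 1) * (v \<bullet> e) / (x \<bullet> x) ^ j - 2 * real j * (x \<bullet> e) ^ i * (x \<bullet> v) / (x \<bullet> x) ^ (j + 1))) (at x)"
    if x: "x \<noteq> 0" for x :: 'b and i j
  proof -
    let ?p = "x \<bullet> e" and ?D = "x \<bullet> x"
    have D: "?D \<noteq> 0" using x by simp
    have d1: "((\<lambda>y. (y \<bullet> e) ^ i) has_derivative (\<lambda>v. real i * (v \<bullet> e) * ?p ^ (i - 1))) (at x)"
      by (auto intro!: derivative_eq_intros)
    have d2: "((\<lambda>y. (y \<bullet> y) ^ j) has_derivative (\<lambda>v. real j * (2 * (x \<bullet> v)) * ?D ^ (j - 1))) (at x)"
      by (auto intro!: derivative_eq_intros simp: inner_commute)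
    have "?D ^ j \<noteq> 0" using D by simp
    from has_derivative_divide'[OF d1 d2 this]
    show ?thesis
    proof (rule has_derivative_eq_rhs, intro ext)
      fix v
      have p: "real j * ?D ^ (j - 1) * ?D ^ (j + 1) = real j * (?D ^ j * ?D ^ j)"
        by (cases j) auto
      have "(real i * (v \<bullet> e) * ?p ^ (i - 1) * ?D ^ j - ?p ^ i * (real j * (2 * (x \<bullet> v)) * ?D ^ (j - 1))) / (?D ^ j * ?D ^ j)
         = real i * (v \<bullet> e) * ?p ^ (i - 1) / ?D ^ j - 2 * ?p ^ i * (x \<bullet> v) * (real j * ?D ^ (j - 1) / (?D ^ j * ?D ^ j))"
        using D by (simp add: diff_divide_distrib)
      also have "real j * ?D ^ (j - 1) / (?D ^ j * ?D ^ j) = real j / ?D ^ (j + 1)"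
        using D p by (simp add: frac_eq_eq)
      finally show "(real i * (v \<bullet> e) * ?p ^ (i - 1) * ?D ^ j - ?p ^ i * (real j * (2 * (x \<bullet> v)) * ?D ^ (j - 1))) / (?D ^ j * ?D ^ j)
        = real i * ?p ^ (i - 1) * (v \<bullet> e) / ?D ^ j - 2 * real j * ?p ^ i * (x \<bullet> v) / ?D ^ (j + 1)"
        by (simp add: mult_ac)
    qed
  qed
  have d\<alpha>: "(\<alpha> has_derivative \<alpha>' x) (at x)" and d\<beta>: "(\<beta> has_derivative \<beta>' x) (at x)" if "x \<noteq> 0" for x
  proof -
    show "(\<alpha> has_derivative \<alpha>' x) (at x)"
      using has_derivative_mult_right[OF quot[OF that, of 3 2], of "4 * t"]
      unfolding \<alpha>_def[abs_def] by (rule has_derivative_eq_rhs) (simp add: \<alpha>'_def fun_eq_iff)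
    show "(\<beta> has_derivative \<beta>' x) (at x)"
      using has_derivative_mult_right[OF quot[OF that, of 4 3], of "4 * t"]
      unfolding \<beta>_def[abs_def] by (rule has_derivative_eq_rhs) (simp add: \<beta>'_def fun_eq_iff)
  qed
  have dG: "(G has_derivative H x) (at x)" if "x \<noteq> 0" for x
    unfolding G_def[abs_def] H_def[abs_def]
    by (auto intro!: derivative_eq_intros d\<alpha>[OF that] d\<beta>[OF that])
  have df: "((\<lambda>y. support_fun K (sgn y)) has_derivative (\<lambda>v. G x \<bullet> v)) (at x)" if x: "x \<noteq> 0" for x
  proof (rule has_derivative_transform_within_open[of "\<lambda>y. 1 + t * ((y \<bullet> e) ^ 4 / (y \<bullet> y)\<^sup>2)" _ _ _ "- {0}"])
    have "((\<lambda>y. 1 + t * ((y \<bullet> e) ^ 4 / (y \<bullet> y)\<^sup>2)) has_derivative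
       (\<lambda>v. 0 + t * (real 4 * (x \<bullet> e) ^ (4 - 1) * (v \<bullet> e) / (x \<bullet> x)\<^sup>2 - 2 * real 2 * (x \<bullet> e) ^ 4 * (x \<bullet> v) / (x \<bullet> x) ^ (2 + 1)))) (at x)"
      by (intro has_derivative_add has_derivative_const has_derivative_mult_right quot[OF x])
    then show "((\<lambda>y. 1 + t * ((y \<bullet> e) ^ 4 / (y \<bullet> y)\<^sup>2)) has_derivative (\<lambda>v. G x \<bullet> v)) (at x)"
      by (rule has_derivative_eq_rhs)
        (simp add: fun_eq_iff G_def \<alpha>_def \<beta>_def inner_diff_left inner_commute[of e] power3_eq_cube algebra_simps)
    fix y :: 'b assume "y \<in> - {0}"
    then have y: "y \<noteq> 0" by simp
    then have "support_fun K (sgn y) = 1 + t * (sgn y \<bullet> e) ^ 4" by (intro h) (simp add: norm_sgn)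
    also have "(sgn y \<bullet> e) ^ 4 = (y \<bullet> e) ^ 4 / norm y ^ 4"
      by (simp add: sgn_div_norm power_mult_distrib divide_inverse power_inverse mult.commute)
    also have "norm y ^ 4 = (y \<bullet> y)\<^sup>2" by (simp add: dot_square_norm flip: power_mult)
    finally show "1 + t * ((y \<bullet> e) ^ 4 / (y \<bullet> y)\<^sup>2) = support_fun K (sgn y)" by simp
  qed (use x in auto)
  show ?thesis
    unfolding C2_plus_def sphere_grad_hess_def
  proof (intro exI[of _ G] exI[of _ H] conjI ballI impI)
    fix x :: 'b assume "x \<in> UNIV - {0}"
    then have x: "x \<noteq> 0" by simp
    show "((\<lambda>y. support_fun K (sgn y)) has_derivative (\<lambda>v. G x \<bullet> v)) (at x)" by (rule df[OF x])
    show "(G has_derivative H x) (at x)" by (rule dG[OF x])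
  next
    fix v :: 'b show "continuous_on (UNIV - {0}) (\<lambda>x. H x v)"
      unfolding H_def \<alpha>'_def \<beta>'_def \<beta>_def by (intro continuous_intros) auto
  next
    fix u v :: 'b assume u: "norm u = 1" and v: "v \<bullet> u = 0 \<and> v \<noteq> 0"
    have uu: "u \<bullet> u = 1" "u \<bullet> v = 0" using u v by (auto simp: norm_eq_1 inner_commute)
    note a4 = inner_power4_le_1[OF u e]
    have "H u v \<bullet> v + support_fun K u * (v \<bullet> v) = 12 * t * ((u \<bullet> e) * (v \<bullet> e))\<^sup>2 + (1 - 3 * t * (u \<bullet> e) ^ 4) * (v \<bullet> v)"
      unfolding h[OF u] H_def \<alpha>'_def \<beta>'_def \<beta>_def
      by (simp add: uu inner_diff_left inner_add_left inner_commute[of e] power_mult_distrib) (simp add: algebra_simps power2_eq_square)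
    moreover have "3 * t * (u \<bullet> e) ^ 4 \<le> 1/2 * 1" using t a4 by (intro mult_mono) auto
    then have "0 < (1 - 3 * t * (u \<bullet> e) ^ 4) * (v \<bullet> v)" using v by (intro mult_pos_pos) auto
    moreover have "0 \<le> 12 * t * ((u \<bullet> e) * (v \<bullet> e))\<^sup>2" using t by simp
    ultimately show "0 < H u v \<bullet> v + support_fun K u * (v \<bullet> v)" by linarith
  qed auto
qed

section \<open>Volumes of projections of the perturbed ball\<close>

lemma slice_height_le:
  assumes \<tau>: "\<tau> \<in> {0..1/6}" and z: "\<bar>z\<bar> \<le> 1"
  shows "\<bar>slice_height \<tau> z\<bar> \<le> 1 + \<tau>"
proof -
  have mono: "slice_height \<tau> x \<le> slice_height \<tau> y" if "-1 \<le> x" "x \<le> y" "y \<le> 1" for x y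
  proof (rule DERIV_nonneg_imp_nondecreasing[OF that(2)])
    fix w assume "x \<le> w" "w \<le> y"
    then have "slice_height' \<tau> w \<ge> 1 - 3 * \<tau>" using that \<tau> by (intro slice_height'_ge) auto
    then have "slice_height' \<tau> w \<ge> 0" using \<tau> by simp
    then show "\<exists>d. (slice_height \<tau> has_real_derivative d) (at w) \<and> 0 \<le> d" using slice_height_deriv by blast
  qed
  show ?thesis using mono[of "-1" z] mono[of z 1] z by (auto simp: slice_height_1 abs_le_iff)
qed

context linear_isometry
begin

text \<open>Closed and bounded suffices only in finite dimension, so the argument runs on the
  preimage under \<phi>.\<close>

lemma compact_bump_body:
  assumes e: "norm e = 1" and t: "t \<ge> 0"
  shows "compact (bump_body E e t)"
proof -
  let ?K = "\<phi> -` bump_body E e t"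
  have "?K = (\<Inter>u\<in>{u \<in> E. norm u = 1}. {y. \<phi> y \<bullet> u \<le> 1 + t * (u \<bullet> e) ^ 4})"
    by (auto simp: bump_body_def)
  also have "closed \<dots>"
    by (intro closed_INT ballI closed_Collect_le continuous_intros continuous_phi)
  finally have "closed ?K" .
  moreover have "bounded ?K"
    unfolding bounded_iff using norm_bump_body_le[OF subspace_E e t] norm_phi by (metis vimageE)
  ultimately have "compact ?K" by (simp add: compact_eq_bounded_closed)
  then have "compact (\<phi> ` ?K)" by (rule compact_phi_image)
  also have "\<phi> ` ?K = bump_body E e t" by (rule phi_image_vimage) (auto simp: bump_body_def)
  finally show ?thesis .
qed

lemma convex_body_bump:
  assumes e: "norm e = 1" and t: "t \<ge> 0"
  shows "convex_body_in E (bump_body E e t)"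
  unfolding convex_body_in_def
proof (intro conjI compact_bump_body[OF e t] bump_body_convex[OF subspace_E])
  have "openin (top_of_set E) (E \<inter> ball 0 1)" by (simp add: openin_open_Int)
  moreover have "E \<inter> ball 0 1 \<subseteq> bump_body E e t" using cball_subset_bump_body[OF t, of E e] by force
  moreover have "0 \<in> E \<inter> ball 0 1" using subspace_E by (simp add: subspace_0)
  ultimately show "top_of_set E interior_of bump_body E e t \<noteq> {}"
    unfolding interior_of_def by blast
qed (auto simp: bump_body_def)

text \<open>The projection is pinned from two sides: \<open>upper\<close> gives the half-space
  inequalities it inherits, \<open>point\<close> gives boundary points it contains, and convexity
  fills in between. The slices follow from these facts.\<close>

lemma vol_proj_bump_body:
  assumes F: "F \<in> grassmannian E k" and k: "k \<ge> 1" and e: "e \<in> E" "norm e = 1" and t: "t \<in> {0..1/6}"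
  shows "vol F (orth_proj F ` bump_body E e t)
    = unit_ball_vol (real (k - 1)) * profile k (t * norm (orth_proj F e) ^ 4)"
proof -
  let ?P = "orth_proj F" and ?K = "bump_body E e t"
  define a where "a = norm (?P e)"
  define \<tau> where "\<tau> = t * a ^ 4"
  have FE: "subspace F" "F \<subseteq> E" "dim F = k" using F by (auto simp: grassmannian_def)
  have o: "has_onb F" by (rule grassmannian_has_onb[OF F])
  have a: "0 \<le> a" "a \<le> 1" using norm_orth_proj_le[OF o, of e] e by (auto simp: a_def)
  then have "t * a ^ 4 \<le> t * 1" using t by (intro mult_left_mono power_le_one) auto
  then have \<tau>: "\<tau> \<in> {0..1/6}" using t a by (auto simp: \<tau>_def)
  \<comment> \<open>If the projection of e vanishes, then \<tau> = 0 and any unit vector of F can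
    serve as the axis.\<close>
  obtain f where f: "f \<in> F" "norm f = 1" "?P e = a *\<^sub>R f"
  proof (cases "?P e = 0")
    case False
    then show thesis using orth_proj_in[OF o, of e] FE
      by (intro that[of "?P e /\<^sub>R a"]) (auto simp: a_def subspace_scale)
  next
    case True
    obtain B where B: "orthonormal B" "span B = F" using o by (auto simp: has_onb_def)
    then have "card B = k" using orthonormal_card[OF B(1)] FE by simp
    then obtain f where "f \<in> B" using k by (metis card.empty ex_in_conv not_one_le_zero)
    then show thesis using True B span_base[of f B] by (intro that[of f]) (auto simp: a_def orthonormal_def)
  qed
  have ue: "u \<bullet> e = a * (u \<bullet> f)" if "u \<in> F" for u
    using orth_proj_inner[OF o that, of e] f(3) by (simp add: inner_commute)
  have ff: "f \<bullet> f = 1" using f by (simp add: norm_eq_1)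
  let ?A = "?P ` ?K"
  have upper: "y \<in> F \<and> (\<forall>u\<in>F. norm u = 1 \<longrightarrow> y \<bullet> u \<le> 1 + \<tau> * (u \<bullet> f) ^ 4)" if y: "y \<in> ?A" for y
  proof -
    from y obtain x where x: "x \<in> ?K" "y = ?P x" by auto
    have "y \<bullet> u \<le> 1 + \<tau> * (u \<bullet> f) ^ 4" if u: "u \<in> F" "norm u = 1" for u
    proof -
      have "y \<bullet> u = x \<bullet> u" using orth_proj_inner[OF o u(1)] x by simp
      also have "\<dots> \<le> 1 + t * (u \<bullet> e) ^ 4" using x u FE by (auto simp: bump_body_def)
      finally show ?thesis using ue[OF u(1)] by (simp add: \<tau>_def power_mult_distrib mult.assoc)
    qed
    then show ?thesis using x orth_proj_in[OF o] by auto
  qed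
  \<comment> \<open>Boundary points whose normal u lies in F project to boundary points of the same
    form, with e replaced by f and t by \<tau>.\<close>
  have point: "u + \<tau> *\<^sub>R ((4 * (u \<bullet> f) ^ 3) *\<^sub>R f - (3 * (u \<bullet> f) ^ 4) *\<^sub>R u) \<in> ?A" if u: "u \<in> F" "norm u = 1" for u
  proof -
    have "?P (bump_point e t u) = u + t *\<^sub>R ((4 * (u \<bullet> e) ^ 3) *\<^sub>R (a *\<^sub>R f) - (3 * (u \<bullet> e) ^ 4) *\<^sub>R u)"
      using linear_orth_proj[OF o] orth_proj_id[OF o u(1)] f(3)
      by (simp add: bump_point_def linear_add linear_diff linear_cmul)
    also have "\<dots> = u + \<tau> *\<^sub>R ((4 * (u \<bullet> f) ^ 3) *\<^sub>R f - (3 * (u \<bullet> f) ^ 4) *\<^sub>R u)"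
    proof -
      have "t * (4 * (a * (u \<bullet> f)) ^ 3 * a) = \<tau> * (4 * (u \<bullet> f) ^ 3)" "t * (3 * (a * (u \<bullet> f)) ^ 4) = \<tau> * (3 * (u \<bullet> f) ^ 4)"
        unfolding \<tau>_def by algebra+
      then show ?thesis unfolding ue[OF u(1)] by (simp only: scaleR_diff_right scaleR_scaleR)
    qed
    finally show ?thesis using bump_point_in[OF subspace_E e t, of u] u FE by (metis image_eqI subsetD)
  qed
  have conv: "convex ?A" using bump_body_convex[OF subspace_E] linear_orth_proj[OF o] by (intro convex_linear_image)
  have "bounded_linear ?P"
    by (rule bounded_linear_intro[where K = 1])
      (use linear_orth_proj[OF o] norm_orth_proj_le[OF o] in \<open>auto simp: linear_add linear_cmul\<close>)
  then have "compact ?A"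
    using compact_bump_body[OF e(2), of t] t by (intro compact_continuous_image linear_continuous_on) auto
  then have Ab: "?A \<in> sets borel" by (rule borel_compact)
  have slice: "slice_height \<tau> z *\<^sub>R f + w \<in> ?A \<longleftrightarrow> norm w \<le> slice_radius \<tau> z"
    if z: "\<bar>z\<bar> < 1" and w: "w \<in> F" "w \<bullet> f = 0" for z w
  proof -
    define s where "s = sqrt (1 - z\<^sup>2)"
    have z2: "z\<^sup>2 < 1" using z by (simp add: abs_square_less_1)
    then have s: "s > 0" "s\<^sup>2 = 1 - z\<^sup>2" by (auto simp: s_def)
    define c where "c = 1 - 3 * \<tau> * z ^ 4"
    have "c \<ge> 1 - 3 * \<tau>" unfolding c_def using \<tau> z by (intro slice_radius_factor_ge) auto
    then have c: "c > 0" using \<tau> by auto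
    have r: "slice_radius \<tau> z = c * s" by (simp add: slice_radius_def c_def s_def)
    then have r0: "slice_radius \<tau> z > 0" using c s by simp
    have u: "z *\<^sub>R f + q *\<^sub>R \<omega> \<in> F \<and> norm (z *\<^sub>R f + q *\<^sub>R \<omega>) = 1 \<and> (z *\<^sub>R f + q *\<^sub>R \<omega>) \<bullet> f = z"
      if "\<omega> \<in> F" "norm \<omega> = 1" "\<omega> \<bullet> f = 0" "q\<^sup>2 = 1 - z\<^sup>2" for \<omega> q
    proof -
      have "(norm (z *\<^sub>R f + q *\<^sub>R \<omega>))\<^sup>2 = 1"
        using that ff by (simp add: power2_norm_eq_inner inner_add_left inner_add_right inner_commute[of f \<omega>] norm_eq_1 flip: power2_eq_square)
      then have "norm (z *\<^sub>R f + q *\<^sub>R \<omega>) = 1" by (metis abs_norm_cancel one_power2 power2_eq_iff_nonneg norm_ge_zero zero_le_one)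
      then show ?thesis using that FE f ff by (simp add: subspace_add subspace_scale inner_add_left)
    qed
    show ?thesis
    proof (cases "w = 0")
      case True
      \<comment> \<open>On the axis there is no direction orthogonal to f to work with (for k = 1
        none exists), so the point is placed on the segment between the two poles.\<close>
      have "f + \<tau> *\<^sub>R ((4 * (f \<bullet> f) ^ 3) *\<^sub>R f - (3 * (f \<bullet> f) ^ 4) *\<^sub>R f) = (1 + \<tau>) *\<^sub>R f"
        by (simp add: ff scaleR_add_left flip: scaleR_diff_left)
      then have pf: "(1 + \<tau>) *\<^sub>R f \<in> ?A" using point[OF f(1,2)] by simp
      have "(4 * ((- f) \<bullet> f) ^ 3) *\<^sub>R f - (3 * ((- f) \<bullet> f) ^ 4) *\<^sub>R (- f) = - f"
        by (simp add: ff flip: scaleR_diff_left)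
      then have mf: "- ((1 + \<tau>) *\<^sub>R f) \<in> ?A"
        using point[of "- f"] f FE by (simp add: subspace_neg scaleR_add_left)
      define \<theta> where "\<theta> = (1 + slice_height \<tau> z / (1 + \<tau>)) / 2"
      have \<tau>1: "1 + \<tau> > 0" using \<tau> by auto
      have "\<bar>slice_height \<tau> z\<bar> \<le> 1 + \<tau>" using slice_height_le[OF \<tau>, of z] z by simp
      then have l: "0 \<le> \<theta>" "\<theta> \<le> 1" using \<tau>1 by (auto simp: \<theta>_def field_simps abs_le_iff)
      have "(1 - \<theta>) *\<^sub>R (- ((1 + \<tau>) *\<^sub>R f)) + \<theta> *\<^sub>R ((1 + \<tau>) *\<^sub>R f) = ((2 * \<theta> - 1) * (1 + \<tau>)) *\<^sub>R f"
      proof -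
        have "(1 - \<theta>) *\<^sub>R (- ((1 + \<tau>) *\<^sub>R f)) + \<theta> *\<^sub>R ((1 + \<tau>) *\<^sub>R f)
          = ((1 - \<theta>) * - (1 + \<tau>) + \<theta> * (1 + \<tau>)) *\<^sub>R f"
          by (simp only: scaleR_add_left[of "(1 - \<theta>) * - (1 + \<tau>)"] scaleR_scaleR scaleR_minus_left[symmetric])
        also have "(1 - \<theta>) * - (1 + \<tau>) + \<theta> * (1 + \<tau>) = (2 * \<theta> - 1) * (1 + \<tau>)" by algebra
        finally show ?thesis .
      qed
      also have "(2 * \<theta> - 1) * (1 + \<tau>) = slice_height \<tau> z" using \<tau>1 by (simp add: \<theta>_def field_simps)
      finally have "slice_height \<tau> z *\<^sub>R f \<in> ?A"
        using convexD_alt[OF conv mf pf l] by simp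
      then show ?thesis using True r0 by simp
    next
      case False
      define \<omega> where "\<omega> = w /\<^sub>R norm w"
      have \<omega>: "\<omega> \<in> F" "norm \<omega> = 1" "\<omega> \<bullet> f = 0" "w = norm w *\<^sub>R \<omega>"
        using w False FE by (auto simp: \<omega>_def subspace_scale)
      have up: "z *\<^sub>R f + s *\<^sub>R \<omega> \<in> F" "norm (z *\<^sub>R f + s *\<^sub>R \<omega>) = 1" "(z *\<^sub>R f + s *\<^sub>R \<omega>) \<bullet> f = z"
        using u[OF \<omega>(1-3) s(2)] by auto
      have um: "z *\<^sub>R f + (- s) *\<^sub>R \<omega> \<in> F" "norm (z *\<^sub>R f + (- s) *\<^sub>R \<omega>) = 1" "(z *\<^sub>R f + (- s) *\<^sub>R \<omega>) \<bullet> f = z"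
        using u[OF \<omega>(1-3), of "- s"] s(2) by auto
      have pt: "(z *\<^sub>R f + q *\<^sub>R \<omega>) + \<tau> *\<^sub>R ((4 * z ^ 3) *\<^sub>R f - (3 * z ^ 4) *\<^sub>R (z *\<^sub>R f + q *\<^sub>R \<omega>))
          = slice_height \<tau> z *\<^sub>R f + (c * q) *\<^sub>R \<omega>" for q
      proof -
        have "(z *\<^sub>R f + q *\<^sub>R \<omega>) + \<tau> *\<^sub>R ((4 * z ^ 3) *\<^sub>R f - (3 * z ^ 4) *\<^sub>R (z *\<^sub>R f + q *\<^sub>R \<omega>))
          = (z + \<tau> * (4 * z ^ 3) - \<tau> * ((3 * z ^ 4) * z)) *\<^sub>R f + (q - \<tau> * ((3 * z ^ 4) * q)) *\<^sub>R \<omega>"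
          by (simp only: scaleR_add_left scaleR_diff_left scaleR_add_right scaleR_diff_right scaleR_scaleR) simp
        also have "z + \<tau> * (4 * z ^ 3) - \<tau> * ((3 * z ^ 4) * z) = slice_height \<tau> z" unfolding slice_height_def by algebra
        also have "q - \<tau> * ((3 * z ^ 4) * q) = c * q" unfolding c_def by algebra
        finally show ?thesis .
      qed
      show ?thesis
      proof
        assume "norm w \<le> slice_radius \<tau> z"
        \<comment> \<open>The normals z f + s \<omega> and z f - s \<omega> give two boundary points
          at the same height on opposite sides of the axis; \<open>\<theta>\<close> is the weight
          that places w between them.\<close>
        define \<theta> where "\<theta> = (1 + norm w / slice_radius \<tau> z) / 2"
        have "norm w / slice_radius \<tau> z \<le> 1" "0 \<le> norm w / slice_radius \<tau> z"
          using r0 \<open>norm w \<le> slice_radius \<tau> z\<close> by auto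
        then have l: "0 \<le> \<theta>" "\<theta> \<le> 1" by (auto simp: \<theta>_def)
        have A1: "slice_height \<tau> z *\<^sub>R f + (c * s) *\<^sub>R \<omega> \<in> ?A" using point[OF up(1,2)] up(3) pt[of s] by simp
        have A2: "slice_height \<tau> z *\<^sub>R f + (c * (- s)) *\<^sub>R \<omega> \<in> ?A" using point[OF um(1,2)] um(3) pt[of "- s"] by simp
        have "(1 - \<theta>) *\<^sub>R (slice_height \<tau> z *\<^sub>R f + (c * (- s)) *\<^sub>R \<omega>) + \<theta> *\<^sub>R (slice_height \<tau> z *\<^sub>R f + (c * s) *\<^sub>R \<omega>)
            = slice_height \<tau> z *\<^sub>R f + ((2 * \<theta> - 1) * (c * s)) *\<^sub>R \<omega>"
        proof -
          have "(1 - \<theta>) *\<^sub>R (x + (c * (- s)) *\<^sub>R \<omega>) + \<theta> *\<^sub>R (x + (c * s) *\<^sub>R \<omega>)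
             = ((1 - \<theta>) + \<theta>) *\<^sub>R x + ((1 - \<theta>) * (c * (- s)) + \<theta> * (c * s)) *\<^sub>R \<omega>" for x
            by (simp only: scaleR_add_right scaleR_add_left scaleR_scaleR) simp
          moreover have "(1 - \<theta>) * (c * (- s)) + \<theta> * (c * s) = (2 * \<theta> - 1) * (c * s)" by algebra
          ultimately show ?thesis by (simp only:) simp
        qed
        also have "(2 * \<theta> - 1) * (c * s) = norm w" using r0 unfolding r[symmetric] by (simp add: \<theta>_def field_simps)
        also have "norm w *\<^sub>R \<omega> = w" using \<omega>(4) by simp
        finally show "slice_height \<tau> z *\<^sub>R f + w \<in> ?A" using convexD_alt[OF conv A2 A1 l] by simp
      next
        assume "slice_height \<tau> z *\<^sub>R f + w \<in> ?A"
        \<comment> \<open>Testing against the normal z f + s \<omega> is sharp: equality holds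
          exactly when w has length \<open>slice_radius\<close>.\<close>
        then have "(slice_height \<tau> z *\<^sub>R f + w) \<bullet> (z *\<^sub>R f + s *\<^sub>R \<omega>) \<le> 1 + \<tau> * z ^ 4"
          using upper up by metis
        moreover have "(slice_height \<tau> z *\<^sub>R f + w) \<bullet> (z *\<^sub>R f + s *\<^sub>R \<omega>) = slice_height \<tau> z * z + norm w * s"
        proof -
          have "w \<bullet> \<omega> = norm w" using False by (simp add: \<omega>_def dot_square_norm power2_eq_square)
          then show ?thesis using w \<omega>(3) ff by (simp add: inner_add_left inner_add_right inner_commute[of f \<omega>])
        qed
        moreover have "slice_height \<tau> z * z + (c * s) * s = 1 + \<tau> * z ^ 4"
          using s(2) unfolding slice_height_def c_def by algebra
        ultimately have "norm w * s \<le> (c * s) * s" by linarith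
        then show "norm w \<le> slice_radius \<tau> z" using s(1) r by simp
      qed
    qed
  qed
  have bound: "\<bar>z\<bar> \<le> 1 + \<tau>" if "z *\<^sub>R f + w \<in> ?A" "w \<bullet> f = 0" for z w
  proof -
    have "(z *\<^sub>R f + w) \<bullet> f \<le> 1 + \<tau> * (f \<bullet> f) ^ 4" "(z *\<^sub>R f + w) \<bullet> (- f) \<le> 1 + \<tau> * ((- f) \<bullet> f) ^ 4"
      using conjunct2[OF upper[OF that(1)], rule_format, of f] conjunct2[OF upper[OF that(1)], rule_format, of "- f"] f FE
      by (simp_all only: subspace_neg norm_minus_cancel)
    then show ?thesis using that ff by (simp add: inner_add_left abs_le_iff)
  qed
  obtain f0 where f0: "f = \<phi> f0" using f FE phi_surj by blast
  \<comment> \<open>The orthogonal complement of the axis within F, in coordinates. An orthonormal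
    basis of it together with \<open>f0\<close> spans the preimage of F.\<close>
  define G where "G = {y. \<phi> y \<in> F \<and> y \<bullet> f0 = 0}"
  have "subspace G"
    using FE(1) lin by (auto simp: G_def subspace_def linear_0 linear_add linear_cmul inner_add_left)
  from orthonormal_basis_subspace[OF this] obtain C where C: "pairwise orthogonal C" "\<And>x. x \<in> C \<Longrightarrow> norm x = 1"
    "independent C" "span C = G" by metis
  have nf0: "norm f0 = 1" using f f0 norm_phi by simp
  have CG: "C \<subseteq> G" using C(4) span_superset by blast
  have oC: "orthonormal (insert f0 C)"
    using C nf0 CG by (auto simp: orthonormal_def independent_imp_finite pairwise_insert orthogonal_def G_def inner_commute)
  have f0C: "f0 \<notin> C" using CG nf0 by (auto simp: G_def norm_eq_1)
  have spF: "\<phi> ` span (insert f0 C) = F"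
  proof
    have "insert f0 C \<subseteq> \<phi> -` F" using CG f f0 by (auto simp: G_def)
    then have "span (insert f0 C) \<subseteq> \<phi> -` F" using FE lin by (intro span_minimal linear_subspace_vimage)
    then show "\<phi> ` span (insert f0 C) \<subseteq> F" by auto
    show "F \<subseteq> \<phi> ` span (insert f0 C)"
    proof
      fix y assume y: "y \<in> F"
      then obtain y0 where y0: "y = \<phi> y0" using FE phi_surj by blast
      have "y0 - (y0 \<bullet> f0) *\<^sub>R f0 \<in> G"
        using y y0 f f0 FE nf0 by (simp add: G_def linear_diff[OF lin] linear_cmul[OF lin] subspace_diff subspace_scale inner_diff_left norm_eq_1)
      then have "y0 \<in> span (insert f0 C)" unfolding span_breakdown_eq C(4) by blast
      then show "y \<in> \<phi> ` span (insert f0 C)" using y0 by blast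
    qed
  qed
  have cC: "card C = k - 1"
  proof -
    have "card (insert f0 C) = card (\<phi> ` insert f0 C)"
      by (rule card_image[OF inj_on_phi, symmetric])
    also have "\<dots> = dim (span (\<phi> ` insert f0 C))"
      using oC orthonormal_phi orthonormal_card by blast
    also have "span (\<phi> ` insert f0 C) = F" by (simp only: span_phi spF)
    finally have "card (insert f0 C) = k" using FE(3) by simp
    then show ?thesis using f0C oC by (simp add: orthonormal_def)
  qed
  have "emeasure (onb_measure (insert f0 C)) (\<phi> -` ?A) = ennreal (unit_ball_vol (card C) * profile (card C + 1) \<tau>)"
  proof (rule emeasure_revolution[OF oC f0C _ \<tau>])
    show "\<phi> -` ?A \<in> sets borel" using measurable_sets[OF measurable_phi Ab] by simp
    have w: "\<phi> w \<in> F" "\<phi> w \<bullet> f = 0" if "w \<in> span C" for w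
      using that C(4) by (auto simp: G_def f0 inner_phi)
    show "slice_height \<tau> z *\<^sub>R f0 + w \<in> \<phi> -` ?A \<longleftrightarrow> norm w \<le> slice_radius \<tau> z" if "\<bar>z\<bar> < 1" "w \<in> span C" for z w
      using slice[OF that(1) w[OF that(2)]] by (simp add: linear_add[OF lin] linear_cmul[OF lin] f0 norm_phi)
    show "\<bar>z\<bar> \<le> 1 + \<tau>" if "w \<in> span C" "z *\<^sub>R f0 + w \<in> \<phi> -` ?A" for z w
      using bound[of z "\<phi> w"] w[OF that(1)] that(2) by (simp add: linear_add[OF lin] linear_cmul[OF lin] f0)
  qed
  moreover have "profile (card C + 1) \<tau> \<ge> 0"
  proof -
    have "0 < (1/2) ^ (card C + 1) * profile (card C + 1) 0" using cap_moment_0_pos by (simp add: profile_0)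
    then show ?thesis using profile_lower[OF _ \<tau>, of "card C + 1"] by linarith
  qed
  ultimately have "measure (onb_measure (insert f0 C)) (\<phi> -` ?A) = unit_ball_vol (card C) * profile (card C + 1) \<tau>"
    by (simp add: measure_def)
  then show ?thesis
    using vol_eq[OF oC Ab] spF cC k by (simp add: \<tau>_def a_def)
qed

text \<open>At t = 0 the body is the unit ball, and the volume formula then identifies the constant
  \<open>unit_ball_vol (k - 1) * profile k 0\<close> with the volume of the k-dimensional unit
  ball.\<close>

lemma vol_proj_bump_body':
  assumes F: "F \<in> grassmannian E k" and k: "k \<ge> 1" and e: "e \<in> E" "norm e = 1" and t: "t \<in> {0..1/6}"
  shows "vol F (orth_proj F ` bump_body E e t) = unit_ball_vol (real k) * rel_profile k (t * norm (orth_proj F e) ^ 4)"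
proof -
  have FE: "subspace F" "F \<subseteq> E" "dim F = k" using F by (auto simp: grassmannian_def)
  have "orth_proj F ` bump_body E e 0 = cball 0 1 \<inter> F"
    unfolding bump_body_0[OF subspace_E e(2)] by (rule orth_proj_cball[OF grassmannian_has_onb[OF F] FE(2)])
  then have "unit_ball_vol (real k) = unit_ball_vol (real (k - 1)) * profile k 0"
    using vol_proj_bump_body[OF F k e, of 0] vol_cball[OF FE(1,2), of 1] FE(3) by simp
  moreover have "profile k 0 \<noteq> 0" using cap_moment_0_pos[of k] by (simp add: profile_0)
  ultimately show ?thesis using vol_proj_bump_body[OF assms] by (simp add: rel_profile_def)
qed

lemma rel_profile_pos: "1 \<le> k \<Longrightarrow> \<tau> \<in> {0..1/6} \<Longrightarrow> rel_profile k \<tau> > 0"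
  using rel_profile_lower[of k \<tau>] zero_less_power[of "1/2 :: real" k] by linarith

text \<open>The choice F = E in the projection formula shows that the body has positive volume.
  Radii of balls of that volume are then positive and unique, as the description in
  \<open>vol_ball\<close> demands.\<close>

lemma vol_ball_bump_body:
  assumes e: "e \<in> E" "norm e = 1" and t: "t \<in> {0..1/6}"
  shows "\<exists>r>0. vol_ball E (bump_body E e t) = cball 0 r \<inter> E"
proof -
  let ?n = "CARD('n)" and ?K = "bump_body E e t"
  have n: "?n \<ge> 1" by (simp add: Suc_leI)
  have "E \<in> grassmannian E ?n" by (simp add: grassmannian_def subspace_E dim_E)
  moreover have "orth_proj E ` ?K = ?K" using orth_proj_id[OF has_onb_E] by (force simp: bump_body_def)
  ultimately have "vol E ?K = unit_ball_vol ?n * rel_profile ?n t"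
    using vol_proj_bump_body'[OF _ n e t, of E] orth_proj_id[OF has_onb_E e(1)] e(2) by simp
  then have V: "vol E ?K > 0" using rel_profile_pos[OF n t] by simp
  define r where "r = root ?n (vol E ?K / unit_ball_vol ?n)"
  have r: "r > 0" using V n by (simp add: r_def)
  have "r ^ ?n = vol E ?K / unit_ball_vol ?n" unfolding r_def using V n by (intro real_root_pow_pos2) auto
  then have vr: "vol E (cball 0 r \<inter> E) = vol E ?K"
    using vol_cball[OF subspace_E order_refl r] unit_ball_vol_pos[of "real ?n"] by (simp add: dim_E order.strict_implies_not_eq[symmetric])
  have uniq: "r' = r" if "r' \<ge> 0" "vol E (cball 0 r' \<inter> E) = vol E ?K" for r'
  proof -
    have "r' \<noteq> 0"
    proof
      assume "r' = 0"
      then have "cball 0 r' \<inter> E = {0}" using subspace_E by (auto simp: subspace_0)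
      then show False using that V vol_zero[OF subspace_E order_refl] n by (simp add: dim_E)
    qed
    then have r': "r' > 0" using that by simp
    then have "unit_ball_vol ?n * r' ^ ?n = unit_ball_vol ?n * r ^ ?n"
      using vol_cball[OF subspace_E order_refl r'] vol_cball[OF subspace_E order_refl r] vr that by (simp add: dim_E)
    then have "r' ^ ?n = r ^ ?n" using unit_ball_vol_pos[of "real ?n"] by (simp add: order.strict_implies_not_eq[symmetric])
    then show ?thesis using r r' n by (intro power_eq_imp_eq_base[of r' ?n r]) auto
  qed
  have "vol_ball E ?K = cball 0 r \<inter> E"
    unfolding vol_ball_def
  proof (rule the_equality)
    show "\<exists>ra\<ge>0. cball 0 r \<inter> E = cball 0 ra \<inter> E \<and> vol E (cball 0 r \<inter> E) = vol E ?K"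
      using r vr by (intro exI[of _ r]) auto
  qed (use uniq in auto)
  then show ?thesis using r by blast
qed

text \<open>The factor \<open>unit_ball_vol k\<close> cancels between body and ball, and the roots
  of order n and k turn the contribution r^k of the ball into a factor 1 / r common to all k.
  Comparing two indices thus means comparing powers of \<Phi>.\<close>

lemma I_fun_bump_body:
  assumes k: "1 \<le> k" "k \<le> CARD('n)" and e: "e \<in> E" "norm e = 1" and t: "t \<in> {0..1/6}"
    and r: "r > 0" "vol_ball E (bump_body E e t) = cball 0 r \<inter> E"
  defines "n \<equiv> CARD('n)"
    and "\<Phi> \<equiv> \<integral>F. inverse (rel_profile k (t * norm (orth_proj F e) ^ 4)) ^ CARD('n) \<partial>grassmann_measure E k"
  shows "\<Phi> > 0"
    and "I_fun E k (- real n) (bump_body E e t) powr (1 / real k) = inverse r * \<Phi> powr (- 1 / (real n * real k))"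
proof -
  let ?M = "grassmann_measure E k" and ?\<kappa> = "unit_ball_vol (real k)"
  interpret prob_space ?M by (rule prob_space_grassmann_measure[OF k(2)])
  note [measurable] = measurable_norm_orth_proj[OF k(2)]
  have n: "n \<ge> 1" unfolding n_def by (simp add: Suc_leI)
  have \<kappa>: "?\<kappa> > 0" by simp
  have \<tau>: "t * norm (orth_proj F e) ^ 4 \<in> {0..1/6}" if "F \<in> space ?M" for F
  proof -
    have "norm (orth_proj F e) \<le> 1" using norm_orth_proj_le[OF has_onb_grassmann[OF k(2) that], of e] e by simp
    then have "t * norm (orth_proj F e) ^ 4 \<le> t * 1" using t by (intro mult_left_mono power_le_one) auto
    then show ?thesis using t by auto
  qed
  let ?f = "\<lambda>F. inverse (rel_profile k (t * norm (orth_proj F e) ^ 4)) ^ n"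
  have fpos: "?f F > 0" if "F \<in> space ?M" for F using rel_profile_pos[OF k(1) \<tau>[OF that]] by simp
  have fle: "?f F \<le> inverse ((1/2) ^ k) ^ n" if "F \<in> space ?M" for F
    using rel_profile_lower[OF k(1) \<tau>[OF that]] rel_profile_pos[OF k(1) \<tau>[OF that]]
    by (intro power_mono le_imp_inverse_le) auto
  have int: "integrable ?M ?f"
    using fpos fle by (intro integrable_const_bound[of _ "inverse ((1/2) ^ k) ^ n"]) (auto simp: less_imp_le abs_of_pos)
  \<comment> \<open>The integrand is strictly positive everywhere, so a vanishing integral would
    contradict total mass 1.\<close>
  have "(\<integral>F. ?f F \<partial>?M) \<noteq> 0"
  proof
    assume "(\<integral>F. ?f F \<partial>?M) = 0"
    moreover have "AE F in ?M. 0 \<le> ?f F" by (rule AE_I2) (rule less_imp_le[OF fpos])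
    ultimately have "AE F in ?M. ?f F = 0"
      using integral_nonneg_eq_0_iff_AE[OF int] by (simp only:)
    then have "AE F in ?M. False" using AE_space by eventually_elim (metis fpos less_irrefl)
    then show False by simp
  qed
  moreover have "(\<integral>F. ?f F \<partial>?M) \<ge> 0" using fpos by (intro Bochner_Integration.integral_nonneg) (auto intro: less_imp_le)
  ultimately show \<Phi>: "\<Phi> > 0" by (simp add: \<Phi>_def n_def)
  have p1: "proj_moment E k (- real n) (bump_body E e t) = ?\<kappa> powr (- real n) * \<Phi>"
  proof -
    have "vol F (orth_proj F ` bump_body E e t) powr (- real n) = ?\<kappa> powr (- real n) * ?f F" if F: "F \<in> space ?M" for F
    proof -
      have "F \<in> grassmannian E k" using F space_grassmann_measure[OF k(2)] by simp
      then have "vol F (orth_proj F ` bump_body E e t) = ?\<kappa> * rel_profile k (t * norm (orth_proj F e) ^ 4)"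
        using k(1) e t by (rule vol_proj_bump_body')
      then show ?thesis using rel_profile_pos[OF k(1) \<tau>[OF F]] \<kappa>
        by (simp add: powr_mult powr_minus powr_realpow power_inverse)
    qed
    then have "proj_moment E k (- real n) (bump_body E e t) = (\<integral>F. ?\<kappa> powr (- real n) * ?f F \<partial>?M)"
      unfolding proj_moment_def by (intro Bochner_Integration.integral_cong) auto
    then show ?thesis by (simp add: \<Phi>_def n_def)
  qed
  have p2: "proj_moment E k (- real n) (cball 0 r \<inter> E) = (?\<kappa> * r ^ k) powr (- real n)"
  proof -
    have "vol F (orth_proj F ` (cball 0 r \<inter> E)) = ?\<kappa> * r ^ k" if F: "F \<in> space ?M" for F
    proof -
      have FG: "F \<in> grassmannian E k" using F space_grassmann_measure[OF k(2)] by simp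
      then have FE: "subspace F" "F \<subseteq> E" "dim F = k" by (auto simp: grassmannian_def)
      have "orth_proj F ` (cball 0 r \<inter> E) = cball 0 r \<inter> F"
        by (rule orth_proj_cball[OF grassmannian_has_onb[OF FG] FE(2)])
      then show ?thesis using vol_cball[OF FE(1,2) r(1)] FE(3) by simp
    qed
    then have "proj_moment E k (- real n) (cball 0 r \<inter> E) = (\<integral>F. (?\<kappa> * r ^ k) powr (- real n) \<partial>?M)"
      unfolding proj_moment_def by (intro Bochner_Integration.integral_cong) auto
    then show ?thesis by (simp add: prob_space)
  qed
  have "proj_moment E k (- real n) (bump_body E e t) / proj_moment E k (- real n) (cball 0 r \<inter> E)
      = \<Phi> * r powr (real k * real n)"
    unfolding p1 p2 using order.strict_implies_not_eq[OF \<kappa>] r(1)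
    by (simp add: powr_mult powr_minus powr_powr divide_inverse flip: powr_realpow)
  then have "I_fun E k (- real n) (bump_body E e t) = (\<Phi> * r powr (real k * real n)) powr (1 / - real n)"
    by (simp add: I_fun_def r(2))
  also have "\<dots> powr (1 / real k) = \<Phi> powr (1 / - real n * (1 / real k)) * r powr (real k * real n * (1 / - real n * (1 / real k)))"
    using \<Phi> r by (simp add: powr_mult powr_powr)
  also have "real k * real n * (1 / - real n * (1 / real k)) = - 1" using k n by simp
  also have "1 / - real n * (1 / real k) = - 1 / (real n * real k)" by simp
  finally show "I_fun E k (- real n) (bump_body E e t) powr (1 / real k) = inverse r * \<Phi> powr (- 1 / (real n * real k))"
    using r by (simp add: powr_minus mult.commute)
qed

text \<open>Taking logarithms, dividing by n m k and changing sign turns \<Phi> k ^ m < \<Phi> m ^ k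
  into the claim: the exponent -1 / n reverses the inequality between moments.\<close>

theorem bump_body_reverses:
  assumes mk: "1 \<le> m" "m < k" "k \<le> CARD('n)" "(m + 2) * (k + 2) < CARD('n) + 2"
  shows "\<exists>e t. norm e = 1 \<and> t \<in> {0..1/6} \<and>
    I_fun E m (- real CARD('n)) (bump_body E e t) powr (1 / real m)
      < I_fun E k (- real CARD('n)) (bump_body E e t) powr (1 / real k)"
proof -
  let ?n = "CARD('n)"
  obtain b :: "real ^ 'n" where "b \<in> Basis" using nonempty_Basis by blast
  then have e: "\<phi> b \<in> E" "norm (\<phi> b) = 1" by (auto simp: norm_phi)
  define e where "e = \<phi> b"
  note e = e[folded e_def]
  have k: "1 \<le> k" "m \<le> ?n" using mk by auto
  have r01: "0 \<le> norm (orth_proj F e) \<and> norm (orth_proj F e) \<le> 1" if "j \<le> ?n" "F \<in> space (grassmann_measure E j)" for F j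
    using norm_orth_proj_le[OF has_onb_grassmann[OF that], of e] e by simp
  obtain t where t: "0 < t" "t \<le> 1/6"
    "(\<integral>F. inverse (rel_profile k (t * norm (orth_proj F e) ^ 4)) ^ ?n \<partial>grassmann_measure E k) ^ m
     < (\<integral>F. inverse (rel_profile m (t * norm (orth_proj F e) ^ 4)) ^ ?n \<partial>grassmann_measure E m) ^ k"
    using profile_moment_less[where M = "grassmann_measure E m" and M' = "grassmann_measure E k"
        and a = "\<lambda>F. norm (orth_proj F e)" and a' = "\<lambda>F. norm (orth_proj F e)",
        OF prob_space_grassmann_measure[OF k(2)] measurable_norm_orth_proj[OF k(2)] r01[OF k(2)]
          prob_space_grassmann_measure[OF mk(3)] measurable_norm_orth_proj[OF mk(3)] r01[OF mk(3)]
          mk(1,2,4) proj_moments[OF k(2) e] proj_moments[OF mk(3) e]] by blast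
  define \<Phi> where "\<Phi> j = (\<integral>F. inverse (rel_profile j (t * norm (orth_proj F e) ^ 4)) ^ ?n \<partial>grassmann_measure E j)" for j
  have tt: "t \<in> {0..1/6}" using t by simp
  obtain r where r: "r > 0" "vol_ball E (bump_body E e t) = cball 0 r \<inter> E"
    using vol_ball_bump_body[OF e tt] by blast
  note Im = I_fun_bump_body[OF mk(1) k(2) e tt r, folded \<Phi>_def]
  note Ik = I_fun_bump_body[OF k(1) mk(3) e tt r, folded \<Phi>_def]
  have "ln (\<Phi> k ^ m) < ln (\<Phi> m ^ k)" using t(3) Im(1) Ik(1) by (simp add: \<Phi>_def)
  then have l: "real m * ln (\<Phi> k) < real k * ln (\<Phi> m)" using Im(1) Ik(1) by (simp add: ln_realpow)
  have "- 1 / (real ?n * real m) * ln (\<Phi> m) < - 1 / (real ?n * real k) * ln (\<Phi> k)"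
    using l mk by (simp add: divide_simps) (simp add: mult_ac)
  then have "\<Phi> m powr (- 1 / (real ?n * real m)) < \<Phi> k powr (- 1 / (real ?n * real k))"
    using Im(1) Ik(1) by (simp add: powr_def)
  then have "inverse r * \<Phi> m powr (- 1 / (real ?n * real m)) < inverse r * \<Phi> k powr (- 1 / (real ?n * real k))"
    using r by simp
  then show ?thesis using Im(2) Ik(2) e tt by (intro exI[of _ e] exI[of _ t] conjI) (simp_all only:)
qed

end

section \<open>The two ambient spaces and the conclusion\<close>

lemma linear_isometry_id: "linear_isometry (\<lambda>x :: real ^ 'n. x) UNIV"
  by unfold_locales auto

lemma coord_space_isometry: "\<exists>\<phi> :: real ^ 'n \<Rightarrow> fseq. linear_isometry \<phi> (coord_space CARD('n))"
proof -
  obtain g where g: "bij_betw g (UNIV :: 'n set) {..<CARD('n)}"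
    using ex_bij_betw_finite_nat[of "UNIV :: 'n set"] by (auto simp: atLeast0LessThan)
  have gi: "g i = g j \<longleftrightarrow> i = j" for i j using g by (auto simp: bij_betw_def inj_eq)
  have gn: "g i < CARD('n)" for i using g by (auto simp: bij_betw_def)
  define \<phi> where "\<phi> x = (\<Sum>i\<in>UNIV. x $ i *\<^sub>R funit (g i))" for x :: "real ^ 'n"
  have c: "fcoord (\<phi> x) (g i) = x $ i" for x i
    by (simp add: \<phi>_def gi if_distrib[of "\<lambda>c. _ * c"] cong: if_cong)
  have c0: "fcoord (\<phi> x) j = 0" if "j \<ge> CARD('n)" for x j
  proof -
    have "j \<noteq> g i" for i using gn[of i] that by simp
    then show ?thesis by (simp add: \<phi>_def)
  qed
  have "linear_isometry \<phi> (coord_space CARD('n))"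
  proof (rule linear_isometry.intro)
    show "linear \<phi>" by (auto simp: linear_iff \<phi>_def scaleR_add_left sum.distrib scaleR_sum_right)
    fix x
    have "\<phi> x \<bullet> \<phi> x = (\<Sum>j<CARD('n). fcoord (\<phi> x) j * fcoord (\<phi> x) j)"
      by (rule inner_fseq_superset) (use c0 in \<open>auto simp: not_le[symmetric]\<close>)
    also have "\<dots> = (\<Sum>i\<in>UNIV. fcoord (\<phi> x) (g i) * fcoord (\<phi> x) (g i))"
      by (rule sum.reindex_bij_betw[OF g, symmetric])
    also have "\<dots> = x \<bullet> x" by (simp add: c inner_vec_def)
    finally show "norm (\<phi> x) = norm x" by (simp add: norm_eq_sqrt_inner)
  next
    show "range \<phi> = coord_space CARD('n)"
    proof
      show "range \<phi> \<subseteq> coord_space CARD('n)" using c0 by (auto simp: coord_space_def)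
      show "coord_space CARD('n) \<subseteq> range \<phi>"
      proof
        fix y assume y: "y \<in> coord_space CARD('n)"
        have "\<phi> (\<chi> i. fcoord y (g i)) = y"
        proof (rule fseq_eqI)
          fix j
          show "fcoord (\<phi> (\<chi> i. fcoord y (g i))) j = fcoord y j"
          proof (cases "j < CARD('n)")
            case True
            then obtain i where "j = g i" using g by (auto simp: bij_betw_def)
            then show ?thesis by (simp add: c)
          qed (use y c0 in \<open>auto simp: coord_space_def\<close>)
        qed
        then show "y \<in> range \<phi>" by (metis rangeI)
      qed
    qed
  qed
  then show ?thesis by blast
qed

theorem theorem1p1:
  shows "(\<forall>m k. 1 \<le> m \<and> m < k \<and> k \<le> CARD('n::finite) - 1 \<and>
                CARD('n) > (m + 2) * (k + 2) - 2 \<longrightarrow>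
           (\<exists>K :: (real ^ 'n) set.
              convex_body_in UNIV K \<and> origin_symmetric K \<and> C2_plus UNIV K \<and>
              I_fun UNIV m (- real CARD('n)) K powr (1 / real m)
                < I_fun UNIV k (- real CARD('n)) K powr (1 / real k))) \<and>
         \<not> (\<forall>n\<ge>1. \<forall>K. convex_body_in (coord_space n) K \<longrightarrow> I_chain (coord_space n) (- real n) K)"
proof (intro conjI allI impI)
  fix m k :: nat
  assume mk: "1 \<le> m \<and> m < k \<and> k \<le> CARD('n) - 1 \<and> CARD('n) > (m + 2) * (k + 2) - 2"
  interpret linear_isometry "\<lambda>x :: real ^ 'n. x" UNIV by (rule linear_isometry_id)
  \<comment> \<open>This rearrangement is valid for truncated subtraction as well.\<close>
  have "(m + 2) * (k + 2) < CARD('n) + 2" using mk by linarith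
  then obtain e t where et: "norm e = 1" "t \<in> {0..1/6}"
    "I_fun UNIV m (- real CARD('n)) (bump_body UNIV e t) powr (1 / real m)
      < I_fun UNIV k (- real CARD('n)) (bump_body (UNIV :: (real ^ 'n) set) e t) powr (1 / real k)"
    using bump_body_reverses[of m k] mk by auto
  have "C2_plus UNIV (bump_body UNIV e t)"
    using et by (intro C2_plus_bump[of e t] support_fun_bump_body) auto
  then show "\<exists>K :: (real ^ 'n) set.
              convex_body_in UNIV K \<and> origin_symmetric K \<and> C2_plus UNIV K \<and>
              I_fun UNIV m (- real CARD('n)) K powr (1 / real m)
                < I_fun UNIV k (- real CARD('n)) K powr (1 / real k)"
    using et convex_body_bump[of e t] bump_body_symmetric[OF subspace_UNIV] by auto
next
  \<comment> \<open>For m = 1 and k = 2 the condition reads n > 3 * 4 - 2 = 10, so dimension 11 is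
    the first one covered; the first link of the chain fails there.\<close>
  obtain \<phi> :: "real ^ 11 \<Rightarrow> fseq" where "linear_isometry \<phi> (coord_space CARD(11))"
    using coord_space_isometry by blast
  then interpret linear_isometry \<phi> "coord_space 11" by simp
  obtain e t where et: "norm e = 1" "t \<in> {0..1/6}"
    "I_fun (coord_space 11) 1 (- real 11) (bump_body (coord_space 11) e t) powr (1 / real 1)
      < I_fun (coord_space 11) 2 (- real 11) (bump_body (coord_space 11) e t) powr (1 / real 2)"
    using bump_body_reverses[of 1 2] by auto
  then have "\<not> I_chain (coord_space 11) (- real 11) (bump_body (coord_space 11) e t)"
    unfolding I_chain_def dim_coord_space by (auto simp: not_le numeral_2_eq_2 intro!: exI[of _ 1])
  moreover have "convex_body_in (coord_space 11) (bump_body (coord_space 11) e t)"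
    using et by (intro convex_body_bump) auto
  ultimately show "\<not> (\<forall>n\<ge>1. \<forall>K. convex_body_in (coord_space n) K \<longrightarrow> I_chain (coord_space n) (- real n) K)"
    by (metis one_le_numeral)
qed

end
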